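(* Suppose that $n\ge3$ and $\mathbf{char}(q)=\ell\ge3$. Then for every integer $s\ge0$ the $\mathfrak u_q(\mathfrak{sl}_n)$-submodule $\mathcal A_q^{(s)}(n)$ of $\mathcal A_q(n)$ is indecomposable and rigid.
   Context: $k$ is an algebraically closed field of characteristic $0$ and $q\in k^*$, $q\ne\pm1$. $[a]=\frac{q^a-q^{-a}}{q-q^{-1}}$ for $a\in\mathbb Z$; $\mathbf{char}(q)$ is the smallest positive integer $\ell$ with $[\ell]=0$ (so $q$ is either a primitive $2\ell$-th root of unity, or $\ell$ is odd and $q$ is a primitive $\ell$-th root of unity). $U_q(\mathfrak{sl}_n)$ is the usual quantum group with generators $e_i,f_i,K_i^{\pm1}$ ($1\le i\le n-1$), and $\mathfrak u_q(\mathfrak{sl}_n)=U_q(\mathfrak{sl}_n)/(e_i^\ell,f_i^\ell,K_i^{2\ell}-1)$. $\mathcal A_q(n)$ is the $k$-vector space with basis $\{x^{(\alpha)}\mid\alpha\in\mathbb Z_+^n\}$ ($\mathbb Z_+$ = nonnegative integers), with $\mathfrak u_q(\mathfrak{sl}_n)$-action (where $x^{(\beta)}:=0$ if $\beta\notin\mathbb Z_+^n$, and $\varepsilon_i$ is the $i$-th unit vector) $$e_i.x^{(\beta)}=[\beta_i+1]x^{(\beta+\varepsilon_i-\varepsilon_{i+1})},\quad f_i.x^{(\beta)}=[\beta_{i+1}+1]x^{(\beta-\varepsilon_i+\varepsilon_{i+1})},\quad K_i^{\pm1}.x^{(\beta)}=q^{\pm(\beta_i-\beta_{i+1})}x^{(\beta)}.$$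 $\mathcal A_q^{(s)}(n)=\mathrm{span}_k\{x^{(\alpha)}\mid\alpha\in\mathbb Z_+^n,\ \sum_i\alpha_i=s\}$ is the $s$-th homogeneous subspace, a submodule. A finite-dimensional module $M$ of Loewy length $r$ is rigid if its socle filtration and radical filtration coincide, i.e. $\mathrm{Rad}^{r-k}M=\mathrm{Soc}^kM$ for $0\le k\le r$. *)

theory Defs
  imports
    "HOL-Computational_Algebra.Polynomial"
    "HOL-Library.Poly_Mapping"
    "HOL-Algebra.QuotRing"
    "HOL-Algebra.Module"
begin

section \<open>Left modules over arbitrary rings\<close>

text \<open>The locale \<^locale>\<open>module\<close> requires a commutative ring of scalars; the record type and the locale
  \<^locale>\<open>submodule\<close> do not and are reused.\<close>

locale left_module = R?: ring R + M?: abelian_group M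
  for R (structure) and M :: "('a, 'b, 'c) module_scheme" (structure) +
  assumes smult_closed:
      "\<lbrakk>a \<in> carrier R; x \<in> carrier M\<rbrakk> \<Longrightarrow> a \<odot>\<^bsub>M\<^esub> x \<in> carrier M"
    and smult_l_distr:
      "\<lbrakk>a \<in> carrier R; b \<in> carrier R; x \<in> carrier M\<rbrakk>
        \<Longrightarrow> (a \<oplus>\<^bsub>R\<^esub> b) \<odot>\<^bsub>M\<^esub> x = a \<odot>\<^bsub>M\<^esub> x \<oplus>\<^bsub>M\<^esub> b \<odot>\<^bsub>M\<^esub> x"
    and smult_r_distr:
      "\<lbrakk>a \<in> carrier R; x \<in> carrier M; y \<in> carrier M\<rbrakk>
        \<Longrightarrow> a \<odot>\<^bsub>M\<^esub> (x \<oplus>\<^bsub>M\<^esub> y) = a \<odot>\<^bsub>M\<^esub> x \<oplus>\<^bsub>M\<^esub> a \<odot>\<^bsub>M\<^esub> y"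
    and smult_assoc:
      "\<lbrakk>a \<in> carrier R; b \<in> carrier R; x \<in> carrier M\<rbrakk>
        \<Longrightarrow> (a \<otimes>\<^bsub>R\<^esub> b) \<odot>\<^bsub>M\<^esub> x = a \<odot>\<^bsub>M\<^esub> (b \<odot>\<^bsub>M\<^esub> x)"
    and smult_one: "x \<in> carrier M \<Longrightarrow> \<one>\<^bsub>R\<^esub> \<odot>\<^bsub>M\<^esub> x = x"

lemma left_module_submodule:
  assumes M: "left_module R M" and H: "submodule H R M"
  shows "left_module R (M\<lparr>carrier := H\<rparr>)"
proof -
  interpret left_module R M by fact
  interpret H: submodule H R M by fact
  have am: "abelian_monoid (M\<lparr>carrier := H\<rparr>)"
    using comm_monoid.submonoid_is_comm_monoid[OF M.a_comm_monoid H.subgroup_is_submonoid]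
    by (auto simp: abelian_monoid_def)
  have "group ((add_monoid M)\<lparr>carrier := H\<rparr>)"
    by (rule H.subgroup_is_group[OF M.add.group_axioms])
  then have ag: "abelian_group (M\<lparr>carrier := H\<rparr>)"
    using am by (simp add: abelian_group_def abelian_group_axioms_def comm_group_def
        abelian_monoid_def)
  have sub: "x \<in> carrier M" if "x \<in> H" for x
    using that H.subset by auto
  have "left_module_axioms R (M\<lparr>carrier := H\<rparr>)"
    by (rule left_module_axioms.intro)
      (simp_all add: H.smult_closed sub smult_l_distr smult_r_distr smult_assoc smult_one)
  then show ?thesis
    by (rule left_module.intro[OF R.ring_axioms ag])
qed

definition simple_module :: "('a, 'r) ring_scheme \<Rightarrow> ('a, 'b, 'm) module_scheme \<Rightarrow> bool" where
  "simple_module R M \<longleftrightarrow> carrier M \<noteq> {\<zero>\<^bsub>M\<^esub>} \<and>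
     (\<forall>N. submodule N R M \<longrightarrow> N = {\<zero>\<^bsub>M\<^esub>} \<or> N = carrier M)"

definition indecomposable_module ::
    "('a, 'r) ring_scheme \<Rightarrow> ('a, 'b, 'm) module_scheme \<Rightarrow> bool" where
  "indecomposable_module R M \<longleftrightarrow> carrier M \<noteq> {\<zero>\<^bsub>M\<^esub>} \<and>
     \<not> (\<exists>N L. submodule N R M \<and> submodule L R M \<and> N \<noteq> {\<zero>\<^bsub>M\<^esub>} \<and> L \<noteq> {\<zero>\<^bsub>M\<^esub>} \<and>
           N \<inter> L = {\<zero>\<^bsub>M\<^esub>} \<and> N <+>\<^bsub>M\<^esub> L = carrier M)"

text \<open>The sum of the simple submodules, as the least submodule containing all of them.\<close>

definition socle :: "('a, 'r) ring_scheme \<Rightarrow> ('a, 'b, 'm) module_scheme \<Rightarrow> 'b set" where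
  "socle R M = \<Inter>{H. submodule H R M \<and>
     (\<forall>S. submodule S R M \<and> simple_module R (M\<lparr>carrier := S\<rparr>) \<longrightarrow> S \<subseteq> H)}"

definition maximal_submodule ::
    "'b set \<Rightarrow> ('a, 'r) ring_scheme \<Rightarrow> ('a, 'b, 'm) module_scheme \<Rightarrow> bool" where
  "maximal_submodule N R M \<longleftrightarrow> submodule N R M \<and> N \<noteq> carrier M \<and>
     (\<forall>L. submodule L R M \<and> N \<subseteq> L \<longrightarrow> L = N \<or> L = carrier M)"

definition radical :: "('a, 'r) ring_scheme \<Rightarrow> ('a, 'b, 'm) module_scheme \<Rightarrow> 'b set" where
  "radical R M = carrier M \<inter> \<Inter>{N. maximal_submodule N R M}"

text \<open>The fields \<open>mult\<close> and \<open>one\<close> of a module record carry no meaning.\<close>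

definition quotient_module :: "('a, 'b, 'm) module_scheme \<Rightarrow> 'b set \<Rightarrow> ('a, 'b set) module" where
  "quotient_module M N =
     \<lparr>carrier = a_rcosets\<^bsub>M\<^esub> N, mult = undefined, one = undefined,
      zero = N, add = set_add M, smult = (\<lambda>a X. \<Union>x\<in>X. N +>\<^bsub>M\<^esub> (a \<odot>\<^bsub>M\<^esub> x))\<rparr>"

primrec socle_series ::
    "('a, 'r) ring_scheme \<Rightarrow> ('a, 'b, 'm) module_scheme \<Rightarrow> nat \<Rightarrow> 'b set" where
  "socle_series R M 0 = {\<zero>\<^bsub>M\<^esub>}"
| "socle_series R M (Suc j) =
     {x \<in> carrier M. socle_series R M j +>\<^bsub>M\<^esub> x
        \<in> socle R (quotient_module M (socle_series R M j))}"

primrec radical_series ::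
    "('a, 'r) ring_scheme \<Rightarrow> ('a, 'b, 'm) module_scheme \<Rightarrow> nat \<Rightarrow> 'b set" where
  "radical_series R M 0 = carrier M"
| "radical_series R M (Suc j) = radical R (M\<lparr>carrier := radical_series R M j\<rparr>)"

text \<open>For modules of finite length this is also the least \<open>r\<close> at which the socle series reaches
  the whole module.\<close>

definition loewy_length :: "('a, 'r) ring_scheme \<Rightarrow> ('a, 'b, 'm) module_scheme \<Rightarrow> nat" where
  "loewy_length R M = (LEAST r. radical_series R M r = {\<zero>\<^bsub>M\<^esub>})"

definition rigid_module :: "('a, 'r) ring_scheme \<Rightarrow> ('a, 'b, 'm) module_scheme \<Rightarrow> bool" where
  "rigid_module R M \<longleftrightarrow>
     (\<forall>j\<le>loewy_length R M. radical_series R M (loewy_length R M - j) = socle_series R M j)"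


section \<open>Quantum integers\<close>

definition qint :: "'k::field \<Rightarrow> int \<Rightarrow> 'k" where
  "qint q a = (q powi a - q powi (- a)) / (q - inverse q)"

text \<open>The value is \<open>0\<close> if no positive quantum integer vanishes.\<close>

definition qchar :: "'k::field \<Rightarrow> nat" where
  "qchar q = (if \<exists>l>0. qint q (int l) = 0 then LEAST l. l > 0 \<and> qint q (int l) = 0 else 0)"


section \<open>The quantum groups\<close>

datatype gen = GenE nat | GenF nat | GenK nat | GenKinv nat

fun gen_index :: "gen \<Rightarrow> nat" where
  "gen_index (GenE i) = i"
| "gen_index (GenF i) = i"
| "gen_index (GenK i) = i"
| "gen_index (GenKinv i) = i"

text \<open>Concatenation of words is written additively, because the convolution product on
  finitely supported functions is available for exponents in \<^class>\<open>monoid_add\<close>. Thus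
  \<open>word \<Rightarrow>\<^sub>0 'k\<close> is the free associative algebra on the generators.\<close>

datatype word = Word (letters: "gen list")

instantiation word :: monoid_add
begin

definition zero_word :: word where "0 = Word []"
definition plus_word :: "word \<Rightarrow> word \<Rightarrow> word" where "u + v = Word (letters u @ letters v)"

instance
  by standard (simp_all add: zero_word_def plus_word_def)

end

lemma letters_zero [simp]: "letters 0 = []"
  by (simp add: zero_word_def)

lemma letters_plus [simp]: "letters (u + v) = letters u @ letters v"
  by (simp add: plus_word_def)

definition scal :: "'k::field \<Rightarrow> ('a \<Rightarrow>\<^sub>0 'k) \<Rightarrow> ('a \<Rightarrow>\<^sub>0 'k)" where
  "scal c p = Poly_Mapping.map ((*) c) p"

definition lin_ext :: "('a \<Rightarrow> ('b \<Rightarrow>\<^sub>0 'k)) \<Rightarrow> ('a \<Rightarrow>\<^sub>0 'k) \<Rightarrow> ('b \<Rightarrow>\<^sub>0 'k::field)" where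
  "lin_ext f v = (\<Sum>a\<in>Poly_Mapping.keys v. scal (Poly_Mapping.lookup v a) (f a))"

definition free_alg :: "nat \<Rightarrow> (word \<Rightarrow>\<^sub>0 'k::field) ring" where
  "free_alg n =
     \<lparr>carrier = {p. \<forall>w\<in>Poly_Mapping.keys p. gen_index ` set (letters w) \<subseteq> {1..<n}},
      mult = (*), one = 1, zero = 0, add = (+)\<rparr>"

definition gE :: "nat \<Rightarrow> (word \<Rightarrow>\<^sub>0 'k::field)" where
  "gE i = Poly_Mapping.single (Word [GenE i]) 1"
definition gF :: "nat \<Rightarrow> (word \<Rightarrow>\<^sub>0 'k::field)" where
  "gF i = Poly_Mapping.single (Word [GenF i]) 1"
definition gK :: "nat \<Rightarrow> (word \<Rightarrow>\<^sub>0 'k::field)" where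
  "gK i = Poly_Mapping.single (Word [GenK i]) 1"
definition gKinv :: "nat \<Rightarrow> (word \<Rightarrow>\<^sub>0 'k::field)" where
  "gKinv i = Poly_Mapping.single (Word [GenKinv i]) 1"

definition adjacent :: "nat \<Rightarrow> nat \<Rightarrow> bool" where
  "adjacent i j \<longleftrightarrow> j = Suc i \<or> i = Suc j"

definition cartan :: "nat \<Rightarrow> nat \<Rightarrow> int" where
  "cartan i j = (if i = j then 2 else if adjacent i j then -1 else 0)"

text \<open>An element \<open>p\<close> of the set stands for the relation \<open>p = 0\<close>.\<close>

definition Uq_relations :: "nat \<Rightarrow> 'k::field \<Rightarrow> (word \<Rightarrow>\<^sub>0 'k) set" where
  "Uq_relations n q =
     (\<Union>i\<in>{1..<n}. {gK i * gKinv i - 1, gKinv i * gK i - 1}) \<union>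
     (\<Union>i\<in>{1..<n}. \<Union>j\<in>{1..<n}.
        {gK i * gK j - gK j * gK i,
         gK i * gE j * gKinv i - scal (q powi cartan i j) (gE j),
         gK i * gF j * gKinv i - scal (q powi (- cartan i j)) (gF j),
         gE i * gF j - gF j * gE i
           - (if i = j then scal (inverse (q - inverse q)) (gK i - gKinv i) else 0)}) \<union>
     (\<Union>i\<in>{1..<n}. \<Union>j\<in>{j\<in>{1..<n}. j \<noteq> i \<and> \<not> adjacent i j}.
        {gE i * gE j - gE j * gE i, gF i * gF j - gF j * gF i}) \<union>
     (\<Union>i\<in>{1..<n}. \<Union>j\<in>{j\<in>{1..<n}. adjacent i j}.
        {gE i * gE i * gE j - scal (q + inverse q) (gE i * gE j * gE i) + gE j * gE i * gE i,
         gF i * gF i * gF j - scal (q + inverse q) (gF i * gF j * gF i) + gF j * gF i * gF i})"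

definition Uq_ideal :: "nat \<Rightarrow> 'k::field \<Rightarrow> (word \<Rightarrow>\<^sub>0 'k) set" where
  "Uq_ideal n q = Idl\<^bsub>free_alg n\<^esub> (Uq_relations n q)"

definition Uq :: "nat \<Rightarrow> 'k::field \<Rightarrow> (word \<Rightarrow>\<^sub>0 'k) set ring" where
  "Uq n q = free_alg n Quot Uq_ideal n q"

definition small_relations :: "nat \<Rightarrow> nat \<Rightarrow> (word \<Rightarrow>\<^sub>0 'k::field) set" where
  "small_relations n l = (\<Union>i\<in>{1..<n}. {gE i ^ l, gF i ^ l, gK i ^ (2 * l) - 1})"

definition small_ideal :: "nat \<Rightarrow> 'k::field \<Rightarrow> nat \<Rightarrow> (word \<Rightarrow>\<^sub>0 'k) set set" where
  "small_ideal n q l =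
     Idl\<^bsub>Uq n q\<^esub> ((\<lambda>p. Uq_ideal n q +>\<^bsub>free_alg n\<^esub> p) ` small_relations n l)"

definition small_uq :: "nat \<Rightarrow> 'k::field \<Rightarrow> nat \<Rightarrow> (word \<Rightarrow>\<^sub>0 'k) set set ring" where
  "small_uq n q l = Uq n q Quot small_ideal n q l"


section \<open>The quantum divided power algebra as a module\<close>

text \<open>A multi-index \<open>\<alpha>\<close> is a function vanishing outside of \<open>{1..n}\<close>, and the basis vector
  \<open>x\<^sup>(\<^sup>\<alpha>\<^sup>)\<close> is \<open>Poly_Mapping.single \<alpha> 1\<close>.\<close>

definition multi_indices :: "nat \<Rightarrow> (nat \<Rightarrow> nat) set" where
  "multi_indices n = {\<alpha>. \<forall>i. i \<notin> {1..n} \<longrightarrow> \<alpha> i = 0}"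

fun gen_basis :: "'k::field \<Rightarrow> gen \<Rightarrow> (nat \<Rightarrow> nat) \<Rightarrow> ((nat \<Rightarrow> nat) \<Rightarrow>\<^sub>0 'k)" where
  "gen_basis q (GenE i) \<beta> =
     (if \<beta> (i + 1) = 0 then 0
      else Poly_Mapping.single (\<beta>(i := \<beta> i + 1, i + 1 := \<beta> (i + 1) - 1)) (qint q (int (\<beta> i) + 1)))"
| "gen_basis q (GenF i) \<beta> =
     (if \<beta> i = 0 then 0
      else Poly_Mapping.single (\<beta>(i := \<beta> i - 1, i + 1 := \<beta> (i + 1) + 1))
             (qint q (int (\<beta> (i + 1)) + 1)))"
| "gen_basis q (GenK i) \<beta> = Poly_Mapping.single \<beta> (q powi (int (\<beta> i) - int (\<beta> (i + 1))))"
| "gen_basis q (GenKinv i) \<beta> = Poly_Mapping.single \<beta> (q powi (- (int (\<beta> i) - int (\<beta> (i + 1)))))"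

definition gen_act ::
    "'k::field \<Rightarrow> gen \<Rightarrow> ((nat \<Rightarrow> nat) \<Rightarrow>\<^sub>0 'k) \<Rightarrow> ((nat \<Rightarrow> nat) \<Rightarrow>\<^sub>0 'k)" where
  "gen_act q g = lin_ext (gen_basis q g)"

definition word_act ::
    "'k::field \<Rightarrow> word \<Rightarrow> ((nat \<Rightarrow> nat) \<Rightarrow>\<^sub>0 'k) \<Rightarrow> ((nat \<Rightarrow> nat) \<Rightarrow>\<^sub>0 'k)" where
  "word_act q w v = foldr (gen_act q) (letters w) v"

definition free_act ::
    "'k::field \<Rightarrow> (word \<Rightarrow>\<^sub>0 'k) \<Rightarrow> ((nat \<Rightarrow> nat) \<Rightarrow>\<^sub>0 'k) \<Rightarrow> ((nat \<Rightarrow> nat) \<Rightarrow>\<^sub>0 'k)" where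
  "free_act q p v = lin_ext (\<lambda>w. word_act q w v) p"

text \<open>An element of \<^const>\<open>small_uq\<close> is a coset of cosets; any representative in the free algebra
  acts in the same way (lemma \<open>small_act_eq\<close> below).\<close>

definition small_act ::
    "'k::field \<Rightarrow> (word \<Rightarrow>\<^sub>0 'k) set set \<Rightarrow> ((nat \<Rightarrow> nat) \<Rightarrow>\<^sub>0 'k) \<Rightarrow> ((nat \<Rightarrow> nat) \<Rightarrow>\<^sub>0 'k)" where
  "small_act q C v = (THE w. \<forall>p\<in>\<Union>C. free_act q p v = w)"

definition Aq ::
    "nat \<Rightarrow> 'k::field \<Rightarrow> ((word \<Rightarrow>\<^sub>0 'k) set set, (nat \<Rightarrow> nat) \<Rightarrow>\<^sub>0 'k) module" where
  "Aq n q =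
     \<lparr>carrier = {v. Poly_Mapping.keys v \<subseteq> multi_indices n}, mult = undefined, one = undefined,
      zero = 0, add = (+), smult = small_act q\<rparr>"

definition Aq_homogeneous :: "nat \<Rightarrow> nat \<Rightarrow> ((nat \<Rightarrow> nat) \<Rightarrow>\<^sub>0 'k::field) set" where
  "Aq_homogeneous n s =
     {v. Poly_Mapping.keys v \<subseteq> {\<alpha> \<in> multi_indices n. (\<Sum>i=1..n. \<alpha> i) = s}}"


section \<open>The action is well defined\<close>

lemma lookup_scal [simp]: "Poly_Mapping.lookup (scal c p) a = c * Poly_Mapping.lookup p a"
  by (simp add: scal_def Poly_Mapping.map.rep_eq when_def)

lemma scal_0_right [simp]: "scal c 0 = 0"
  and scal_0_left [simp]: "scal 0 p = 0"
  and scal_1 [simp]: "scal 1 p = p"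
  and scal_scal [simp]: "scal c (scal d p) = scal (c * d) p"
  and scal_add_right: "scal c (p + p') = scal c p + scal c p'"
  and scal_diff_right: "scal c (p - p') = scal c p - scal c p'"
  and scal_add_left: "scal (c + d) p = scal c p + scal d p"
  and scal_diff_left: "scal (c - d) p = scal c p - scal d p"
  and scal_single [simp]: "scal c (Poly_Mapping.single a d) = Poly_Mapping.single a (c * d)"
  by (rule poly_mapping_eqI; simp add: lookup_add lookup_minus lookup_single algebra_simps when_def)+

lemma keys_scal: "Poly_Mapping.keys (scal c p) \<subseteq> Poly_Mapping.keys p"
  by (rule subsetI) (simp add: in_keys_iff)

lemma scal_sum: "scal c (\<Sum>a\<in>A. f a) = (\<Sum>a\<in>A. scal c (f a))"
  by (induction A rule: infinite_finite_induct) (simp_all add: scal_add_right)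

lemma lin_ext_superset:
  assumes "finite A" "Poly_Mapping.keys v \<subseteq> A"
  shows "lin_ext f v = (\<Sum>a\<in>A. scal (Poly_Mapping.lookup v a) (f a))"
  unfolding lin_ext_def
  by (rule sum.mono_neutral_left[OF assms]) (simp add: in_keys_iff)

lemma lin_ext_add: "lin_ext f (u + v) = lin_ext f u + lin_ext f v"
proof -
  let ?A = "Poly_Mapping.keys u \<union> Poly_Mapping.keys v"
  have A: "finite ?A" by simp
  have "lin_ext f (u + v) = (\<Sum>a\<in>?A. scal (Poly_Mapping.lookup (u + v) a) (f a))"
    by (rule lin_ext_superset[OF A Poly_Mapping.keys_add])
  also have "\<dots> = (\<Sum>a\<in>?A. scal (Poly_Mapping.lookup u a) (f a))
      + (\<Sum>a\<in>?A. scal (Poly_Mapping.lookup v a) (f a))"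
    unfolding lookup_add scal_add_left sum.distrib ..
  also have "(\<Sum>a\<in>?A. scal (Poly_Mapping.lookup u a) (f a)) = lin_ext f u"
    by (rule lin_ext_superset[OF A Un_upper1, symmetric])
  also have "(\<Sum>a\<in>?A. scal (Poly_Mapping.lookup v a) (f a)) = lin_ext f v"
    by (rule lin_ext_superset[OF A Un_upper2, symmetric])
  finally show ?thesis .
qed

lemma lin_ext_scal: "lin_ext f (scal c v) = scal c (lin_ext f v)"
  unfolding lin_ext_superset[OF finite_keys keys_scal, of f c v] lin_ext_def[of f v] scal_sum
  by simp

lemma lin_ext_0 [simp]: "lin_ext f 0 = 0"
  by (simp add: lin_ext_def)

lemma lin_ext_diff: "lin_ext f (u - v) = lin_ext f u - lin_ext f v"
  using lin_ext_add[of f "u - v" v] by (simp only: diff_add_cancel add_diff_cancel_right')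

lemma lin_ext_single [simp]: "lin_ext f (Poly_Mapping.single a c) = scal c (f a)"
  using lin_ext_superset[of "{a}" "Poly_Mapping.single a c" f] by simp

lemma keys_lin_ext:
  assumes "\<And>a. a \<in> Poly_Mapping.keys v \<Longrightarrow> Poly_Mapping.keys (f a) \<subseteq> S"
  shows "Poly_Mapping.keys (lin_ext f v) \<subseteq> S"
proof -
  have "Poly_Mapping.keys (lin_ext f v)
      \<subseteq> (\<Union>a\<in>Poly_Mapping.keys v. Poly_Mapping.keys (scal (Poly_Mapping.lookup v a) (f a)))"
    unfolding lin_ext_def by (rule Poly_Mapping.keys_sum)
  also have "\<dots> \<subseteq> S"
    by (intro UN_least subset_trans[OF keys_scal] assms)
  finally show ?thesis .
qed

lemma pm_induct [case_names zero single add]: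
  fixes v :: "'a \<Rightarrow>\<^sub>0 'k::field"
  assumes "P 0" "\<And>a c. P (Poly_Mapping.single a c)" "\<And>u v. P u \<Longrightarrow> P v \<Longrightarrow> P (u + v)"
  shows "P v"
proof -
  have "P (\<Sum>a\<in>A. Poly_Mapping.single a (Poly_Mapping.lookup v a))" if "finite A" for A
    using that by (induction A) (auto intro: assms)
  moreover have "(\<Sum>a\<in>Poly_Mapping.keys v. Poly_Mapping.single a (Poly_Mapping.lookup v a)) = v"
    by (rule poly_mapping_eqI) (simp add: lookup_sum lookup_single when_def in_keys_iff)
  ultimately show ?thesis
    using finite_keys[of v] by metis
qed

lemma gen_act_linear:
  "gen_act q g (u + v) = gen_act q g u + gen_act q g v"
  "gen_act q g (scal c v) = scal c (gen_act q g v)"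
  by (simp_all add: gen_act_def lin_ext_add lin_ext_scal)

lemma foldr_linear:
  "foldr (gen_act q) gs (u + v) = foldr (gen_act q) gs u + foldr (gen_act q) gs v"
  "foldr (gen_act q) gs (scal c v) = scal c (foldr (gen_act q) gs v)"
  by (induction gs) (simp_all add: gen_act_linear)

lemma word_act_linear:
  "word_act q w (u + v) = word_act q w u + word_act q w v"
  "word_act q w (scal c v) = scal c (word_act q w v)"
  by (simp_all add: word_act_def foldr_linear)

lemma word_act_0 [simp]: "word_act q 0 v = v"
  by (simp add: word_act_def)

lemma word_act_plus: "word_act q (w + w') v = word_act q w (word_act q w' v)"
  by (simp add: word_act_def)

lemma free_act_add_left: "free_act q (p + p') v = free_act q p v + free_act q p' v"
  and free_act_diff_left: "free_act q (p - p') v = free_act q p v - free_act q p' v"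
  and free_act_scal_left: "free_act q (scal c p) v = scal c (free_act q p v)"
  and free_act_0_left [simp]: "free_act q 0 v = 0"
  by (simp_all add: free_act_def lin_ext_add lin_ext_diff lin_ext_scal)

lemma free_act_single: "free_act q (Poly_Mapping.single w c) v = scal c (word_act q w v)"
  by (simp add: free_act_def)

lemma free_act_1 [simp]: "free_act q 1 v = v"
  using free_act_single[of q 0 1 v] by simp

lemma free_act_add_right: "free_act q p (u + v) = free_act q p u + free_act q p v"
  by (induction p rule: pm_induct)
    (simp_all add: free_act_single free_act_add_left word_act_linear scal_add_right algebra_simps)

lemma free_act_scal_right: "free_act q p (scal c v) = scal c (free_act q p v)"
  by (induction p rule: pm_induct)
    (simp_all add: free_act_single free_act_add_left word_act_linear scal_add_right mult.commute)

lemma free_act_0_right [simp]: "free_act q p 0 = 0"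
  using free_act_scal_right[of q p 0 0] by simp

lemma free_act_mult: "free_act q (p * p') v = free_act q p (free_act q p' v)"
proof (induction p rule: pm_induct)
  case (single w c)
  show ?case
    by (induction p' rule: pm_induct)
      (simp_all add: mult_single free_act_single free_act_add_left free_act_add_right word_act_plus
        word_act_linear distrib_left)
qed (simp_all add: free_act_add_left distrib_right)

lemma free_act_gens:
  "free_act q (gE i) v = gen_act q (GenE i) v"
  "free_act q (gF i) v = gen_act q (GenF i) v"
  "free_act q (gK i) v = gen_act q (GenK i) v"
  "free_act q (gKinv i) v = gen_act q (GenKinv i) v"
  by (simp_all add: gE_def gF_def gK_def gKinv_def free_act_single word_act_def)

lemma free_act_eq_0I:
  assumes "\<And>\<beta>. free_act q p (Poly_Mapping.single \<beta> 1) = 0"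
  shows "free_act q p v = 0"
proof (induction v rule: pm_induct)
  case (single \<beta> c)
  then show ?case
    using free_act_scal_right[of q p c "Poly_Mapping.single \<beta> 1"] assms by simp
qed (simp_all add: free_act_add_right)

lemma gen_act_single:
  "gen_act q g (Poly_Mapping.single \<beta> c) = scal c (gen_basis q g \<beta>)"
  by (simp add: gen_act_def)

lemma gen_act_0 [simp]: "gen_act q g 0 = 0"
  by (simp add: gen_act_def)

lemma qint_0 [simp]: "qint q 0 = 0"
  by (simp add: qint_def)

lemma qint_comm:
  assumes "q \<noteq> 0" "q - inverse q \<noteq> 0"
  shows "qint q a * qint q (b + 1) - qint q b * qint q (a + 1)
    = inverse (q - inverse q) * (q powi (a - b) - q powi (b - a))"
proof -
  define A A' B B' p where "A = q powi a" and "A' = q powi (- a)"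
    and "B = q powi b" and "B' = q powi (- b)" and "p = inverse q"
  define d where "d = q - p"
  have "d \<noteq> 0" using assms by (simp add: d_def p_def)
  have 1: "(A - A') * (B * q - B' * p) - (B - B') * (A * q - A' * p) = d * (A * B' - B * A')"
    by (simp add: d_def algebra_simps)
  have pw: "q powi (1 + a) = A * q" "q powi (1 + b) = B * q"
    "q powi (- 1 - a) = A' * p" "q powi (- 1 - b) = B' * p"
    "q powi (a - b) = A * B'" "q powi (b - a) = B * A'"
    using assms(1) by (simp_all add: A_def A'_def B_def B'_def p_def power_int_add power_int_diff
        power_int_minus divide_inverse mult.commute)
  have 2: "qint q a = (A - A') / d" "qint q b = (B - B') / d"
    "qint q (a + 1) = (A * q - A' * p) / d" "qint q (b + 1) = (B * q - B' * p) / d"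
    using pw by (simp_all add: qint_def A_def A'_def B_def B'_def p_def d_def add.commute)
  have "qint q a * qint q (b + 1) - qint q b * qint q (a + 1)
      = ((A - A') * (B * q - B' * p) - (B - B') * (A * q - A' * p)) / (d * d)"
    unfolding 2 times_divide_times_eq diff_divide_distrib[symmetric] by (rule refl)
  also have "\<dots> = inverse d * (A * B' - B * A')"
    unfolding 1 using \<open>d \<noteq> 0\<close> by (simp add: divide_inverse)
  finally show ?thesis
    using pw by (simp add: d_def p_def)
qed

lemma qint_serre:
  assumes "q \<noteq> 0"
  shows "qint q (b + 1) - (q + inverse q) * qint q b + qint q (b - 1) = 0"
proof -
  define B B' p where "B = q powi b" and "B' = q powi (- b)" and "p = inverse q"
  define d where "d = q - p"
  have 1: "(B * q - B' * p) - (q + p) * (B - B') + (B * p - B' * q) = 0"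
    by (simp add: algebra_simps)
  have pw: "q powi (1 + b) = B * q" "q powi (- 1 - b) = B' * p"
    "q powi (b - 1) = B * p" "q powi (1 - b) = B' * q"
    using assms by (simp_all add: B_def B'_def p_def power_int_add power_int_diff
        power_int_minus divide_inverse mult.commute)
  have 2: "qint q b = (B - B') / d" "qint q (b - 1) = (B * p - B' * q) / d"
    "qint q (b + 1) = (B * q - B' * p) / d"
    using pw by (simp_all add: qint_def B_def B'_def p_def d_def add.commute)
  have "qint q (b + 1) - (q + p) * qint q b + qint q (b - 1)
      = ((B * q - B' * p) - (q + p) * (B - B') + (B * p - B' * q)) / d"
    unfolding 2 by (simp only: times_divide_eq_right diff_divide_distrib[symmetric]
        add_divide_distrib[symmetric])
  then show ?thesis
    unfolding 1 by (simp add: p_def)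
qed


lemma upd_single_eqI:
  "\<beta> = \<beta>' \<Longrightarrow> c = c' \<Longrightarrow> Poly_Mapping.single \<beta> c = Poly_Mapping.single \<beta>' c'"
  by simp

lemmas act_simps = free_act_diff_left free_act_add_left free_act_scal_left free_act_mult
  free_act_gens gen_act_single

lemma rel_K_inverse:
  assumes "q \<noteq> 0"
  shows "free_act q (gK i * gKinv i - 1) v = 0" "free_act q (gKinv i * gK i - 1) v = 0"
  by (rule free_act_eq_0I; use assms in \<open>simp add: act_simps power_int_minus power_int_diff\<close>)+

lemma rel_K_comm: "free_act q (gK i * gK j - gK j * gK i) v = 0"
  by (rule free_act_eq_0I) (simp add: act_simps mult.commute)

lemma rel_KE:
  assumes "q \<noteq> 0"
  shows "free_act q (gK i * gE j * gKinv i - scal (q powi cartan i j) (gE j)) v = 0"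
proof (rule free_act_eq_0I)
  fix \<beta> :: "nat \<Rightarrow> nat"
  let ?\<gamma> = "\<beta>(j := \<beta> j + 1, j + 1 := \<beta> (j + 1) - 1)"
  have "int (?\<gamma> i) - int (?\<gamma> (i + 1)) - (int (\<beta> i) - int (\<beta> (i + 1))) = cartan i j"
    if "\<beta> (j + 1) \<noteq> 0"
    using that by (auto simp: cartan_def adjacent_def)
  then have "q powi (int (?\<gamma> i) - int (?\<gamma> (i + 1))) * q powi (- (int (\<beta> i) - int (\<beta> (i + 1))))
      = q powi cartan i j" if "\<beta> (j + 1) \<noteq> 0"
    using that assms by (metis power_int_add diff_conv_add_uminus)
  then show "free_act q (gK i * gE j * gKinv i - scal (q powi cartan i j) (gE j))
      (Poly_Mapping.single \<beta> 1) = 0"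
    by (simp add: act_simps del: fun_upd_apply) (simp add: ac_simps del: fun_upd_apply)?
qed


lemma rel_KF:
  assumes "q \<noteq> 0"
  shows "free_act q (gK i * gF j * gKinv i - scal (q powi (- cartan i j)) (gF j)) v = 0"
proof (rule free_act_eq_0I)
  fix \<beta> :: "nat \<Rightarrow> nat"
  let ?\<gamma> = "\<beta>(j := \<beta> j - 1, j + 1 := \<beta> (j + 1) + 1)"
  have "int (?\<gamma> i) - int (?\<gamma> (i + 1)) - (int (\<beta> i) - int (\<beta> (i + 1))) = - cartan i j"
    if "\<beta> j \<noteq> 0"
    using that by (auto simp: cartan_def adjacent_def)
  then have "q powi (int (?\<gamma> i) - int (?\<gamma> (i + 1))) * q powi (- (int (\<beta> i) - int (\<beta> (i + 1))))
      = q powi (- cartan i j)" if "\<beta> j \<noteq> 0"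
    using that assms by (metis power_int_add diff_conv_add_uminus)
  then show "free_act q (gK i * gF j * gKinv i - scal (q powi (- cartan i j)) (gF j))
      (Poly_Mapping.single \<beta> 1) = 0"
    by (simp add: act_simps del: fun_upd_apply) (simp add: ac_simps del: fun_upd_apply)?
qed

lemma rel_EF_ne:
  assumes "i \<noteq> j"
  shows "free_act q (gE i * gF j - gF j * gE i) v = 0"
proof (rule free_act_eq_0I)
  fix \<beta> :: "nat \<Rightarrow> nat"
  consider "j = Suc i" | "i = Suc j" | "j \<noteq> Suc i" "i \<noteq> Suc j" by blast
  then show "free_act q (gE i * gF j - gF j * gE i) (Poly_Mapping.single \<beta> 1) = 0"
    by cases (use assms in \<open>auto simp: act_simps mult.commute intro!: upd_single_eqI ext\<close>)
qed

lemma rel_EF_eq: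
  assumes "q \<noteq> 0" "q - inverse q \<noteq> 0"
  shows "free_act q (gE i * gF i - gF i * gE i - scal (inverse (q - inverse q)) (gK i - gKinv i)) v = 0"
proof (rule free_act_eq_0I)
  fix \<beta> :: "nat \<Rightarrow> nat"
  let ?x = "Poly_Mapping.single \<beta> (1 :: 'a)"
  let ?a = "int (\<beta> i)" and ?b = "int (\<beta> (i + 1))"
  have "gen_act q (GenE i) (gen_act q (GenF i) ?x) = Poly_Mapping.single \<beta> (qint q ?a * qint q (?b + 1))"
    by (auto simp: act_simps fun_upd_idem mult.commute intro!: upd_single_eqI ext)
  moreover have "gen_act q (GenF i) (gen_act q (GenE i) ?x) = Poly_Mapping.single \<beta> (qint q ?b * qint q (?a + 1))"
    by (auto simp: act_simps fun_upd_idem mult.commute intro!: upd_single_eqI ext)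
  ultimately show "free_act q (gE i * gF i - gF i * gE i
      - scal (inverse (q - inverse q)) (gK i - gKinv i)) ?x = 0"
    using qint_comm[OF assms, of ?a ?b]
    by (simp add: act_simps single_diff[symmetric] scal_diff_right right_diff_distrib del: gen_basis.simps(1,2))
qed

lemma rel_comm_E:
  assumes "j \<noteq> i" "\<not> adjacent i j"
  shows "free_act q (gE i * gE j - gE j * gE i) v = 0"
  by (rule free_act_eq_0I)
    (use assms in \<open>auto simp: act_simps adjacent_def mult.commute intro!: upd_single_eqI ext\<close>)

lemma rel_comm_F:
  assumes "j \<noteq> i" "\<not> adjacent i j"
  shows "free_act q (gF i * gF j - gF j * gF i) v = 0"
  by (rule free_act_eq_0I)
    (use assms in \<open>auto simp: act_simps adjacent_def mult.commute intro!: upd_single_eqI ext\<close>)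


lemma rel_serre_E:
  assumes "q \<noteq> 0" "adjacent i j"
  shows "free_act q (gE i * gE i * gE j - scal (q + inverse q) (gE i * gE j * gE i)
    + gE j * gE i * gE i) v = 0" (is "free_act q ?p v = 0")
proof (rule free_act_eq_0I)
  fix \<beta> :: "nat \<Rightarrow> nat"
  let ?x = "Poly_Mapping.single \<beta> (1 :: 'a)"
  let ?g = "\<lambda>i. gen_act q (GenE i)"
  have "\<exists>\<gamma> c b d. ?g i (?g i (?g j ?x)) = Poly_Mapping.single \<gamma> (c * qint q (b + d)) \<and>
      ?g i (?g j (?g i ?x)) = Poly_Mapping.single \<gamma> (c * qint q b) \<and>
      ?g j (?g i (?g i ?x)) = Poly_Mapping.single \<gamma> (c * qint q (b - d)) \<and> (d = 1 \<or> d = - 1)"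
  proof (cases "j = Suc i")
    case j: True
    show ?thesis
    proof (cases "\<beta> (Suc i) = 0 \<or> \<beta> (Suc j) = 0")
      case True
      then show ?thesis using j
        by (intro exI[of _ \<beta>] exI[of _ 0] exI[of _ 0] exI[of _ 1]) (auto simp: act_simps)
    next
      case False
      then show ?thesis using j
        by (intro exI[of _ "\<beta>(i := \<beta> i + 2, j := \<beta> j - 1, Suc j := \<beta> (Suc j) - 1)"]
            exI[of _ "qint q (int (\<beta> i) + 1) * qint q (int (\<beta> i) + 2)"]
            exI[of _ "int (\<beta> j)"] exI[of _ "1"], cases "\<beta> (Suc i) = 1")
          (auto simp: act_simps of_nat_diff add_ac mult_ac intro!: upd_single_eqI ext)
    qed
  next
    case False
    then have i: "i = Suc j" using assms by (simp add: adjacent_def)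
    show ?thesis
    proof (cases "\<beta> (Suc i) < 2")
      case True
      then show ?thesis using i
        by (intro exI[of _ \<beta>] exI[of _ 0] exI[of _ 0] exI[of _ 1]) (auto simp: act_simps)
    next
      case False
      then show ?thesis using i
        by (intro exI[of _ "\<beta>(j := \<beta> j + 1, i := \<beta> i + 1, Suc i := \<beta> (Suc i) - 2)"]
            exI[of _ "qint q (int (\<beta> j) + 1) * qint q (int (\<beta> i) + 1)"]
            exI[of _ "int (\<beta> i) + 1"] exI[of _ "- 1"], cases "\<beta> i = 0")
          (auto simp: act_simps of_nat_diff add_ac mult_ac intro!: upd_single_eqI ext)
    qed
  qed
  then obtain \<gamma> c b d where eq:
      "?g i (?g i (?g j ?x)) = Poly_Mapping.single \<gamma> (c * qint q (b + d))"
      "?g i (?g j (?g i ?x)) = Poly_Mapping.single \<gamma> (c * qint q b)"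
      "?g j (?g i (?g i ?x)) = Poly_Mapping.single \<gamma> (c * qint q (b - d))"
    and d: "d = 1 \<or> d = - 1"
    by blast
  have "free_act q ?p ?x = Poly_Mapping.single \<gamma>
      (c * (qint q (b + d) - (q + inverse q) * qint q b + qint q (b - d)))"
    unfolding free_act_diff_left free_act_add_left free_act_scal_left free_act_mult free_act_gens eq
    by (simp add: single_diff[symmetric] single_add[symmetric] algebra_simps)
  moreover have "qint q (b + d) - (q + inverse q) * qint q b + qint q (b - d) = 0"
    using d qint_serre[OF assms(1), of b] by (auto simp: algebra_simps)
  ultimately show "free_act q ?p ?x = 0"
    by (simp only: mult_zero_right single_zero)
qed

lemma rel_serre_F:
  assumes "q \<noteq> 0" "adjacent i j"
  shows "free_act q (gF i * gF i * gF j - scal (q + inverse q) (gF i * gF j * gF i)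
    + gF j * gF i * gF i) v = 0" (is "free_act q ?p v = 0")
proof (rule free_act_eq_0I)
  fix \<beta> :: "nat \<Rightarrow> nat"
  let ?x = "Poly_Mapping.single \<beta> (1 :: 'a)"
  let ?g = "\<lambda>i. gen_act q (GenF i)"
  have "\<exists>\<gamma> c b d. ?g i (?g i (?g j ?x)) = Poly_Mapping.single \<gamma> (c * qint q (b + d)) \<and>
      ?g i (?g j (?g i ?x)) = Poly_Mapping.single \<gamma> (c * qint q b) \<and>
      ?g j (?g i (?g i ?x)) = Poly_Mapping.single \<gamma> (c * qint q (b - d)) \<and> (d = 1 \<or> d = - 1)"
  proof (cases "j = Suc i")
    case j: True
    show ?thesis
    proof (cases "\<beta> i < 2")
      case True
      then show ?thesis using j
        by (intro exI[of _ \<beta>] exI[of _ 0] exI[of _ 0] exI[of _ 1]) (auto simp: act_simps)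
    next
      case False
      then show ?thesis using j
        by (intro exI[of _ "\<beta>(i := \<beta> i - 2, j := \<beta> j + 1, Suc j := \<beta> (Suc j) + 1)"]
            exI[of _ "qint q (int (\<beta> j) + 1) * qint q (int (\<beta> (Suc j)) + 1)"]
            exI[of _ "int (\<beta> j) + 1"] exI[of _ "- 1"], cases "\<beta> j = 0")
          (auto simp: act_simps of_nat_diff add_ac mult_ac intro!: upd_single_eqI ext)
    qed
  next
    case False
    then have i: "i = Suc j" using assms by (simp add: adjacent_def)
    show ?thesis
    proof (cases "\<beta> j = 0 \<or> \<beta> i = 0")
      case True
      then show ?thesis using i
        by (intro exI[of _ \<beta>] exI[of _ 0] exI[of _ 0] exI[of _ 1]) (auto simp: act_simps)
    next
      case False
      then show ?thesis using i
        by (intro exI[of _ "\<beta>(j := \<beta> j - 1, i := \<beta> i - 1, Suc i := \<beta> (Suc i) + 2)"]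
            exI[of _ "qint q (int (\<beta> (Suc i)) + 1) * qint q (int (\<beta> (Suc i)) + 2)"]
            exI[of _ "int (\<beta> i)"] exI[of _ "1"], cases "\<beta> i = 1")
          (auto simp: act_simps of_nat_diff add_ac mult_ac intro!: upd_single_eqI ext)
    qed
  qed
  then obtain \<gamma> c b d where eq:
      "?g i (?g i (?g j ?x)) = Poly_Mapping.single \<gamma> (c * qint q (b + d))"
      "?g i (?g j (?g i ?x)) = Poly_Mapping.single \<gamma> (c * qint q b)"
      "?g j (?g i (?g i ?x)) = Poly_Mapping.single \<gamma> (c * qint q (b - d))"
    and d: "d = 1 \<or> d = - 1"
    by blast
  have "free_act q ?p ?x = Poly_Mapping.single \<gamma>
      (c * (qint q (b + d) - (q + inverse q) * qint q b + qint q (b - d)))"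
    unfolding free_act_diff_left free_act_add_left free_act_scal_left free_act_mult free_act_gens eq
    by (simp add: single_diff[symmetric] single_add[symmetric] algebra_simps)
  moreover have "qint q (b + d) - (q + inverse q) * qint q b + qint q (b - d) = 0"
    using d qint_serre[OF assms(1), of b] by (auto simp: algebra_simps)
  ultimately show "free_act q ?p ?x = 0"
    by (simp only: mult_zero_right single_zero)
qed


lemma qint_eq_0_iff:
  assumes "q - inverse q \<noteq> 0"
  shows "qint q a = 0 \<longleftrightarrow> q powi a = q powi (- a)"
  using assms by (simp add: qint_def)

lemma qint_dvd:
  assumes "q - inverse q \<noteq> 0" "qint q a = 0" "a dvd b"
  shows "qint q b = 0"
proof -
  from assms(3) obtain c where b: "b = a * c" by (elim dvdE)
  have "q powi a = q powi (- a)"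
    using assms(1,2) by (simp add: qint_eq_0_iff)
  then have "(q powi a) powi c = (q powi (- a)) powi c" by simp
  then show ?thesis
    using assms(1) by (simp add: b qint_eq_0_iff flip: power_int_mult)
qed

lemma prod_consecutive_qint:
  assumes "q - inverse q \<noteq> 0" "qint q (int l) = 0" "l > 0"
  shows "(\<Prod>t=1..l. qint q (int a + int t)) = 0"
proof -
  define t where "t = l - a mod l"
  have "t \<in> {1..l}" using assms(3) by (auto simp: t_def Suc_le_eq)
  moreover have "l dvd a + t"
  proof -
    have "a mod l < l" using assms(3) by simp
    then have "a + t = l * (a div l) + l"
      using div_mult_mod_eq[of a l] by (simp only: t_def mult.commute[of l])
    then show ?thesis by simp
  qed
  then have "qint q (int a + int t) = 0"
    by (intro qint_dvd[OF assms(1,2)]) (metis of_nat_add of_nat_dvd_iff)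
  ultimately show ?thesis by auto
qed

lemma E_power:
  "free_act q (gE i ^ m) (Poly_Mapping.single \<beta> 1) =
    (if \<beta> (i + 1) < m then 0 else
     Poly_Mapping.single (\<beta>(i := \<beta> i + m, i + 1 := \<beta> (i + 1) - m))
       (\<Prod>t=1..m. qint q (int (\<beta> i) + int t)))"
proof (induction m)
  case (Suc m)
  have "free_act q (gE i ^ Suc m) (Poly_Mapping.single \<beta> 1)
      = gen_act q (GenE i) (free_act q (gE i ^ m) (Poly_Mapping.single \<beta> 1))"
    by (simp add: free_act_mult free_act_gens)
  then show ?case
    unfolding Suc.IH by (auto simp: act_simps add_ac mult.commute intro!: upd_single_eqI ext)
qed simp

lemma F_power:
  "free_act q (gF i ^ m) (Poly_Mapping.single \<beta> 1) =
    (if \<beta> i < m then 0 else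
     Poly_Mapping.single (\<beta>(i := \<beta> i - m, i + 1 := \<beta> (i + 1) + m))
       (\<Prod>t=1..m. qint q (int (\<beta> (i + 1)) + int t)))"
proof (induction m)
  case (Suc m)
  have "free_act q (gF i ^ Suc m) (Poly_Mapping.single \<beta> 1)
      = gen_act q (GenF i) (free_act q (gF i ^ m) (Poly_Mapping.single \<beta> 1))"
    by (simp add: free_act_mult free_act_gens)
  then show ?case
    unfolding Suc.IH by (auto simp: act_simps add_ac mult.commute intro!: upd_single_eqI ext)
qed simp

lemma K_power:
  "free_act q (gK i ^ m) (Poly_Mapping.single \<beta> 1) =
    Poly_Mapping.single \<beta> ((q powi (int (\<beta> i) - int (\<beta> (i + 1)))) ^ m)"
proof (induction m)
  case (Suc m)
  have "free_act q (gK i ^ Suc m) (Poly_Mapping.single \<beta> 1)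
      = gen_act q (GenK i) (free_act q (gK i ^ m) (Poly_Mapping.single \<beta> 1))"
    by (simp add: free_act_mult free_act_gens)
  then show ?case
    unfolding Suc.IH by (simp add: act_simps mult.commute)
qed simp

lemma rel_EF:
  assumes "q \<noteq> 0" "q - inverse q \<noteq> 0"
  shows "free_act q (gE i * gF j - gF j * gE i
    - (if i = j then scal (inverse (q - inverse q)) (gK i - gKinv i) else 0)) v = 0"
  using rel_EF_eq[OF assms, of i v] rel_EF_ne[of i j q v] by (cases "i = j") simp_all

lemma act_Uq_relations:
  assumes "q \<noteq> 0" "q - inverse q \<noteq> 0" "p \<in> Uq_relations n q"
  shows "free_act q p v = 0"
  using assms(3) unfolding Uq_relations_def
  by (elim UnE UN_E insertE emptyE; simp only: mem_Collect_eq rel_K_inverse[OF assms(1)] rel_K_comm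
      rel_KE[OF assms(1)] rel_KF[OF assms(1)] rel_EF[OF assms(1,2)] rel_comm_E rel_comm_F
      rel_serre_E[OF assms(1)] rel_serre_F[OF assms(1)] not_False_eq_True)

lemma act_small_relations:
  assumes "q \<noteq> 0" "q - inverse q \<noteq> 0" "qint q (int l) = 0" "l > 0" "p \<in> small_relations n l"
  shows "free_act q p v = 0"
proof (rule free_act_eq_0I)
  fix \<beta> :: "nat \<Rightarrow> nat"
  have "q powi int l = q powi (- int l)"
    using assms(2,3) by (simp add: qint_eq_0_iff)
  then have "q powi int l * q powi int l = 1"
    using assms(1) by (metis power_int_add add.right_inverse power_int_0_right)
  then have 2: "q powi (int (2 * l)) = 1"
    unfolding power_int_of_nat mult_2 power_add .
  have K: "(q powi a) ^ (2 * l) = 1" for a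
  proof -
    have "(q powi a) ^ (2 * l) = q powi (a * int (2 * l))"
      unfolding power_int_mult power_int_of_nat ..
    also have "\<dots> = (q powi int (2 * l)) powi a"
      unfolding power_int_mult[symmetric] by (simp only: mult.commute)
    finally show ?thesis unfolding 2 by simp
  qed
  from assms(5) consider i where "p = gE i ^ l" | i where "p = gF i ^ l"
    | i where "p = gK i ^ (2 * l) - 1"
    by (auto simp: small_relations_def)
  then show "free_act q p (Poly_Mapping.single \<beta> 1) = 0"
  proof cases
    case 1
    then show ?thesis
      by (simp only: E_power prod_consecutive_qint[OF assms(2,3,4)] single_zero if_cancel)
  next
    case 2
    then show ?thesis
      by (simp only: F_power prod_consecutive_qint[OF assms(2,3,4)] single_zero if_cancel)
  next
    case 3
    then show ?thesis
      by (simp only: free_act_diff_left K_power K free_act_1 diff_self)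
  qed
qed

lemma free_alg_simps [simp]:
  "x \<otimes>\<^bsub>free_alg n\<^esub> y = x * y" "\<one>\<^bsub>free_alg n\<^esub> = 1"
  "\<zero>\<^bsub>free_alg n\<^esub> = 0" "x \<oplus>\<^bsub>free_alg n\<^esub> y = x + y"
  by (simp_all add: free_alg_def)

lemma free_alg_closed:
  "p \<in> carrier (free_alg n) \<Longrightarrow> p' \<in> carrier (free_alg n) \<Longrightarrow> p + p' \<in> carrier (free_alg n)"
  "p \<in> carrier (free_alg n) \<Longrightarrow> p' \<in> carrier (free_alg n) \<Longrightarrow> p * p' \<in> carrier (free_alg n)"
  "p \<in> carrier (free_alg n) \<Longrightarrow> - p \<in> carrier (free_alg n)"
  "p \<in> carrier (free_alg n) \<Longrightarrow> scal c p \<in> carrier (free_alg n)"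
proof -
  let ?ok = "\<lambda>w. gen_index ` set (letters w) \<subseteq> {1..<n}"
  have C: "p \<in> carrier (free_alg n) \<longleftrightarrow> (\<forall>w\<in>Poly_Mapping.keys p. ?ok w)" for p :: "word \<Rightarrow>\<^sub>0 'a"
    by (simp add: free_alg_def)
  show "- p \<in> carrier (free_alg n)" if "p \<in> carrier (free_alg n)"
    using that by (simp add: C)
  show "scal c p \<in> carrier (free_alg n)" if "p \<in> carrier (free_alg n)"
    using that keys_scal[of c p] unfolding C by blast
  show "p + p' \<in> carrier (free_alg n)" if "p \<in> carrier (free_alg n)" "p' \<in> carrier (free_alg n)"
    using that Poly_Mapping.keys_add[of p p'] unfolding C by blast
  show "p * p' \<in> carrier (free_alg n)" if "p \<in> carrier (free_alg n)" "p' \<in> carrier (free_alg n)"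
    unfolding C
  proof
    fix w assume "w \<in> Poly_Mapping.keys (p * p')"
    then obtain u u' where "w = u + u'" "u \<in> Poly_Mapping.keys p" "u' \<in> Poly_Mapping.keys p'"
      using keys_mult[of p p'] by blast
    then show "?ok w"
      using that unfolding C by (auto simp: image_Un)
  qed
qed

lemma free_alg_consts [simp]: "0 \<in> carrier (free_alg n)" "1 \<in> carrier (free_alg n)"
  by (simp_all add: free_alg_def)

lemma ring_free_alg: "ring (free_alg n :: (word \<Rightarrow>\<^sub>0 'k::field) ring)"
proof (rule ringI)
  show "abelian_group (free_alg n :: (word \<Rightarrow>\<^sub>0 'k) ring)"
    by (rule abelian_groupI)
      (auto simp: free_alg_closed add_ac intro!: bexI[where x = "- x" for x])
  show "monoid (free_alg n :: (word \<Rightarrow>\<^sub>0 'k) ring)"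
    by (rule monoidI) (auto simp: free_alg_closed mult.assoc)
qed (auto simp: algebra_simps)

lemma free_alg_minus:
  assumes "p \<in> carrier (free_alg n)"
  shows "\<ominus>\<^bsub>free_alg n\<^esub> p = - p"
proof -
  interpret ring "free_alg n" by (rule ring_free_alg)
  show ?thesis
    using minus_equality[of "- p" p] assms free_alg_closed(3)[OF assms] by simp
qed

lemma gens_closed:
  assumes "i \<in> {1..<n}"
  shows "gE i \<in> carrier (free_alg n)" "gF i \<in> carrier (free_alg n)"
    "gK i \<in> carrier (free_alg n)" "gKinv i \<in> carrier (free_alg n)"
  using assms by (simp_all add: free_alg_def gE_def gF_def gK_def gKinv_def)

lemma free_alg_closed_diff:
  assumes "p \<in> carrier (free_alg n)" "p' \<in> carrier (free_alg n)"
  shows "p - p' \<in> carrier (free_alg n)"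
  using free_alg_closed(1)[OF assms(1) free_alg_closed(3)[OF assms(2)]] by simp

lemma free_alg_closed_power:
  "p \<in> carrier (free_alg n) \<Longrightarrow> p ^ m \<in> carrier (free_alg n)"
  by (induction m) (auto simp: free_alg_closed)

lemma Uq_relations_closed: "Uq_relations n q \<subseteq> carrier (free_alg n)"
proof
  fix p assume "p \<in> Uq_relations n q"
  then show "p \<in> carrier (free_alg n)"
    unfolding Uq_relations_def
    by (elim UnE UN_E insertE emptyE; simp add: free_alg_closed free_alg_closed_diff gens_closed)
qed

lemma small_relations_closed: "small_relations n l \<subseteq> carrier (free_alg n)"
  unfolding small_relations_def
  by (auto intro!: free_alg_closed_power free_alg_closed_diff gens_closed)

definition act_kernel :: "nat \<Rightarrow> 'k::field \<Rightarrow> (word \<Rightarrow>\<^sub>0 'k) set" where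
  "act_kernel n q = {p \<in> carrier (free_alg n). \<forall>v. free_act q p v = 0}"

lemma ideal_act_kernel: "ideal (act_kernel n q) (free_alg n)"
proof (rule idealI)
  show "ring (free_alg n :: (word \<Rightarrow>\<^sub>0 'a) ring)" by (rule ring_free_alg)
  then interpret ring "free_alg n :: (word \<Rightarrow>\<^sub>0 'a) ring" .
  show "subgroup (act_kernel n q) (add_monoid (free_alg n))"
  proof (rule add.subgroupI)
    show "act_kernel n q \<noteq> {}" by (auto simp: act_kernel_def intro!: exI[of _ 0])
  next
    fix a assume "a \<in> act_kernel n q"
    then show "\<ominus>\<^bsub>free_alg n\<^esub> a \<in> act_kernel n q"
      using free_alg_minus[of a n] free_alg_closed(3)[of a n] free_act_diff_left[of q 0 a]
      by (auto simp: act_kernel_def)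
  qed (auto simp: act_kernel_def free_alg_closed free_act_add_left)
qed (auto simp: act_kernel_def free_alg_closed free_act_mult)

lemma ideal_Uq_ideal: "ideal (Uq_ideal n q) (free_alg n)"
  unfolding Uq_ideal_def by (rule ring.genideal_ideal[OF ring_free_alg Uq_relations_closed])

lemma ring_Uq: "ring (Uq n q)"
  unfolding Uq_def by (rule ideal.quotient_is_ring[OF ideal_Uq_ideal])

lemma small_gens_closed:
  "(\<lambda>p. Uq_ideal n q +>\<^bsub>free_alg n\<^esub> p) ` small_relations n l \<subseteq> carrier (Uq n q)"
  using small_relations_closed[of n l] ideal.rcos_ring_hom[OF ideal_Uq_ideal[of n q]]
  by (auto simp: Uq_def ring_hom_closed)

lemma ideal_small_ideal: "ideal (small_ideal n q l) (Uq n q)"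
  unfolding small_ideal_def by (rule ring.genideal_ideal[OF ring_Uq small_gens_closed])

lemma ring_small_uq: "ring (small_uq n q l)"
  unfolding small_uq_def by (rule ideal.quotient_is_ring[OF ideal_small_ideal])

lemma Uq_ideal_subset_kernel:
  assumes "q \<noteq> 0" "q - inverse q \<noteq> 0"
  shows "Uq_ideal n q \<subseteq> act_kernel n q"
  unfolding Uq_ideal_def
  using Uq_relations_closed[of n q] act_Uq_relations[OF assms]
  by (intro ring.genideal_minimal[OF ring_free_alg ideal_act_kernel]) (auto simp: act_kernel_def)

lemma small_ideal_subset_kernel:
  assumes "q \<noteq> 0" "q - inverse q \<noteq> 0" "qint q (int l) = 0" "l > 0"
  shows "small_ideal n q l \<subseteq> (\<lambda>p. Uq_ideal n q +>\<^bsub>free_alg n\<^esub> p) ` act_kernel n q"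
  unfolding small_ideal_def
proof (rule ring.genideal_minimal[OF ring_Uq])
  show "ideal ((\<lambda>p. Uq_ideal n q +>\<^bsub>free_alg n\<^esub> p) ` act_kernel n q) (Uq n q)"
    unfolding Uq_def
    by (rule ring.ring_ideal_imp_quot_ideal[OF ring_free_alg ideal_Uq_ideal ideal_act_kernel])
  show "(\<lambda>p. Uq_ideal n q +>\<^bsub>free_alg n\<^esub> p) ` small_relations n l
      \<subseteq> (\<lambda>p. Uq_ideal n q +>\<^bsub>free_alg n\<^esub> p) ` act_kernel n q"
    using small_relations_closed[of n l] act_small_relations[OF assms]
    by (intro image_mono) (auto simp: act_kernel_def)
qed

definition to_small :: "nat \<Rightarrow> 'k::field \<Rightarrow> nat \<Rightarrow> (word \<Rightarrow>\<^sub>0 'k) \<Rightarrow> (word \<Rightarrow>\<^sub>0 'k) set set" where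
  "to_small n q l p = small_ideal n q l +>\<^bsub>Uq n q\<^esub> (Uq_ideal n q +>\<^bsub>free_alg n\<^esub> p)"

lemma to_small_hom: "to_small n q l \<in> ring_hom (free_alg n) (small_uq n q l)"
  using ring_hom_trans[OF ideal.rcos_ring_hom[OF ideal_Uq_ideal[of n q], folded Uq_def]
      ideal.rcos_ring_hom[OF ideal_small_ideal[of n q l], folded small_uq_def]]
  by (simp add: to_small_def[abs_def] comp_def)

lemma small_uq_carrier: "carrier (small_uq n q l) = to_small n q l ` carrier (free_alg n)"
  by (auto simp: small_uq_def Uq_def FactRing_def A_RCOSETS_def' to_small_def)

lemma small_act_eq:
  assumes "q \<noteq> 0" "q - inverse q \<noteq> 0" "qint q (int l) = 0" "l > 0"
    and p: "p \<in> carrier (free_alg n)"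
  shows "small_act q (to_small n q l p) v = free_act q p v"
proof -
  interpret F: ring "free_alg n :: (word \<Rightarrow>\<^sub>0 'a) ring" by (rule ring_free_alg)
  interpret I: ideal "Uq_ideal n q" "free_alg n" by (rule ideal_Uq_ideal)
  interpret U: ring "Uq n q" by (rule ring_Uq)
  interpret J: ideal "small_ideal n q l" "Uq n q" by (rule ideal_small_ideal)
  have eq: "free_act q p' v = free_act q p v" if "p' \<in> \<Union>(to_small n q l p)" for p'
  proof -
    from that obtain Y where Y: "Y \<in> to_small n q l p" "p' \<in> Y" by blast
    then obtain j where j: "j \<in> small_ideal n q l"
      and Yj: "Y = j \<oplus>\<^bsub>Uq n q\<^esub> (Uq_ideal n q +>\<^bsub>free_alg n\<^esub> p)"
      by (auto simp: to_small_def a_r_coset_def')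
    from j small_ideal_subset_kernel[OF assms(1-4)] obtain m
      where m: "m \<in> act_kernel n q" and jm: "j = Uq_ideal n q +>\<^bsub>free_alg n\<^esub> m" by blast
    have mF: "m \<in> carrier (free_alg n)" using m by (simp add: act_kernel_def)
    have "Y = Uq_ideal n q +>\<^bsub>free_alg n\<^esub> (m + p)"
      using I.a_rcos_sum[OF mF p] by (simp add: Yj jm Uq_def FactRing_def)
    with Y(2) obtain i where "i \<in> Uq_ideal n q" "p' = i + (m + p)"
      by (auto simp: a_r_coset_def')
    moreover have "i \<in> act_kernel n q"
      using Uq_ideal_subset_kernel[OF assms(1,2)] \<open>i \<in> Uq_ideal n q\<close> by blast
    ultimately show ?thesis
      using m by (simp add: free_act_add_left act_kernel_def)
  qed
  have "p \<in> Uq_ideal n q +>\<^bsub>free_alg n\<^esub> p"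
    using p by (rule I.a_rcos_self)
  moreover have "Uq_ideal n q +>\<^bsub>free_alg n\<^esub> p \<in> carrier (Uq n q)"
    using p ideal.rcos_ring_hom[OF ideal_Uq_ideal[of n q]] by (auto simp: Uq_def ring_hom_closed)
  then have "Uq_ideal n q +>\<^bsub>free_alg n\<^esub> p \<in> to_small n q l p"
    unfolding to_small_def by (rule J.a_rcos_self)
  ultimately have "p \<in> \<Union>(to_small n q l p)" by blast
  then show ?thesis
    unfolding small_act_def using eq by (intro the_equality) (blast, metis)
qed

lemma keys_free_act:
  assumes S: "\<And>i g \<beta>. gen_index g \<in> {1..<n} \<Longrightarrow> \<beta> \<in> S \<Longrightarrow> Poly_Mapping.keys (gen_basis q g \<beta>) \<subseteq> S"
    and p: "p \<in> carrier (free_alg n)" and v: "Poly_Mapping.keys v \<subseteq> S"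
  shows "Poly_Mapping.keys (free_act q p v) \<subseteq> S"
  unfolding free_act_def
proof (rule keys_lin_ext)
  fix w assume "w \<in> Poly_Mapping.keys p"
  then have "gen_index ` set (letters w) \<subseteq> {1..<n}"
    using p by (simp add: free_alg_def)
  then have "Poly_Mapping.keys (foldr (gen_act q) (letters w) v) \<subseteq> S"
  proof (induction "letters w" arbitrary: w)
    case (Cons g gs)
    have IH: "Poly_Mapping.keys (foldr (gen_act q) gs v) \<subseteq> S"
      using Cons(1)[of "Word gs"] Cons(2,3) by (simp flip: Cons(2))
    have "Poly_Mapping.keys (gen_act q g (foldr (gen_act q) gs v)) \<subseteq> S"
      unfolding gen_act_def[of q g]
      by (rule keys_lin_ext, rule S) (use IH Cons(3) in \<open>auto simp flip: Cons(2)\<close>)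
    then show ?case by (simp flip: Cons(2))
  qed (use v in simp)
  then show "Poly_Mapping.keys (word_act q w v) \<subseteq> S"
    by (simp add: word_act_def)
qed

lemma sum_upd2:
  fixes \<beta> :: "nat \<Rightarrow> nat"
  assumes "i \<in> {1..<n}"
  shows "(\<Sum>j=1..n. (\<beta>(i := x, Suc i := y)) j) + \<beta> i + \<beta> (Suc i) = (\<Sum>j=1..n. \<beta> j) + x + y"
proof -
  have split: "(\<Sum>j=1..n. f j) = f i + f (Suc i) + (\<Sum>j\<in>{1..n} - {i, Suc i}. f j)" for f :: "nat \<Rightarrow> nat"
    using assms sum.subset_diff[of "{i, Suc i}" "{1..n}" f] by simp
  have "(\<Sum>j\<in>{1..n} - {i, Suc i}. (\<beta>(i := x, Suc i := y)) j) = (\<Sum>j\<in>{1..n} - {i, Suc i}. \<beta> j)"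
    by (intro sum.cong) auto
  then show ?thesis
    unfolding split[of \<beta>] split[of "\<beta>(i := x, Suc i := y)"] by simp
qed

lemma keys_gen_basis_multi:
  assumes "gen_index g \<in> {1..<n}" "\<beta> \<in> multi_indices n"
  shows "Poly_Mapping.keys (gen_basis q g \<beta>) \<subseteq> multi_indices n"
  using assms by (cases g) (auto simp: multi_indices_def)

lemma keys_gen_basis_homogeneous:
  assumes "gen_index g \<in> {1..<n}" "\<beta> \<in> {\<alpha> \<in> multi_indices n. (\<Sum>i=1..n. \<alpha> i) = s}"
  shows "Poly_Mapping.keys (gen_basis q g \<beta>) \<subseteq> {\<alpha> \<in> multi_indices n. (\<Sum>i=1..n. \<alpha> i) = s}"
proof -
  have "(\<Sum>i=1..n. \<alpha> i) = s" if "\<alpha> \<in> Poly_Mapping.keys (gen_basis q g \<beta>)" for \<alpha>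
  proof (cases g)
    case (GenE i)
    then show ?thesis
      using that assms sum_upd2[of i n \<beta> "\<beta> i + 1" "\<beta> (Suc i) - 1"]
      by (auto split: if_splits simp del: fun_upd_apply)
  next
    case (GenF i)
    then show ?thesis
      using that assms sum_upd2[of i n \<beta> "\<beta> i - 1" "\<beta> (Suc i) + 1"]
      by (auto split: if_splits simp del: fun_upd_apply)
  qed (use that assms in \<open>auto split: if_splits\<close>)
  then show ?thesis
    using keys_gen_basis_multi[OF assms(1)] assms(2) by blast
qed

lemma Aq_simps [simp]:
  "v \<in> carrier (Aq n q) \<longleftrightarrow> Poly_Mapping.keys v \<subseteq> multi_indices n"
  "\<zero>\<^bsub>Aq n q\<^esub> = 0" "u \<oplus>\<^bsub>Aq n q\<^esub> v = u + v" "C \<odot>\<^bsub>Aq n q\<^esub> v = small_act q C v"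
  by (simp_all add: Aq_def)

lemma qchar_qint:
  assumes "qchar q = l" "l > 0"
  shows "qint q (int l) = 0"
  using assms LeastI_ex[of "\<lambda>l. l > 0 \<and> qint q (int l) = 0"]
  by (auto simp: qchar_def split: if_splits)

lemma q_minus_inverse:
  fixes q :: "'k::field"
  assumes "q \<noteq> 0" "q \<noteq> 1" "q \<noteq> - 1"
  shows "q - inverse q \<noteq> 0"
proof
  assume "q - inverse q = 0"
  then have "q * q = 1" using assms(1) by (metis eq_iff_diff_eq_0 right_inverse)
  then show False using assms by (simp add: square_eq_1_iff)
qed

theorem Aq_left_module:
  fixes q :: "'k::field"
  assumes "q \<noteq> 0" "q \<noteq> 1" "q \<noteq> - 1" "qchar q = l" "l > 0"
  shows "left_module (small_uq n q l) (Aq n q)"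
proof -
  note act = small_act_eq[OF assms(1) q_minus_inverse[OF assms(1-3)] qchar_qint[OF assms(4,5)] assms(5)]
  note hom = to_small_hom[of n q l]
  have add: "Poly_Mapping.keys (u + v) \<subseteq> S" if "Poly_Mapping.keys u \<subseteq> S" "Poly_Mapping.keys v \<subseteq> S"
    for u v :: "(nat \<Rightarrow> nat) \<Rightarrow>\<^sub>0 'k" and S
    using that Poly_Mapping.keys_add[of u v] by blast
  have "abelian_group (Aq n q)"
  proof (rule abelian_groupI)
    fix v assume "v \<in> carrier (Aq n q)"
    then show "\<exists>u\<in>carrier (Aq n q). u \<oplus>\<^bsub>Aq n q\<^esub> v = \<zero>\<^bsub>Aq n q\<^esub>"
      by (intro bexI[of _ "- v"]) simp_all
  qed (simp_all add: add_ac add)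
  moreover have "left_module_axioms (small_uq n q l) (Aq n q)"
  proof (rule left_module_axioms.intro)
    fix C D u v
    assume "C \<in> carrier (small_uq n q l)" and u: "u \<in> carrier (Aq n q)"
    then obtain p where p: "p \<in> carrier (free_alg n)" and C: "C = to_small n q l p"
      by (auto simp: small_uq_carrier)
    show "C \<odot>\<^bsub>Aq n q\<^esub> u \<in> carrier (Aq n q)"
      using keys_free_act[where S = "multi_indices n" and p = p and v = u, OF keys_gen_basis_multi p] u
      by (simp add: C act p)
    show "C \<odot>\<^bsub>Aq n q\<^esub> (u \<oplus>\<^bsub>Aq n q\<^esub> v) = C \<odot>\<^bsub>Aq n q\<^esub> u \<oplus>\<^bsub>Aq n q\<^esub> C \<odot>\<^bsub>Aq n q\<^esub> v"
      by (simp add: C act p free_act_add_right)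
    assume "D \<in> carrier (small_uq n q l)"
    then obtain p' where p': "p' \<in> carrier (free_alg n)" and D: "D = to_small n q l p'"
      by (auto simp: small_uq_carrier)
    show "(C \<oplus>\<^bsub>small_uq n q l\<^esub> D) \<odot>\<^bsub>Aq n q\<^esub> u = C \<odot>\<^bsub>Aq n q\<^esub> u \<oplus>\<^bsub>Aq n q\<^esub> D \<odot>\<^bsub>Aq n q\<^esub> u"
      unfolding C D ring_hom_add[OF hom p p', symmetric]
      by (simp add: act p p' free_act_add_left free_alg_closed)
    show "(C \<otimes>\<^bsub>small_uq n q l\<^esub> D) \<odot>\<^bsub>Aq n q\<^esub> u = C \<odot>\<^bsub>Aq n q\<^esub> (D \<odot>\<^bsub>Aq n q\<^esub> u)"
      unfolding C D ring_hom_mult[OF hom p p', symmetric]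
      by (simp add: act p p' free_act_mult free_alg_closed)
  next
    fix u assume "u \<in> carrier (Aq n q)"
    show "\<one>\<^bsub>small_uq n q l\<^esub> \<odot>\<^bsub>Aq n q\<^esub> u = u"
      unfolding ring_hom_one[OF hom, symmetric] by (simp add: act)
  qed
  ultimately show ?thesis
    by (intro left_module.intro ring_small_uq)
qed

theorem Aq_homogeneous_submodule:
  fixes q :: "'k::field"
  assumes "q \<noteq> 0" "q \<noteq> 1" "q \<noteq> - 1" "qchar q = l" "l > 0"
  shows "submodule (Aq_homogeneous n s) (small_uq n q l) (Aq n q)"
proof -
  interpret left_module "small_uq n q l" "Aq n q" by (rule Aq_left_module[OF assms])
  note act = small_act_eq[OF assms(1) q_minus_inverse[OF assms(1-3)] qchar_qint[OF assms(4,5)] assms(5)]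
  let ?S = "{\<alpha> \<in> multi_indices n. (\<Sum>i=1..n. \<alpha> i) = s}"
  have sub: "Aq_homogeneous n s \<subseteq> carrier (Aq n q)"
    by (auto simp: Aq_homogeneous_def)
  show ?thesis
  proof (rule submodule.intro)
    show "subgroup (Aq_homogeneous n s) (add_monoid (Aq n q))"
    proof (rule M.add.subgroupI)
      show "Aq_homogeneous n s \<noteq> {}"
        by (auto simp: Aq_homogeneous_def intro!: exI[of _ 0])
    next
      fix v :: "(nat \<Rightarrow> nat) \<Rightarrow>\<^sub>0 'k" assume v: "v \<in> Aq_homogeneous n s"
      then have "\<ominus>\<^bsub>Aq n q\<^esub> v = - v"
        by (intro M.minus_equality) (auto simp: Aq_homogeneous_def)
      then show "\<ominus>\<^bsub>Aq n q\<^esub> v \<in> Aq_homogeneous n s"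
        using v by (simp add: Aq_homogeneous_def)
    next
      fix u v :: "(nat \<Rightarrow> nat) \<Rightarrow>\<^sub>0 'k" assume "u \<in> Aq_homogeneous n s" "v \<in> Aq_homogeneous n s"
      then show "u \<oplus>\<^bsub>Aq n q\<^esub> v \<in> Aq_homogeneous n s"
        using Poly_Mapping.keys_add[of u v] by (auto simp: Aq_homogeneous_def)
    qed (use sub in simp)
    show "submodule_axioms (Aq_homogeneous n s) (small_uq n q l) (Aq n q)"
    proof (rule submodule_axioms.intro)
      fix C and v :: "(nat \<Rightarrow> nat) \<Rightarrow>\<^sub>0 'k"
      assume "C \<in> carrier (small_uq n q l)" and v: "v \<in> Aq_homogeneous n s"
      then obtain p where p: "p \<in> carrier (free_alg n)" "C = to_small n q l p"
        by (auto simp: small_uq_carrier)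
      have "Poly_Mapping.keys (free_act q p v) \<subseteq> ?S"
        by (rule keys_free_act[where n = n, OF keys_gen_basis_homogeneous])
          (use v p in \<open>auto simp: Aq_homogeneous_def\<close>)
      then show "C \<odot>\<^bsub>Aq n q\<^esub> v \<in> Aq_homogeneous n s"
        by (simp add: act p Aq_homogeneous_def)
    qed
  qed
qed

text \<open>Hence the homogeneous components are finite-dimensional.\<close>

lemma finite_homogeneous_basis: "finite {\<alpha> \<in> multi_indices n. (\<Sum>i=1..n. \<alpha> i) = s}"
proof (rule finite_subset)
  show "{\<alpha> \<in> multi_indices n. (\<Sum>i=1..n. \<alpha> i) = s}
      \<subseteq> {\<alpha>. \<forall>i. (i \<in> {1..n} \<longrightarrow> \<alpha> i \<in> {..s}) \<and> (i \<notin> {1..n} \<longrightarrow> \<alpha> i = 0)}"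
    by (auto simp: multi_indices_def intro: member_le_sum)
  show "finite {\<alpha>. \<forall>i. (i \<in> {1..n} \<longrightarrow> \<alpha> i \<in> {..s}) \<and> (i \<notin> {1..n} \<longrightarrow> \<alpha> i = (0 :: nat))}"
    by (rule finite_set_of_finite_funs) auto
qed


end

theory Submission
  imports Defs
begin

text \<open>
  Write an exponent as \<open>\<beta> = \<rho> + l m\<close> with residues \<open>0 \<le> \<rho>\<^sub>i < l\<close>, and call \<open>\<Sum> m\<^sub>i\<close> its energy. Every
  word in the generators acts on monomials as a partial shift and never increases any \<open>m\<^sub>i\<close>, so
  the monomials of energy below \<open>K\<close> span a submodule \<open>D K\<close>. Modulo \<open>D K\<close> the layer of energy \<open>K\<close>
  is a direct sum, over the \<open>m\<close> of sum \<open>K\<close>, of simple modules with basis indexed by the residues of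
  sum \<open>s - l K\<close>. Between residues of one layer there are words that annihilate all other residues
  of that layer; composing them with a step that carries across a multiple of \<open>l\<close> gives operators
  that lower the energy from \<open>K + 1\<close> to \<open>K\<close> and map \<open>D (K + 1)\<close> into \<open>D K\<close>. These force both the
  socle and the radical filtration to be the energy filtration.

  For indecomposability, the matrix entry \<open>(\<beta>, \<beta>')\<close> of an equivariant projection vanishes exactly
  when the entry at \<open>(\<beta> + \<delta>, \<beta>' + \<delta>)\<close> does, for every shift \<open>\<delta>\<close> of a word that is nonzero on both.
  Descending one layer and ascending again therefore shows that on the top layer the projection is a
  scalar modulo the radical, so one of the two summands is everything by Nakayama's lemma.
\<close>

section \<open>Submodules, quotients and the socle\<close>

text \<open>The weights of the \<open>K_i\<close> do not separate the residues of a layer: for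
  \<open>n = l = 3\<close> and \<open>q\<close> of order 3, the residues (0,1,2), (1,2,0) and
  (2,0,1) have the same sum and the same weight. Single residues are therefore isolated by crossing
  the whole layer: the potential \<Sum> i \<rho>_i has a unique maximum there, and a shift as long
  as the range of the potential fits inside the layer only if it starts at one particular residue;
  from any other start it vanishes or loses energy.

  The bound n \<ge> 3 gives the top layer a neighbour. Its residues have sum r = s mod l \<le> l -
  1, and r + l \<le> n (l - 1) then makes the layer below nonempty as soon as the top energy is
  positive. For n = 2 and s = l - 1 + l K there is only the layer of energy K, and the component is
  a direct sum of K + 1 simple modules.\<close>

lemma submoduleD:
  assumes "left_module R M" "submodule H R M"
  shows "additive_subgroup H M" "abelian_subgroup H M" "H \<subseteq> carrier M" "\<zero>\<^bsub>M\<^esub> \<in> H"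
    "\<And>x y. x \<in> H \<Longrightarrow> y \<in> H \<Longrightarrow> x \<oplus>\<^bsub>M\<^esub> y \<in> H"
    "\<And>x. x \<in> H \<Longrightarrow> \<ominus>\<^bsub>M\<^esub> x \<in> H"
    "\<And>a x. a \<in> carrier R \<Longrightarrow> x \<in> H \<Longrightarrow> a \<odot>\<^bsub>M\<^esub> x \<in> H"
proof -
  interpret left_module R M by fact
  show *: "additive_subgroup H M"
    using assms(2) by (simp add: submodule_def additive_subgroupI)
  then show "abelian_subgroup H M"
    by (rule abelian_subgroupI3) (rule M.abelian_group_axioms)
  interpret additive_subgroup H M by fact
  show "H \<subseteq> carrier M" "\<zero>\<^bsub>M\<^esub> \<in> H"
    "\<And>x y. x \<in> H \<Longrightarrow> y \<in> H \<Longrightarrow> x \<oplus>\<^bsub>M\<^esub> y \<in> H"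
    "\<And>x. x \<in> H \<Longrightarrow> \<ominus>\<^bsub>M\<^esub> x \<in> H"
    using a_subset by auto
  show "\<And>a x. a \<in> carrier R \<Longrightarrow> x \<in> H \<Longrightarrow> a \<odot>\<^bsub>M\<^esub> x \<in> H"
    using assms(2) by (rule submodule.smult_closed)
qed

text \<open>The radical series and \<open>simple_module\<close> speak about records with a smaller
  carrier; this brings them back to submodules of one fixed module.\<close>

lemma submodule_restrict_iff:
  assumes "left_module R M" "submodule S R M"
  shows "submodule T R (M\<lparr>carrier := S\<rparr>) \<longleftrightarrow> submodule T R M \<and> T \<subseteq> S"
proof -
  interpret left_module R M by fact
  have S: "subgroup S (add_monoid M)" using assms(2) by (simp add: submodule_def)
  have eq: "add_monoid (M\<lparr>carrier := S\<rparr>) = (add_monoid M)\<lparr>carrier := S\<rparr>" by simp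
  have "subgroup T (add_monoid (M\<lparr>carrier := S\<rparr>)) \<longleftrightarrow> subgroup T (add_monoid M) \<and> T \<subseteq> S"
    unfolding eq
    using M.add.incl_subgroup[OF S, of T] M.add.subgroup_incl[OF _ S, of T]
      subgroup.subset[of T "(add_monoid M)\<lparr>carrier := S\<rparr>"] by auto
  then show ?thesis
    by (auto simp: submodule_def submodule_axioms_def)
qed

locale quotient_of_module =
  fixes R :: "('a, 'r) ring_scheme" and M :: "('a, 'b, 'm) module_scheme" and N :: "'b set"
  assumes left_module: "left_module R M" and submodule: "submodule N R M"
begin

abbreviation Q where "Q \<equiv> quotient_module M N"

sublocale left_module R M by (rule left_module)
sublocale N: abelian_subgroup N M by (rule submoduleD[OF left_module submodule])

lemma quotient_simps:
  "carrier Q = (\<lambda>x. N +>\<^bsub>M\<^esub> x) ` carrier M" "zero Q = N" "add Q = set_add M"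
  by (auto simp: quotient_module_def A_RCOSETS_def')

lemma quotient_zero: "\<zero>\<^bsub>Q\<^esub> = N +>\<^bsub>M\<^esub> \<zero>\<^bsub>M\<^esub>"
  by (simp add: quotient_simps N.a_subset)

lemma quotient_add:
  assumes "x \<in> carrier M" "y \<in> carrier M"
  shows "(N +>\<^bsub>M\<^esub> x) \<oplus>\<^bsub>Q\<^esub> (N +>\<^bsub>M\<^esub> y) = N +>\<^bsub>M\<^esub> (x \<oplus>\<^bsub>M\<^esub> y)"
  using assms by (simp add: quotient_simps N.a_rcos_sum)

lemma coset_eq_iff:
  assumes "x \<in> carrier M" "y \<in> carrier M"
  shows "N +>\<^bsub>M\<^esub> x = N +>\<^bsub>M\<^esub> y \<longleftrightarrow> (\<exists>z\<in>N. x = z \<oplus>\<^bsub>M\<^esub> y)"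
proof -
  have "N +>\<^bsub>M\<^esub> x = N +>\<^bsub>M\<^esub> y \<longleftrightarrow> x \<in> N +>\<^bsub>M\<^esub> y"
    using assms N.a_repr_independence' N.a_repr_independenceD by metis
  then show ?thesis by (auto simp: a_r_coset_def')
qed

text \<open>The scalar action of \<open>quotient_module\<close> is a union over representatives. It
  collapses to a single coset because \<open>N\<close> is stable under scalars.\<close>

lemma quotient_smult:
  assumes "a \<in> carrier R" "x \<in> carrier M"
  shows "a \<odot>\<^bsub>Q\<^esub> (N +>\<^bsub>M\<^esub> x) = N +>\<^bsub>M\<^esub> (a \<odot>\<^bsub>M\<^esub> x)"
proof -
  have "N +>\<^bsub>M\<^esub> (a \<odot>\<^bsub>M\<^esub> y) = N +>\<^bsub>M\<^esub> (a \<odot>\<^bsub>M\<^esub> x)" if y: "y \<in> N +>\<^bsub>M\<^esub> x" for y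
  proof -
    obtain z where "z \<in> N" "y = z \<oplus>\<^bsub>M\<^esub> x" using y by (auto simp: a_r_coset_def')
    moreover from this have "z \<in> carrier M" using N.a_subset by blast
    ultimately show ?thesis
      using assms submoduleD(7)[OF left_module submodule, of a z]
      by (subst coset_eq_iff) (auto simp: smult_closed smult_r_distr)
  qed
  then have "(\<Union>y\<in>N +>\<^bsub>M\<^esub> x. N +>\<^bsub>M\<^esub> (a \<odot>\<^bsub>M\<^esub> y))
      = (\<Union>y\<in>N +>\<^bsub>M\<^esub> x. N +>\<^bsub>M\<^esub> (a \<odot>\<^bsub>M\<^esub> x))"
    by (rule SUP_cong[OF refl])
  also have "\<dots> = N +>\<^bsub>M\<^esub> (a \<odot>\<^bsub>M\<^esub> x)"
    using N.a_rcos_self[OF assms(2)] by (subst UN_constant) auto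
  finally show ?thesis
    by (simp add: quotient_module_def)
qed

lemma left_module_quotient: "left_module R Q"
proof -
  have ag: "abelian_group Q"
  proof (rule abelian_groupI)
    fix X assume "X \<in> carrier Q"
    then obtain x where "x \<in> carrier M" "X = N +>\<^bsub>M\<^esub> x"
      by (auto simp: quotient_simps(1))
    then show "\<exists>Y\<in>carrier Q. Y \<oplus>\<^bsub>Q\<^esub> X = \<zero>\<^bsub>Q\<^esub>"
      by (intro bexI[of _ "N +>\<^bsub>M\<^esub> (\<ominus>\<^bsub>M\<^esub> x)"])
        (simp_all add: quotient_add quotient_zero quotient_simps(1) M.l_neg)
  qed (auto simp: quotient_simps(1) quotient_zero quotient_add M.a_ac)
  have "left_module_axioms R Q"
    by (rule left_module_axioms.intro)
      (auto simp: quotient_simps(1) quotient_add quotient_smult smult_closed smult_l_distr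
        smult_r_distr smult_assoc smult_one)
  then show ?thesis
    by (rule left_module.intro[OF R.ring_axioms ag])
qed

lemma submodule_image:
  assumes H: "submodule H R M"
  shows "submodule ((\<lambda>x. N +>\<^bsub>M\<^esub> x) ` H) R Q"
proof -
  interpret Q: left_module R Q by (rule left_module_quotient)
  note D = submoduleD[OF left_module H]
  have inH: "x \<in> carrier M" if "x \<in> H" for x using that D(3) by blast
  have "subgroup ((\<lambda>x. N +>\<^bsub>M\<^esub> x) ` H) (add_monoid Q)"
  proof (rule Q.add.subgroupI)
    fix X assume "X \<in> (\<lambda>x. N +>\<^bsub>M\<^esub> x) ` H"
    then obtain x where x: "x \<in> H" "X = N +>\<^bsub>M\<^esub> x" by auto
    have "\<ominus>\<^bsub>Q\<^esub> X = N +>\<^bsub>M\<^esub> (\<ominus>\<^bsub>M\<^esub> x)"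
      by (rule Q.minus_equality)
        (use x inH in \<open>auto simp: quotient_add M.l_neg quotient_zero quotient_simps(1)\<close>)
    then show "\<ominus>\<^bsub>Q\<^esub> X \<in> (\<lambda>x. N +>\<^bsub>M\<^esub> x) ` H" using x(1) D(6) by auto
  qed (use D(4,5) inH in \<open>auto simp: quotient_simps(1) quotient_add\<close>)
  then show ?thesis
    using D(7) inH by (auto simp: submodule_def submodule_axioms_def quotient_smult)
qed

lemma submodule_vimage:
  assumes H: "submodule H R Q"
  shows "submodule {x \<in> carrier M. N +>\<^bsub>M\<^esub> x \<in> H} R M"
    and "N \<subseteq> {x \<in> carrier M. N +>\<^bsub>M\<^esub> x \<in> H}"
    and "(\<lambda>x. N +>\<^bsub>M\<^esub> x) ` {x \<in> carrier M. N +>\<^bsub>M\<^esub> x \<in> H} = H"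
proof -
  interpret Q: left_module R Q by (rule left_module_quotient)
  note D = submoduleD[OF left_module_quotient H]
  show "N \<subseteq> {x \<in> carrier M. N +>\<^bsub>M\<^esub> x \<in> H}"
    using D(4) N.a_subset by (auto simp: quotient_simps(2) N.a_rcos_const)
  show "(\<lambda>x. N +>\<^bsub>M\<^esub> x) ` {x \<in> carrier M. N +>\<^bsub>M\<^esub> x \<in> H} = H"
    using D(3) by (auto simp: quotient_simps(1))
  have "subgroup {x \<in> carrier M. N +>\<^bsub>M\<^esub> x \<in> H} (add_monoid M)"
  proof (rule M.add.subgroupI)
    fix x assume x: "x \<in> {x \<in> carrier M. N +>\<^bsub>M\<^esub> x \<in> H}"
    have "\<ominus>\<^bsub>Q\<^esub> (N +>\<^bsub>M\<^esub> x) = N +>\<^bsub>M\<^esub> (\<ominus>\<^bsub>M\<^esub> x)"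
      by (rule Q.minus_equality)
        (use x in \<open>auto simp: quotient_add M.l_neg quotient_zero quotient_simps(1)\<close>)
    then show "\<ominus>\<^bsub>M\<^esub> x \<in> {x \<in> carrier M. N +>\<^bsub>M\<^esub> x \<in> H}"
      using x D(6)[of "N +>\<^bsub>M\<^esub> x"] by simp
  next
    show "{x \<in> carrier M. N +>\<^bsub>M\<^esub> x \<in> H} \<noteq> {}"
      using D(4) by (auto simp: quotient_zero)
  qed (use D(5) in \<open>auto simp: quotient_add[symmetric]\<close>)
  then show "submodule {x \<in> carrier M. N +>\<^bsub>M\<^esub> x \<in> H} R M"
    using D(7) by (auto simp: submodule_def submodule_axioms_def quotient_smult[symmetric] smult_closed)
qed

lemma mem_image_iff:
  assumes "submodule H R M" "N \<subseteq> H" "x \<in> carrier M"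
  shows "N +>\<^bsub>M\<^esub> x \<in> (\<lambda>x. N +>\<^bsub>M\<^esub> x) ` H \<longleftrightarrow> x \<in> H"
proof
  note D = submoduleD[OF left_module assms(1)]
  assume "N +>\<^bsub>M\<^esub> x \<in> (\<lambda>x. N +>\<^bsub>M\<^esub> x) ` H"
  then obtain y where y: "y \<in> H" "N +>\<^bsub>M\<^esub> x = N +>\<^bsub>M\<^esub> y" by blast
  then obtain z where "z \<in> N" "x = z \<oplus>\<^bsub>M\<^esub> y"
    using coset_eq_iff[OF assms(3), of y] D(3) by auto
  then show "x \<in> H" using y(1) assms(2) D(5) by auto
qed simp

text \<open>The preimages in \<open>M\<close> of the simple submodules of the quotient; with them
  the socle can be computed without cosets.\<close>

definition minimal_over :: "'b set \<Rightarrow> bool" where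
  "minimal_over S \<longleftrightarrow> submodule S R M \<and> N \<subset> S \<and>
     (\<forall>T. submodule T R M \<longrightarrow> N \<subseteq> T \<longrightarrow> T \<subseteq> S \<longrightarrow> T = N \<or> T = S)"

text \<open>The correspondence theorem: images and preimages match the submodules between
  \<open>N\<close> and \<open>S\<close> with those of the image of \<open>S\<close>.\<close>

lemma simple_image_iff:
  assumes S: "submodule S R M" "N \<subseteq> S"
  shows "simple_module R (Q\<lparr>carrier := (\<lambda>x. N +>\<^bsub>M\<^esub> x) ` S\<rparr>) \<longleftrightarrow> minimal_over S"
proof -
  let ?\<phi> = "\<lambda>x. N +>\<^bsub>M\<^esub> x"
  have SM: "S \<subseteq> carrier M" by (rule submoduleD[OF left_module S(1)])
  have "?\<phi> ` N = (\<lambda>_. N) ` N"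
    by (rule image_cong) (simp_all add: N.a_rcos_const)
  then have \<phi>N: "?\<phi> ` N = {N}"
    by (simp add: image_constant[OF N.zero_closed])
  have inj: "T = T'" if T: "submodule T R M" "N \<subseteq> T" "submodule T' R M" "N \<subseteq> T'" "?\<phi> ` T = ?\<phi> ` T'" for T T'
  proof -
    have "x \<in> T \<longleftrightarrow> x \<in> T'" if x: "x \<in> carrier M" for x
    proof -
      have "x \<in> T \<longleftrightarrow> ?\<phi> x \<in> ?\<phi> ` T"
        using mem_image_iff[OF T(1,2) x] by (rule sym)
      also have "\<dots> \<longleftrightarrow> ?\<phi> x \<in> ?\<phi> ` T'"
        by (simp only: T(5))
      also have "\<dots> \<longleftrightarrow> x \<in> T'"
        by (rule mem_image_iff[OF T(3,4) x])
      finally show ?thesis .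
    qed
    then show ?thesis
      using submoduleD(3)[OF left_module] that(1,3) by blast
  qed
  have sub: "submodule H R (Q\<lparr>carrier := ?\<phi> ` S\<rparr>) \<longleftrightarrow> submodule H R Q \<and> H \<subseteq> ?\<phi> ` S" for H
    by (rule submodule_restrict_iff[OF left_module_quotient submodule_image[OF S(1)]])
  have simple: "simple_module R (Q\<lparr>carrier := ?\<phi> ` S\<rparr>) \<longleftrightarrow> ?\<phi> ` S \<noteq> {N} \<and>
      (\<forall>H. submodule H R Q \<and> H \<subseteq> ?\<phi> ` S \<longrightarrow> H = {N} \<or> H = ?\<phi> ` S)"
    by (simp add: simple_module_def sub quotient_simps(2))
  show ?thesis
  proof
    assume L: "simple_module R (Q\<lparr>carrier := ?\<phi> ` S\<rparr>)"
    note L = L[unfolded simple, THEN conjunct1] L[unfolded simple, THEN conjunct2, rule_format]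
    have "N \<noteq> S"
    proof
      assume "N = S"
      then show False using L(1) \<phi>N by (simp only:)
    qed
    moreover have "T = N \<or> T = S" if T: "submodule T R M" "N \<subseteq> T" "T \<subseteq> S" for T
    proof -
      have "?\<phi> ` T = {N} \<or> ?\<phi> ` T = ?\<phi> ` S"
        by (rule L(2)) (intro conjI submodule_image T(1) image_mono T(3))
      then show ?thesis
        using inj[OF T(1,2) submodule subset_refl] inj[OF T(1,2) S] unfolding \<phi>N by blast
    qed
    ultimately show "minimal_over S" using S by (auto simp: minimal_over_def)
  next
    assume m: "minimal_over S"
    have "?\<phi> ` S \<noteq> {N}"
      using inj[OF S submodule subset_refl] m unfolding \<phi>N minimal_over_def by blast
    moreover have "H = {N} \<or> H = ?\<phi> ` S" if H: "submodule H R Q" "H \<subseteq> ?\<phi> ` S" for H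
    proof -
      let ?T = "{x \<in> carrier M. ?\<phi> x \<in> H}"
      note T = submodule_vimage[OF H(1)]
      have "?T \<subseteq> S" using H(2) mem_image_iff[OF S] by blast
      then have "?T = N \<or> ?T = S"
        using m T(1,2) unfolding minimal_over_def by blast
      then show ?thesis
      proof
        assume "?T = N"
        then show ?thesis using T(3) unfolding \<open>?T = N\<close> \<phi>N by simp
      next
        assume "?T = S"
        then show ?thesis using T(3) unfolding \<open>?T = S\<close> by simp
      qed
    qed
    ultimately show "simple_module R (Q\<lparr>carrier := ?\<phi> ` S\<rparr>)"
      unfolding simple by (intro conjI allI impI) (auto dest: conjunct1 conjunct2)
  qed
qed

text \<open>The socle is an intersection, so two bounds identify it: \<open>upper\<close> makes
  \<open>H\<close> one of the intersected submodules, and \<open>lower\<close> makes it the least of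
  them.\<close>

lemma vimage_socle:
  assumes H: "submodule H R M" "N \<subseteq> H"
    and upper: "\<And>S. minimal_over S \<Longrightarrow> S \<subseteq> H"
    and lower: "\<And>T. submodule T R M \<Longrightarrow> N \<subseteq> T \<Longrightarrow> (\<And>S. minimal_over S \<Longrightarrow> S \<subseteq> T) \<Longrightarrow> H \<subseteq> T"
  shows "{x \<in> carrier M. N +>\<^bsub>M\<^esub> x \<in> socle R Q} = H"
proof -
  let ?\<phi> = "\<lambda>x. N +>\<^bsub>M\<^esub> x"
  have simple: "\<exists>S'. minimal_over S' \<and> S = ?\<phi> ` S'"
    if "submodule S R Q" "simple_module R (Q\<lparr>carrier := S\<rparr>)" for S
    using submodule_vimage[OF that(1)] that(2) simple_image_iff by metis
  have "?\<phi> ` H \<in> {H. submodule H R Q \<and> (\<forall>S. submodule S R Q \<and> simple_module R (Q\<lparr>carrier := S\<rparr>) \<longrightarrow> S \<subseteq> H)}"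
    using submodule_image[OF H(1)] simple upper by blast
  then have 1: "socle R Q \<subseteq> ?\<phi> ` H" unfolding socle_def by blast
  have 2: "?\<phi> x \<in> X" if x: "x \<in> H" and X: "submodule X R Q"
    "\<And>S. submodule S R Q \<Longrightarrow> simple_module R (Q\<lparr>carrier := S\<rparr>) \<Longrightarrow> S \<subseteq> X" for x X
  proof -
    have "H \<subseteq> {x \<in> carrier M. ?\<phi> x \<in> X}"
    proof (rule lower)
      fix S assume S: "minimal_over S"
      then have S': "submodule S R M" "N \<subseteq> S" by (auto simp: minimal_over_def)
      then have "?\<phi> ` S \<subseteq> X"
        using S simple_image_iff[OF S'] submodule_image[OF S'(1)] X(2) by blast
      then show "S \<subseteq> {x \<in> carrier M. ?\<phi> x \<in> X}"
        using submoduleD(3)[OF left_module S'(1)] by blast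
    qed (rule submodule_vimage[OF X(1)])+
    then show ?thesis using x by blast
  qed
  have "x \<in> H" if "x \<in> carrier M" "?\<phi> x \<in> socle R Q" for x
    using 1 that mem_image_iff[OF H] by blast
  moreover have "?\<phi> x \<in> socle R Q" if "x \<in> H" for x
    unfolding socle_def using 2[OF that] by blast
  ultimately show ?thesis
    using submoduleD(3)[OF left_module H(1)] by blast
qed

end

section \<open>Words as partial shifts of multi-indices\<close>

text \<open>Written additively to avoid subtraction on naturals. The weight \<open>f\<close> is
  constantly 1 for plain sums and the identity for the potential \<open>pot\<close>.\<close>

lemma sum_fun_upd2:
  fixes \<beta> :: "'a \<Rightarrow> nat"
  assumes "finite A" "a \<in> A" "b \<in> A" "a \<noteq> b"
  shows "(\<Sum>j\<in>A. f j * (\<beta>(a := x, b := y)) j) + f a * \<beta> a + f b * \<beta> b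
    = (\<Sum>j\<in>A. f j * \<beta> j) + f a * x + f b * y"
proof -
  have split: "(\<Sum>j\<in>A. g j) = g a + g b + (\<Sum>j\<in>A - {a, b}. g j)" for g :: "'a \<Rightarrow> nat"
    using assms sum.subset_diff[of "{a, b}" A g] by simp
  have "(\<Sum>j\<in>A - {a, b}. f j * (\<beta>(a := x, b := y)) j) = (\<Sum>j\<in>A - {a, b}. f j * \<beta> j)"
    by (intro sum.cong) auto
  then show ?thesis
    unfolding split[of "\<lambda>j. f j * \<beta> j"] split[of "\<lambda>j. f j * (\<beta>(a := x, b := y)) j"]
    using assms(4) by simp
qed

text \<open>Greedy filling: each index takes as much of the remaining amount as its capacity
  allows.\<close>

lemma ex_bounded_sum_eq:
  fixes c :: "'a \<Rightarrow> nat"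
  assumes "finite I" "r \<le> (\<Sum>i\<in>I. c i)"
  shows "\<exists>\<rho>. (\<forall>i\<in>I. \<rho> i \<le> c i) \<and> (\<forall>i. i \<notin> I \<longrightarrow> \<rho> i = 0) \<and> (\<Sum>i\<in>I. \<rho> i) = r"
  using assms
proof (induction I arbitrary: r)
  case (insert x I)
  have "r - min r (c x) \<le> (\<Sum>i\<in>I. c i)" using insert.prems insert.hyps by auto
  then obtain \<rho> where \<rho>: "\<forall>i\<in>I. \<rho> i \<le> c i" "\<forall>i. i \<notin> I \<longrightarrow> \<rho> i = 0" "(\<Sum>i\<in>I. \<rho> i) = r - min r (c x)"
    using insert.IH by blast
  have "(\<Sum>i\<in>I. (\<rho>(x := min r (c x))) i) = (\<Sum>i\<in>I. \<rho> i)"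
    using insert.hyps by (intro sum.cong) auto
  then show ?case
    using \<rho> insert.hyps by (intro exI[of _ "\<rho>(x := min r (c x))"]) (auto simp del: fun_upd_apply, auto)
qed auto

lemma poly_mapping_single_eq_iff:
  "Poly_Mapping.single a c = Poly_Mapping.single b d \<longleftrightarrow> (c = 0 \<and> d = 0) \<or> (a = b \<and> c = d)"
  by (metis lookup_single_eq lookup_single_not_eq single_zero)

lemma poly_mapping_single_eq_0_iff: "Poly_Mapping.single a c = 0 \<longleftrightarrow> c = 0"
  using poly_mapping_single_eq_iff[of a c a 0] by simp

locale divided_powers =
  fixes q :: "'k::field" and n l :: nat
  assumes q: "q \<noteq> 0" "q \<noteq> 1" "q \<noteq> - 1" and n: "n \<ge> 3" and qchar: "qchar q = l" and l: "l \<ge> 3"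
begin

lemma l_pos: "l > 0" using l by simp

lemma q_diff: "q - inverse q \<noteq> 0" by (rule q_minus_inverse[OF q])

lemma qint_l: "qint q (int l) = 0" by (rule qchar_qint[OF qchar l_pos])

text \<open>The exponents \<open>a\<close> with \<open>q powi a = q powi (- a)\<close> form a group
  containing \<open>l\<close>. It thus contains the remainder of \<open>a\<close> modulo
  \<open>l\<close>, which the minimality of \<open>l\<close> forces to be 0.\<close>

lemma qint_eq_0_iff_dvd: "qint q (int a) = 0 \<longleftrightarrow> l dvd a"
proof
  assume "l dvd a"
  then show "qint q (int a) = 0" by (intro qint_dvd[OF q_diff qint_l]) simp
next
  assume a: "qint q (int a) = 0"
  let ?d = "int (l * (a div l))" and ?r = "a mod l"
  have "qint q ?d = 0" by (intro qint_dvd[OF q_diff qint_l]) simp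
  then have d: "q powi ?d = q powi (- ?d)" by (rule iffD1[OF qint_eq_0_iff[OF q_diff]])
  have a': "q powi int a = q powi (- int a)" using a by (rule iffD1[OF qint_eq_0_iff[OF q_diff]])
  have r: "int ?r = int a + (- ?d)" "- int ?r = - int a + ?d"
    by (simp_all add: minus_mult_div_eq_mod[symmetric] of_nat_diff algebra_simps flip: of_nat_mult)
  have "q powi int ?r = q powi int a * q powi (- ?d)"
    unfolding r(1) using q(1) by (intro power_int_add) simp
  also have "\<dots> = q powi (- int a) * q powi ?d" by (simp only: d a')
  also have "\<dots> = q powi (- int ?r)"
    unfolding r(2) using q(1) by (intro power_int_add[symmetric]) simp
  finally have "q powi int ?r = q powi (- int ?r)" .
  then have "qint q (int ?r) = 0" by (rule iffD2[OF qint_eq_0_iff[OF q_diff]])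
  moreover have "l = (LEAST l. l > 0 \<and> qint q (int l) = 0)"
    using qchar l_pos by (auto simp: qchar_def split: if_splits)
  moreover have "?r < l" using l_pos by simp
  ultimately have "?r = 0" using not_less_Least[of ?r "\<lambda>l. l > 0 \<and> qint q (int l) = 0"] by auto
  then show "l dvd a" by auto
qed

text \<open>The scalar is forgotten on purpose: the filtrations depend only on which monomials
  survive and where they go.\<close>

definition maps_to :: "(word \<Rightarrow>\<^sub>0 'k) \<Rightarrow> (nat \<Rightarrow> nat) \<Rightarrow> (nat \<Rightarrow> nat) \<Rightarrow> bool" where
  "maps_to p \<beta> \<gamma> \<longleftrightarrow> (\<exists>c. c \<noteq> 0 \<and>
     free_act q p (Poly_Mapping.single \<beta> 1) = Poly_Mapping.single \<gamma> c)"

text \<open>Quantum integers vanish at multiples of \<open>l\<close>, so no generator can carry an exponent upwards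
  across a multiple of \<open>l\<close>. This is the origin of the condition on quotients.\<close>

definition shift_op :: "(word \<Rightarrow>\<^sub>0 'k) \<Rightarrow> (nat \<Rightarrow> int) \<Rightarrow> bool" where
  "shift_op p \<delta> \<longleftrightarrow> p \<in> carrier (free_alg n) \<and>
     (\<forall>\<beta>. free_act q p (Poly_Mapping.single \<beta> 1) = 0 \<or>
       (\<exists>\<gamma>. maps_to p \<beta> \<gamma> \<and> (\<forall>i. int (\<gamma> i) = int (\<beta> i) + \<delta> i) \<and> (\<forall>i. \<gamma> i div l \<le> \<beta> i div l)))"

lemma maps_to_unique:
  assumes "maps_to p \<beta> \<gamma>" "maps_to p \<beta> \<gamma>'"
  shows "\<gamma> = \<gamma>'"
proof -
  obtain c d :: 'k where "c \<noteq> 0" "Poly_Mapping.single \<gamma> c = Poly_Mapping.single \<gamma>' d"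
    using assms unfolding maps_to_def by metis
  then show ?thesis by (simp add: poly_mapping_single_eq_iff)
qed

lemma maps_to_nz: "maps_to p \<beta> \<gamma> \<Longrightarrow> free_act q p (Poly_Mapping.single \<beta> 1) \<noteq> 0"
  by (metis maps_to_def keys_single insert_not_empty keys_zero)

lemma shift_op_carrier: "shift_op p \<delta> \<Longrightarrow> p \<in> carrier (free_alg n)"
  by (simp add: shift_op_def)

lemma shift_opD:
  assumes "shift_op p \<delta>" "maps_to p \<beta> \<gamma>"
  shows "int (\<gamma> i) = int (\<beta> i) + \<delta> i" "\<gamma> i div l \<le> \<beta> i div l"
proof -
  have "free_act q p (Poly_Mapping.single \<beta> 1) \<noteq> 0" by (rule maps_to_nz[OF assms(2)])
  then obtain \<gamma>' where "maps_to p \<beta> \<gamma>'" "\<forall>i. int (\<gamma>' i) = int (\<beta> i) + \<delta> i" "\<forall>i. \<gamma>' i div l \<le> \<beta> i div l"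
    using assms(1) by (auto simp: shift_op_def)
  moreover from this have "\<gamma>' = \<gamma>" using assms(2) maps_to_unique by blast
  ultimately show "int (\<gamma> i) = int (\<beta> i) + \<delta> i" "\<gamma> i div l \<le> \<beta> i div l" by auto
qed

lemma shift_op_nz:
  assumes "shift_op p \<delta>" "free_act q p (Poly_Mapping.single \<beta> 1) \<noteq> 0"
  obtains \<gamma> where "maps_to p \<beta> \<gamma>"
  using assms by (auto simp: shift_op_def)

lemma maps_to_mult:
  assumes "maps_to p \<beta> \<gamma>" "maps_to p' \<gamma> \<gamma>'"
  shows "maps_to (p' * p) \<beta> \<gamma>'"
proof -
  obtain c d where cd: "c \<noteq> 0" "free_act q p (Poly_Mapping.single \<beta> 1) = Poly_Mapping.single \<gamma> c"
    "d \<noteq> 0" "free_act q p' (Poly_Mapping.single \<gamma> 1) = Poly_Mapping.single \<gamma>' d"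
    using assms by (auto simp: maps_to_def)
  have "free_act q (p' * p) (Poly_Mapping.single \<beta> 1) = free_act q p' (scal c (Poly_Mapping.single \<gamma> 1))"
    by (simp add: free_act_mult cd)
  also have "\<dots> = Poly_Mapping.single \<gamma>' (c * d)"
    unfolding free_act_scal_right cd by simp
  finally show ?thesis
    using cd unfolding maps_to_def by (intro exI[of _ "c * d"]) simp
qed

lemma maps_to_multE:
  assumes "shift_op p \<delta>" "shift_op p' \<delta>'" "maps_to (p' * p) \<beta> \<gamma>'"
  obtains \<gamma> where "maps_to p \<beta> \<gamma>" "maps_to p' \<gamma> \<gamma>'"
proof -
  have nz: "free_act q p' (free_act q p (Poly_Mapping.single \<beta> 1)) \<noteq> 0"
    using maps_to_nz[OF assms(3)] by (simp add: free_act_mult)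
  then have "free_act q p (Poly_Mapping.single \<beta> 1) \<noteq> 0" by auto
  then obtain \<gamma> where \<gamma>: "maps_to p \<beta> \<gamma>" using assms(1) shift_op_nz by blast
  then obtain c where "free_act q p (Poly_Mapping.single \<beta> 1) = scal c (Poly_Mapping.single \<gamma> 1)"
    by (auto simp: maps_to_def)
  then have "free_act q p' (Poly_Mapping.single \<gamma> 1) \<noteq> 0"
    using nz by (auto simp: free_act_scal_right simp del: scal_single)
  then obtain \<gamma>'' where "maps_to p' \<gamma> \<gamma>''" using assms(2) shift_op_nz by blast
  then show ?thesis using maps_to_mult[OF \<gamma>] maps_to_unique[OF assms(3)] \<gamma> that by blast
qed

lemma shift_op_mult:
  assumes "shift_op p \<delta>" "shift_op p' \<delta>'"
  shows "shift_op (p' * p) (\<lambda>i. \<delta> i + \<delta>' i)"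
proof -
  have "\<exists>\<gamma>. maps_to (p' * p) \<beta> \<gamma> \<and> (\<forall>i. int (\<gamma> i) = int (\<beta> i) + (\<delta> i + \<delta>' i)) \<and> (\<forall>i. \<gamma> i div l \<le> \<beta> i div l)"
    if "free_act q (p' * p) (Poly_Mapping.single \<beta> 1) \<noteq> 0" for \<beta>
  proof -
    have nz: "free_act q p' (free_act q p (Poly_Mapping.single \<beta> 1)) \<noteq> 0"
      using that by (simp add: free_act_mult)
    then have "free_act q p (Poly_Mapping.single \<beta> 1) \<noteq> 0" by auto
    then obtain \<gamma> where \<gamma>: "maps_to p \<beta> \<gamma>" using assms(1) shift_op_nz by blast
    then obtain c where "free_act q p (Poly_Mapping.single \<beta> 1) = scal c (Poly_Mapping.single \<gamma> 1)"
      by (auto simp: maps_to_def)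
    then have "free_act q p' (Poly_Mapping.single \<gamma> 1) \<noteq> 0"
      using nz by (auto simp: free_act_scal_right simp del: scal_single)
    then obtain \<gamma>' where \<gamma>': "maps_to p' \<gamma> \<gamma>'" using assms(2) shift_op_nz by blast
    show ?thesis
      using maps_to_mult[OF \<gamma> \<gamma>'] shift_opD[OF assms(1) \<gamma>] shift_opD[OF assms(2) \<gamma>']
      by (intro exI[of _ \<gamma>']) (auto simp: add.assoc intro: order_trans[OF _ shift_opD(2)[OF assms(1) \<gamma>]])
  qed
  then show ?thesis
    using assms by (auto simp: shift_op_def free_alg_closed(2))
qed

lemma maps_to_1: "maps_to 1 \<beta> \<beta>"
  by (auto simp: maps_to_def poly_mapping_single_eq_iff)

lemma shift_op_1: "shift_op 1 (\<lambda>_. 0)"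
  using maps_to_1 by (auto simp: shift_op_def)

definition adj :: "nat \<Rightarrow> nat \<Rightarrow> bool" where
  "adj a b \<longleftrightarrow> a \<in> {1..n} \<and> b \<in> {1..n} \<and> adjacent a b"

lemma adj_sym: "adj a b \<Longrightarrow> adj b a"
  by (auto simp: adj_def adjacent_def)

lemma adj_neq: "adj a b \<Longrightarrow> a \<noteq> b"
  by (auto simp: adj_def adjacent_def)

lemma ex_adj: "j \<in> {1..n} \<Longrightarrow> \<exists>i. adj i j"
  using n by (cases "j = 1") (auto simp: adj_def adjacent_def intro: exI[of _ 2] exI[of _ "j - 1"])

text \<open>For neighbouring indices, the generator that moves one unit from exponent
  \<open>b\<close> to exponent \<open>a\<close>. It treats both kinds of generators
  uniformly.\<close>

definition step :: "nat \<Rightarrow> nat \<Rightarrow> (word \<Rightarrow>\<^sub>0 'k)" where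
  "step a b = (if b = Suc a then gE a else gF b)"

lemma free_act_step:
  assumes "adj a b"
  shows "free_act q (step a b) (Poly_Mapping.single \<beta> 1) =
    (if \<beta> b = 0 then 0
     else Poly_Mapping.single (\<beta>(a := \<beta> a + 1, b := \<beta> b - 1)) (qint q (int (\<beta> a) + 1)))"
  using assms by (auto simp: step_def act_simps adj_def adjacent_def fun_upd_twist)

lemma maps_to_step_iff:
  assumes "adj a b"
  shows "maps_to (step a b) \<beta> \<gamma> \<longleftrightarrow>
    \<beta> b \<noteq> 0 \<and> \<not> l dvd \<beta> a + 1 \<and> \<gamma> = \<beta>(a := \<beta> a + 1, b := \<beta> b - 1)"
proof -
  have nz: "qint q (int (\<beta> a) + 1) = 0 \<longleftrightarrow> l dvd \<beta> a + 1"
    using qint_eq_0_iff_dvd[of "\<beta> a + 1"] by (simp add: add.commute)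
  show ?thesis
    unfolding maps_to_def free_act_step[OF assms] nz[symmetric]
    by (auto simp: poly_mapping_single_eq_iff poly_mapping_single_eq_0_iff)
qed

lemma shift_op_step:
  assumes "adj a b"
  shows "shift_op (step a b) (\<lambda>i. (if i = a then 1 else 0) - (if i = b then 1 else 0))"
  unfolding shift_op_def
proof (intro conjI allI)
  show "step a b \<in> carrier (free_alg n)"
    using assms by (auto simp: step_def adj_def adjacent_def intro!: gens_closed)
  fix \<beta>
  show "free_act q (step a b) (Poly_Mapping.single \<beta> 1) = 0 \<or>
    (\<exists>\<gamma>. maps_to (step a b) \<beta> \<gamma> \<and>
      (\<forall>i. int (\<gamma> i) = int (\<beta> i) + ((if i = a then 1 else 0) - (if i = b then 1 else 0))) \<and>
      (\<forall>i. \<gamma> i div l \<le> \<beta> i div l))"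
  proof (cases "\<beta> b \<noteq> 0 \<and> \<not> l dvd \<beta> a + 1")
    case True
    moreover from True have "Suc (\<beta> a) div l = \<beta> a div l"
      by (auto simp: div_Suc dvd_eq_mod_eq_0)
    ultimately show ?thesis
      using adj_neq[OF assms]
      by (intro disjI2 exI[of _ "\<beta>(a := \<beta> a + 1, b := \<beta> b - 1)"])
        (auto simp: maps_to_step_iff[OF assms] div_le_mono)
  next
    case False
    then show ?thesis
      using qint_eq_0_iff_dvd[of "\<beta> a + 1"] by (auto simp: free_act_step[OF assms] add.commute)
  qed
qed

subsection \<open>Connectedness of a layer\<close>

definition Box :: "nat \<Rightarrow> (nat \<Rightarrow> nat) set" where
  "Box r = {\<rho> \<in> multi_indices n. (\<forall>i. \<rho> i < l) \<and> (\<Sum>i=1..n. \<rho> i) = r}"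

text \<open>The effect of \<open>step a b\<close> on residues when no exponent crosses a multiple of
  \<open>l\<close>.\<close>

definition hop :: "(nat \<Rightarrow> nat) \<Rightarrow> (nat \<Rightarrow> nat) \<Rightarrow> bool" where
  "hop \<rho> \<rho>' \<longleftrightarrow> (\<exists>a b. adj a b \<and> \<rho> b \<noteq> 0 \<and> \<rho> a + 1 < l \<and> \<rho>' = \<rho>(a := \<rho> a + 1, b := \<rho> b - 1))"

text \<open>A hop to the right raises this by 1. Being linear, it changes under a fixed shift by an
  amount that does not depend on the starting point.\<close>

definition pot :: "(nat \<Rightarrow> nat) \<Rightarrow> nat" where
  "pot \<rho> = (\<Sum>i=1..n. i * \<rho> i)"

lemma hop_Box:
  assumes "hop \<rho> \<rho>'" "\<rho> \<in> Box r"
  shows "\<rho>' \<in> Box r"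
proof -
  obtain a b where ab: "adj a b" "\<rho> b \<noteq> 0" "\<rho> a + 1 < l" "\<rho>' = \<rho>(a := \<rho> a + 1, b := \<rho> b - 1)"
    using assms(1) by (auto simp: hop_def)
  have "a \<in> {1..n}" "b \<in> {1..n}" "a \<noteq> b" using ab(1) adj_neq[OF ab(1)] by (auto simp: adj_def)
  then have "(\<Sum>i=1..n. \<rho>' i) = (\<Sum>i=1..n. \<rho> i)"
    using sum_fun_upd2[of "{1..n}" a b "\<lambda>_. 1" \<rho> "\<rho> a + 1" "\<rho> b - 1"] ab(2)
    unfolding ab(4) by simp
  then show ?thesis
    using assms(2) ab \<open>a \<in> {1..n}\<close> \<open>b \<in> {1..n}\<close>
    by (auto simp: Box_def multi_indices_def intro: le_less_trans[OF diff_le_self])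
qed

lemma hop_sym:
  assumes "hop \<rho> \<rho>'" "\<rho> \<in> Box r"
  shows "hop \<rho>' \<rho>"
proof -
  obtain a b where ab: "adj a b" "\<rho> b \<noteq> 0" "\<rho> a + 1 < l" "\<rho>' = \<rho>(a := \<rho> a + 1, b := \<rho> b - 1)"
    using assms(1) by (auto simp: hop_def)
  have "\<rho> b < l" using assms(2) by (simp add: Box_def)
  then show ?thesis
    unfolding hop_def using ab adj_neq[OF ab(1)]
    by (intro exI[of _ b] exI[of _ a]) (auto simp: adj_sym)
qed

lemma hops_Box: "hop\<^sup>*\<^sup>* \<rho> \<rho>' \<Longrightarrow> \<rho> \<in> Box r \<Longrightarrow> \<rho>' \<in> Box r"
  by (induction rule: rtranclp_induct) (auto intro: hop_Box)

lemma hops_sym: "hop\<^sup>*\<^sup>* \<rho> \<rho>' \<Longrightarrow> \<rho> \<in> Box r \<Longrightarrow> hop\<^sup>*\<^sup>* \<rho>' \<rho>"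
proof (induction rule: rtranclp_induct)
  case (step \<sigma> \<tau>)
  then have "hop \<tau> \<sigma>" using hop_sym hops_Box by blast
  then show ?case using step by (auto intro: converse_rtranclp_into_rtranclp)
qed simp

text \<open>The residues from which no unit can hop to the right.\<close>

definition rightmost :: "(nat \<Rightarrow> nat) \<Rightarrow> bool" where
  "rightmost \<rho> \<longleftrightarrow> (\<forall>i\<in>{1..<n}. \<rho> i = 0 \<or> \<rho> (Suc i) = l - 1)"

text \<open>A rightmost residue reads 0, ..., 0, t, l - 1, ..., l - 1. At the first index where two
  of them differ, the larger one is positive and hence full everywhere to the right; it dominates
  the other one, and the sums differ.\<close>

lemma rightmost_unique:
  assumes "rightmost \<sigma>" "rightmost \<tau>" "\<sigma> \<in> Box r" "\<tau> \<in> Box r"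
  shows "\<sigma> = \<tau>"
proof -
  have False if "rightmost \<tau>" "\<sigma> \<in> Box r" "\<tau> \<in> Box r" "\<sigma> j < \<tau> j" "\<forall>i<j. \<sigma> i = \<tau> i" for \<sigma> \<tau> j
  proof -
    have j: "j \<in> {1..n}" using that by (auto simp: Box_def multi_indices_def)
    have max: "\<tau> i = l - 1" if "i > j" "i \<le> n" for i
      using that
    proof (induction i)
      case (Suc i)
      have "\<tau> i \<noteq> 0"
        using Suc l \<open>\<sigma> j < \<tau> j\<close> by (cases "i = j") auto
      have "i \<in> {1..<n}" using Suc.prems j by auto
      then have "\<tau> i = 0 \<or> \<tau> (Suc i) = l - 1"
        using \<open>rightmost \<tau>\<close> unfolding rightmost_def by (rule bspec[rotated])
      with \<open>\<tau> i \<noteq> 0\<close> show ?case by simp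
    qed simp
    have "\<sigma> i \<le> \<tau> i" if "i \<in> {1..n}" for i
    proof -
      have "\<sigma> i < l" using \<open>\<sigma> \<in> Box r\<close> by (simp add: Box_def)
      then show ?thesis
        using max[of i] that \<open>\<sigma> j < \<tau> j\<close> \<open>\<forall>i<j. \<sigma> i = \<tau> i\<close> by (cases i j rule: linorder_cases) auto
    qed
    then have "(\<Sum>i=1..n. \<sigma> i) < (\<Sum>i=1..n. \<tau> i)"
      using j that(4) by (intro sum_strict_mono_ex1) auto
    then show False using that by (simp add: Box_def)
  qed
  note * = this
  show ?thesis
  proof (rule ccontr)
    assume "\<sigma> \<noteq> \<tau>"
    then obtain i where "\<sigma> i \<noteq> \<tau> i" by blast
    then obtain j where "\<sigma> j \<noteq> \<tau> j" "\<forall>i<j. \<sigma> i = \<tau> i"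
      using exists_least_iff[of "\<lambda>j. \<sigma> j \<noteq> \<tau> j"] by blast
    then have eq: "\<forall>i<j. \<tau> i = \<sigma> i" "\<forall>i<j. \<sigma> i = \<tau> i" by simp_all
    from \<open>\<sigma> j \<noteq> \<tau> j\<close> consider "\<sigma> j < \<tau> j" | "\<tau> j < \<sigma> j" by linarith
    then show False
      by cases (rule *[OF assms(2,3,4) _ eq(2)] *[OF assms(1,4,3) _ eq(1)], assumption)+
  qed
qed

lemma pot_le: "\<rho> \<in> Box r \<Longrightarrow> pot \<rho> \<le> n * r"
  unfolding pot_def Box_def
  by (auto simp: sum_distrib_left intro!: sum_mono)

text \<open>Hops to the right raise \<open>pot\<close>, which is bounded on a layer, so they come to
  an end. The last conjunct recognises a residue of maximal potential as the rightmost one.\<close>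

lemma hops_to_rightmost:
  assumes "\<rho> \<in> Box r"
  shows "\<exists>\<tau>. hop\<^sup>*\<^sup>* \<rho> \<tau> \<and> rightmost \<tau> \<and> pot \<rho> \<le> pot \<tau> \<and> (pot \<rho> = pot \<tau> \<longrightarrow> \<rho> = \<tau>)"
  using assms
proof (induction "n * r - pot \<rho>" arbitrary: \<rho> rule: less_induct)
  case less
  show ?case
  proof (cases "rightmost \<rho>")
    case True
    then show ?thesis by blast
  next
    case False
    then obtain i where i: "i \<in> {1..<n}" "\<rho> i \<noteq> 0" "\<rho> (Suc i) \<noteq> l - 1"
      by (auto simp: rightmost_def)
    define \<rho>' where "\<rho>' = \<rho>(Suc i := \<rho> (Suc i) + 1, i := \<rho> i - 1)"
    have "adj (Suc i) i" using i by (auto simp: adj_def adjacent_def)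
    moreover have "\<rho> (Suc i) < l" using less.prems by (simp add: Box_def)
    ultimately have hop: "hop \<rho> \<rho>'"
      unfolding hop_def \<rho>'_def using i by (intro exI[of _ "Suc i"] exI[of _ i]) auto
    have "pot \<rho>' + Suc i * \<rho> (Suc i) + i * \<rho> i = pot \<rho> + Suc i * (\<rho> (Suc i) + 1) + i * (\<rho> i - 1)"
      unfolding pot_def \<rho>'_def by (rule sum_fun_upd2) (use i in auto)
    moreover have "i * \<rho> i = i * (\<rho> i - 1) + i" using i(2) by (cases "\<rho> i") auto
    ultimately have pot: "pot \<rho>' = pot \<rho> + 1" by simp
    have \<rho>': "\<rho>' \<in> Box r" by (rule hop_Box[OF hop less.prems])
    have "n * r - pot \<rho>' < n * r - pot \<rho>" using pot pot_le[OF \<rho>'] by simp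
    from less.hyps[OF this \<rho>'] obtain \<tau> where "hop\<^sup>*\<^sup>* \<rho>' \<tau>" "rightmost \<tau>" "pot \<rho>' \<le> pot \<tau>"
      by blast
    then show ?thesis
      using pot hop by (intro exI[of _ \<tau>]) (auto intro: converse_rtranclp_into_rtranclp)
  qed
qed

text \<open>Both residues hop to the same rightmost one, and hops are reversible.\<close>

lemma Box_connected:
  assumes "\<rho> \<in> Box r" "\<rho>' \<in> Box r"
  shows "hop\<^sup>*\<^sup>* \<rho> \<rho>'"
proof -
  obtain \<tau> where \<tau>: "hop\<^sup>*\<^sup>* \<rho> \<tau>" "rightmost \<tau>" using hops_to_rightmost[OF assms(1)] by blast
  obtain \<tau>' where \<tau>': "hop\<^sup>*\<^sup>* \<rho>' \<tau>'" "rightmost \<tau>'" using hops_to_rightmost[OF assms(2)] by blast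
  have "\<tau> = \<tau>'"
    using rightmost_unique \<tau> \<tau>' hops_Box assms by blast
  then show ?thesis
    using \<tau>(1) hops_sym[OF \<tau>'(1) assms(2)] by simp
qed

text \<open>If a shift has the length of the whole layer, only its lowest element survives it.\<close>

lemma Box_extremal_pair:
  assumes "\<rho> \<in> Box r"
  obtains \<omega> \<tau> where "\<omega> \<in> Box r" "\<tau> \<in> Box r"
    "\<And>\<sigma> \<sigma>'. \<sigma> \<in> Box r \<Longrightarrow> \<sigma>' \<in> Box r \<Longrightarrow> (\<And>i. int (\<sigma>' i) = int (\<sigma> i) + (int (\<tau> i) - int (\<omega> i))) \<Longrightarrow> \<sigma> = \<omega>"
proof -
  obtain \<omega> where \<omega>: "\<omega> \<in> Box r" "\<And>\<sigma>. \<sigma> \<in> Box r \<Longrightarrow> pot \<omega> \<le> pot \<sigma>"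
    using ex_has_least_nat[of "\<lambda>\<sigma>. \<sigma> \<in> Box r" \<rho> pot] assms by blast
  obtain \<tau> where \<tau>: "hop\<^sup>*\<^sup>* \<omega> \<tau>" "rightmost \<tau>" using hops_to_rightmost[OF \<omega>(1)] by blast
  have \<tau>B: "\<tau> \<in> Box r" using hops_Box \<tau>(1) \<omega>(1) by blast
  show ?thesis
  proof (rule that[OF \<omega>(1) \<tau>B])
    fix \<sigma> \<sigma>' assume \<sigma>: "\<sigma> \<in> Box r" "\<sigma>' \<in> Box r"
      and eq: "\<And>i. int (\<sigma>' i) = int (\<sigma> i) + (int (\<tau> i) - int (\<omega> i))"
    have "i * \<sigma>' i + i * \<omega> i = i * \<sigma> i + i * \<tau> i" for i
    proof -
      have "\<sigma>' i + \<omega> i = \<sigma> i + \<tau> i" using eq[of i] by linarith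
      then show ?thesis by (metis add_mult_distrib2)
    qed
    then have pot: "pot \<sigma>' + pot \<omega> = pot \<sigma> + pot \<tau>"
      unfolding pot_def sum.distrib[symmetric] by simp
    obtain \<tau>' where \<tau>': "hop\<^sup>*\<^sup>* \<sigma>' \<tau>'" "rightmost \<tau>'" "pot \<sigma>' \<le> pot \<tau>'" "pot \<sigma>' = pot \<tau>' \<longrightarrow> \<sigma>' = \<tau>'"
      using hops_to_rightmost[OF \<sigma>(2)] by blast
    have "\<tau>' = \<tau>" using rightmost_unique[OF \<tau>'(2) \<tau>(2)] hops_Box[OF \<tau>'(1) \<sigma>(2)] \<tau>B by blast
    \<comment> \<open>By linearity \<open>pot \<sigma>'\<close> exceeds \<open>pot \<tau>\<close> by
      \<open>pot \<sigma> - pot \<omega> \<ge> 0\<close>, but \<open>pot \<tau>\<close> is the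
      maximum of the layer.\<close>
    then have "\<sigma>' = \<tau>" using \<tau>'(3,4) pot \<omega>(2)[OF \<sigma>(1)] by simp
    then show "\<sigma> = \<omega>" using eq by (intro ext) (metis add_diff_cancel_left' add.commute diff_add_cancel
      of_nat_eq_iff add_left_cancel diff_eq_eq eq_diff_eq)
  qed
qed

section \<open>Residues and operators that select one of them\<close>

definition res :: "(nat \<Rightarrow> nat) \<Rightarrow> nat \<Rightarrow> nat" where
  "res \<beta> i = \<beta> i mod l"

lemma res_add:
  assumes "int (\<gamma> i) = int (\<beta> i) + (int (\<rho>' i) - int (\<rho> i))" "res \<beta> i = \<rho> i" "\<rho>' i < l"
  shows "res \<gamma> i = \<rho>' i"
proof -
  have "\<gamma> i + \<rho> i = \<beta> i + \<rho>' i" using assms(1) by linarith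
  moreover have "\<beta> i = l * (\<beta> i div l) + \<rho> i"
    using assms(2) mult_div_mod_eq[of l "\<beta> i"] by (simp add: res_def)
  ultimately have "\<gamma> i = l * (\<beta> i div l) + \<rho>' i" by linarith
  then show ?thesis using assms(3) by (simp add: res_def)
qed

lemma res_of_div_eq:
  assumes "int (\<gamma> i) = int (\<beta> i) + d" "\<gamma> i div l = \<beta> i div l"
  shows "int (res \<gamma> i) = int (res \<beta> i) + d"
proof -
  have "\<gamma> i = l * (\<gamma> i div l) + res \<gamma> i" "\<beta> i = l * (\<beta> i div l) + res \<beta> i"
    by (simp_all add: res_def)
  then have "int (\<gamma> i) = int (l * (\<beta> i div l)) + int (res \<gamma> i)"
    "int (\<beta> i) = int (l * (\<beta> i div l)) + int (res \<beta> i)"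
    unfolding assms(2) by (simp_all only: of_nat_add[symmetric])
  then show ?thesis using assms(1) by linarith
qed

text \<open>The path of hops becomes a product of \<open>step\<close>s. Since no hop leaves the box,
  the residue alone guarantees survival, so one operator serves all exponents of residue
  \<open>\<rho>\<close>, whatever their quotients.\<close>

lemma hops_shift_op:
  assumes "hop\<^sup>*\<^sup>* \<rho> \<rho>'" "\<rho> \<in> Box r"
  shows "\<exists>p. shift_op p (\<lambda>i. int (\<rho>' i) - int (\<rho> i)) \<and>
    (\<forall>\<beta>. res \<beta> = \<rho> \<longrightarrow> free_act q p (Poly_Mapping.single \<beta> 1) \<noteq> 0)"
  using assms
proof (induction rule: rtranclp_induct)
  case base
  then show ?case
    using shift_op_1 by (intro exI[of _ 1]) (auto simp: poly_mapping_single_eq_0_iff)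
next
  case (step \<sigma> \<tau>)
  then obtain p where p: "shift_op p (\<lambda>i. int (\<sigma> i) - int (\<rho> i))"
    "\<And>\<beta>. res \<beta> = \<rho> \<Longrightarrow> free_act q p (Poly_Mapping.single \<beta> 1) \<noteq> 0" by blast
  obtain a b where ab: "adj a b" "\<sigma> b \<noteq> 0" "\<sigma> a + 1 < l" "\<tau> = \<sigma>(a := \<sigma> a + 1, b := \<sigma> b - 1)"
    using step(2) by (auto simp: hop_def)
  have \<sigma>: "\<sigma> \<in> Box r" using step hops_Box by blast
  have "shift_op (local.step a b * p) (\<lambda>i. int (\<tau> i) - int (\<rho> i))"
  proof -
    have "(\<lambda>i. int (\<tau> i) - int (\<rho> i)) = (\<lambda>i. (int (\<sigma> i) - int (\<rho> i))
        + ((if i = a then 1 else 0) - (if i = b then 1 else 0)))"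
      unfolding ab(4) using ab(2) adj_neq[OF ab(1)] by (auto simp: fun_eq_iff of_nat_diff)
    then show ?thesis
      using shift_op_mult[OF p(1) shift_op_step[OF ab(1)]] by simp
  qed
  moreover have "free_act q (local.step a b * p) (Poly_Mapping.single \<beta> 1) \<noteq> 0" if \<beta>: "res \<beta> = \<rho>" for \<beta>
  proof -
    obtain \<gamma> where \<gamma>: "maps_to p \<beta> \<gamma>" using p \<beta> shift_op_nz by blast
    have res: "res \<gamma> i = \<sigma> i" for i
      by (rule res_add[where \<beta> = \<beta> and \<rho> = \<rho>])
        (use shift_opD(1)[OF p(1) \<gamma>] \<sigma> \<beta> in \<open>auto simp: Box_def\<close>)
    have "\<gamma> b \<noteq> 0" using res[of b] ab(2) by (metis res_def mod_0)
    moreover have "\<not> l dvd \<gamma> a + 1"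
      using res[of a] ab(3) by (auto simp: res_def dvd_eq_mod_eq_0 mod_Suc)
    ultimately have "maps_to (local.step a b) \<gamma> (\<gamma>(a := \<gamma> a + 1, b := \<gamma> b - 1))"
      by (simp add: maps_to_step_iff[OF ab(1)])
    then show ?thesis using maps_to_mult[OF \<gamma>] maps_to_nz by blast
  qed
  ultimately show ?case by blast
qed

text \<open>The route is \<open>\<rho>\<close>, \<open>\<omega>\<close>, \<open>\<tau>\<close>,
  \<open>\<rho>'\<close> through an extremal pair. As long as no quotient drops, the middle leg can
  be survived only from \<open>\<omega>\<close>, and the first leg, being a fixed shift, reaches
  \<open>\<omega>\<close> only from \<open>\<rho>\<close>.\<close>

lemma ex_layer_op:
  assumes "\<rho> \<in> Box r" "\<rho>' \<in> Box r"
  shows "\<exists>p. shift_op p (\<lambda>i. int (\<rho>' i) - int (\<rho> i)) \<and>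
    (\<forall>\<beta>. res \<beta> = \<rho> \<longrightarrow> free_act q p (Poly_Mapping.single \<beta> 1) \<noteq> 0) \<and>
    (\<forall>\<beta> \<gamma>. res \<beta> \<in> Box r \<longrightarrow> maps_to p \<beta> \<gamma> \<longrightarrow> (\<forall>i. \<gamma> i div l = \<beta> i div l) \<longrightarrow> res \<beta> = \<rho>)"
proof -
  obtain \<omega> \<tau> where \<omega>: "\<omega> \<in> Box r" and \<tau>: "\<tau> \<in> Box r"
    and ex: "\<And>\<sigma> \<sigma>'. \<sigma> \<in> Box r \<Longrightarrow> \<sigma>' \<in> Box r \<Longrightarrow> (\<And>i. int (\<sigma>' i) = int (\<sigma> i) + (int (\<tau> i) - int (\<omega> i))) \<Longrightarrow> \<sigma> = \<omega>"
    using Box_extremal_pair[OF assms(1)] by metis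
  obtain p1 where p1: "shift_op p1 (\<lambda>i. int (\<omega> i) - int (\<rho> i))"
    "\<And>\<beta>. res \<beta> = \<rho> \<Longrightarrow> free_act q p1 (Poly_Mapping.single \<beta> 1) \<noteq> 0"
    using hops_shift_op[OF Box_connected[OF assms(1) \<omega>] assms(1)] by blast
  obtain p2 where p2: "shift_op p2 (\<lambda>i. int (\<tau> i) - int (\<omega> i))"
    "\<And>\<beta>. res \<beta> = \<omega> \<Longrightarrow> free_act q p2 (Poly_Mapping.single \<beta> 1) \<noteq> 0"
    using hops_shift_op[OF Box_connected[OF \<omega> \<tau>] \<omega>] by blast
  obtain p3 where p3: "shift_op p3 (\<lambda>i. int (\<rho>' i) - int (\<tau> i))"
    "\<And>\<beta>. res \<beta> = \<tau> \<Longrightarrow> free_act q p3 (Poly_Mapping.single \<beta> 1) \<noteq> 0"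
    using hops_shift_op[OF Box_connected[OF \<tau> assms(2)] \<tau>] by blast
  note p21 = shift_op_mult[OF p1(1) p2(1)]
  note p321 = shift_op_mult[OF p21 p3(1)]
  show ?thesis
  proof (rule exI[of _ "p3 * (p2 * p1)"], intro conjI allI impI)
    show "shift_op (p3 * (p2 * p1)) (\<lambda>i. int (\<rho>' i) - int (\<rho> i))"
      using p321 by (simp add: algebra_simps)
  next
    fix \<beta> assume \<beta>: "res \<beta> = \<rho>"
    obtain \<gamma>1 where \<gamma>1: "maps_to p1 \<beta> \<gamma>1" using p1 \<beta> shift_op_nz by blast
    have "res \<gamma>1 i = \<omega> i" for i
      by (rule res_add[where \<beta> = \<beta> and \<rho> = \<rho>])
        (use shift_opD(1)[OF p1(1) \<gamma>1] \<omega> \<beta> in \<open>auto simp: Box_def\<close>)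
    then have r1: "res \<gamma>1 = \<omega>" by blast
    then obtain \<gamma>2 where \<gamma>2: "maps_to p2 \<gamma>1 \<gamma>2" using p2 shift_op_nz by blast
    have "res \<gamma>2 i = \<tau> i" for i
      by (rule res_add[where \<beta> = \<gamma>1 and \<rho> = \<omega>])
        (use shift_opD(1)[OF p2(1) \<gamma>2] \<tau> r1 in \<open>auto simp: Box_def\<close>)
    then have "res \<gamma>2 = \<tau>" by blast
    then obtain \<gamma>3 where \<gamma>3: "maps_to p3 \<gamma>2 \<gamma>3" using p3 shift_op_nz by blast
    show "free_act q (p3 * (p2 * p1)) (Poly_Mapping.single \<beta> 1) \<noteq> 0"
      using maps_to_nz maps_to_mult \<gamma>1 \<gamma>2 \<gamma>3 by blast
  next
    fix \<beta> \<gamma> assume \<beta>: "res \<beta> \<in> Box r" and m: "maps_to (p3 * (p2 * p1)) \<beta> \<gamma>"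
      and eq: "\<forall>i. \<gamma> i div l = \<beta> i div l"
    obtain \<gamma>2 where \<gamma>2: "maps_to (p2 * p1) \<beta> \<gamma>2" "maps_to p3 \<gamma>2 \<gamma>"
      using maps_to_multE[OF p21 p3(1) m] by blast
    obtain \<gamma>1 where \<gamma>1: "maps_to p1 \<beta> \<gamma>1" "maps_to p2 \<gamma>1 \<gamma>2"
      using maps_to_multE[OF p1(1) p2(1) \<gamma>2(1)] by blast
    note d1 = shift_opD[OF p1(1) \<gamma>1(1)] and d2 = shift_opD[OF p2(1) \<gamma>1(2)] and d3 = shift_opD[OF p3(1) \<gamma>2(2)]
    \<comment> \<open>Quotients never increase along the way and agree at both ends, so they are
      constant.\<close>
    have div: "\<gamma>1 i div l = \<beta> i div l" "\<gamma>2 i div l = \<gamma>1 i div l" for i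
      using d1(2)[of i] d2(2)[of i] d3(2)[of i] eq[rule_format, of i] by auto
    have r1: "int (res \<gamma>1 i) = int (res \<beta> i) + (int (\<omega> i) - int (\<rho> i))" for i
      using d1(1) div(1) by (rule res_of_div_eq)
    have r2: "int (res \<gamma>2 i) = int (res \<gamma>1 i) + (int (\<tau> i) - int (\<omega> i))" for i
      using d2(1) div(2) by (rule res_of_div_eq)
    \<comment> \<open>A shift between two residues of sum \<open>r\<close> preserves the residue
      sum.\<close>
    have Box: "res \<gamma>' \<in> Box r"
      if "res \<beta>' \<in> Box r" "\<sigma> \<in> Box r" "\<sigma>' \<in> Box r" "\<And>i. int (res \<gamma>' i) = int (res \<beta>' i) + (int (\<sigma>' i) - int (\<sigma> i))"
      for \<beta>' \<gamma>' \<sigma> \<sigma>'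
    proof -
      have "res \<gamma>' i + \<sigma> i = res \<beta>' i + \<sigma>' i" for i using that(4)[of i] by linarith
      then have "(\<Sum>i=1..n. res \<gamma>' i) + (\<Sum>i=1..n. \<sigma> i) = (\<Sum>i=1..n. res \<beta>' i) + (\<Sum>i=1..n. \<sigma>' i)"
        unfolding sum.distrib[symmetric] by simp
      moreover have "res \<gamma>' i = 0" if "i \<notin> {1..n}" for i
        using that \<open>\<And>i. res \<gamma>' i + \<sigma> i = res \<beta>' i + \<sigma>' i\<close>[of i] \<open>res \<beta>' \<in> Box r\<close> \<open>\<sigma>' \<in> Box r\<close>
        by (auto simp: Box_def multi_indices_def)
      moreover have "res \<gamma>' i < l" for i using l_pos by (simp add: res_def)
      ultimately show ?thesis using that(1-3) by (simp add: Box_def multi_indices_def)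
    qed
    have B1: "res \<gamma>1 \<in> Box r" by (rule Box[OF \<beta> assms(1) \<omega> r1])
    have B2: "res \<gamma>2 \<in> Box r" by (rule Box[OF B1 \<omega> \<tau> r2])
    have "res \<gamma>1 = \<omega>" by (rule ex[OF B1 B2 r2])
    then show "res \<beta> = \<rho>" using r1 by (auto simp: fun_eq_iff)
  qed
qed

end

section \<open>The filtration by energy\<close>

locale homogeneous_component = divided_powers q n l
  for q :: "'k::field" and n l :: nat +
  fixes s :: nat
begin

definition basis :: "(nat \<Rightarrow> nat) set" where
  "basis = {\<alpha> \<in> multi_indices n. (\<Sum>i=1..n. \<alpha> i) = s}"

definition en :: "(nat \<Rightarrow> nat) \<Rightarrow> nat" where
  "en \<beta> = (\<Sum>i=1..n. \<beta> i div l)"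

definition spn :: "((nat \<Rightarrow> nat) \<Rightarrow> bool) \<Rightarrow> ((nat \<Rightarrow> nat) \<Rightarrow>\<^sub>0 'k) set" where
  "spn P = {v. \<forall>\<beta>\<in>Poly_Mapping.keys v. \<beta> \<in> basis \<and> P \<beta>}"

abbreviation D :: "nat \<Rightarrow> ((nat \<Rightarrow> nat) \<Rightarrow>\<^sub>0 'k) set" where
  "D K \<equiv> spn (\<lambda>\<beta>. en \<beta> < K)"

abbreviation X :: "(nat \<Rightarrow> nat) \<Rightarrow> ((nat \<Rightarrow> nat) \<Rightarrow>\<^sub>0 'k)" where
  "X \<beta> \<equiv> Poly_Mapping.single \<beta> 1"

abbreviation U where "U \<equiv> small_uq n q l"
abbreviation V :: "((nat \<Rightarrow> nat) \<Rightarrow>\<^sub>0 'k) set" where "V \<equiv> Aq_homogeneous n s"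
abbreviation M where "M \<equiv> (Aq n q)\<lparr>carrier := V\<rparr>"

lemma V_eq: "V = spn (\<lambda>_. True)"
  by (auto simp: Aq_homogeneous_def spn_def basis_def)

lemma basis_multi: "\<beta> \<in> basis \<Longrightarrow> \<beta> \<in> multi_indices n"
  by (simp add: basis_def)

lemma sum_res_en:
  assumes "\<beta> \<in> basis"
  shows "(\<Sum>i=1..n. res \<beta> i) + l * en \<beta> = s"
proof -
  have "(\<Sum>i=1..n. res \<beta> i) + l * en \<beta> = (\<Sum>i=1..n. \<beta> i mod l + l * (\<beta> i div l))"
    by (simp only: res_def en_def sum_distrib_left sum.distrib)
  also have "\<dots> = (\<Sum>i=1..n. \<beta> i)" by (simp only: mod_mult_div_eq)
  finally show ?thesis using assms by (simp add: basis_def)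
qed

text \<open>In fixed degree \<open>s\<close> the energy and the residue sum determine each
  other.\<close>

lemma res_Box_iff:
  assumes "\<beta> \<in> basis" "s = r + l * K"
  shows "res \<beta> \<in> Box r \<longleftrightarrow> en \<beta> = K"
proof -
  have "res \<beta> \<in> Box r \<longleftrightarrow> (\<Sum>i=1..n. res \<beta> i) = r"
    using assms(1) l_pos by (auto simp: Box_def basis_def multi_indices_def res_def)
  also have "\<dots> \<longleftrightarrow> l * en \<beta> = l * K"
    using sum_res_en[OF assms(1)] assms(2) by linarith
  finally show ?thesis using l_pos by simp
qed

lemma Box_sum_le: "\<rho> \<in> Box r \<Longrightarrow> r \<le> n * (l - 1)"
proof -
  assume "\<rho> \<in> Box r"
  then have "r = (\<Sum>i=1..n. \<rho> i)" and lt: "\<And>i. \<rho> i < l" by (auto simp: Box_def)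
  have "\<rho> i \<le> l - 1" for i using lt[of i] by linarith
  then show "r \<le> n * (l - 1)"
    using sum_mono[of "{1..n}" \<rho> "\<lambda>_. l - 1"] \<open>r = _\<close> by simp
qed

lemma Box_nonempty:
  assumes "r \<le> n * (l - 1)"
  obtains \<rho> where "\<rho> \<in> Box r"
proof -
  obtain \<rho> where \<rho>: "\<forall>i\<in>{1..n}. \<rho> i \<le> l - 1" "\<forall>i. i \<notin> {1..n} \<longrightarrow> \<rho> i = 0" "(\<Sum>i=1..n. \<rho> i) = r"
    using ex_bounded_sum_eq[of "{1..n}" r "\<lambda>_. l - 1"] assms by auto
  have "\<rho> i < l" for i
    using \<rho>(1,2) l_pos by (cases "i \<in> {1..n}") (auto simp: less_eq_Suc_le dest!: bspec)
  then have "\<rho> \<in> Box r" using \<rho> by (simp add: Box_def multi_indices_def)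
  then show ?thesis by (rule that)
qed

lemma layer_bounds:
  assumes "\<beta> \<in> basis"
  shows "l * en \<beta> \<le> s" "s \<le> l * en \<beta> + n * (l - 1)"
proof -
  show "l * en \<beta> \<le> s" using sum_res_en[OF assms] by simp
  then have "s = (s - l * en \<beta>) + l * en \<beta>" by simp
  then have "res \<beta> \<in> Box (s - l * en \<beta>)" using res_Box_iff[OF assms] by blast
  then show "s \<le> l * en \<beta> + n * (l - 1)" using Box_sum_le by fastforce
qed

definition compose :: "(nat \<Rightarrow> nat) \<Rightarrow> (nat \<Rightarrow> nat) \<Rightarrow> nat \<Rightarrow> nat" where
  "compose \<rho> m i = \<rho> i + l * m i"

lemma compose_simps:
  assumes "\<rho> \<in> Box r"
  shows "res (compose \<rho> m) = \<rho>" "compose \<rho> m i div l = m i"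
  using assms l_pos by (auto simp: compose_def res_def Box_def fun_eq_iff)

lemma compose_basis:
  assumes "\<rho> \<in> Box r" "m \<in> multi_indices n" "s = r + l * (\<Sum>i=1..n. m i)"
  shows "compose \<rho> m \<in> basis" "en (compose \<rho> m) = (\<Sum>i=1..n. m i)"
proof -
  have "(\<Sum>i=1..n. compose \<rho> m i) = s"
    using assms(1,3) by (simp add: compose_def sum.distrib sum_distrib_left Box_def)
  moreover have "compose \<rho> m \<in> multi_indices n"
    using assms(1,2) by (simp add: multi_indices_def compose_def Box_def)
  ultimately show "compose \<rho> m \<in> basis" by (simp add: basis_def)
  show "en (compose \<rho> m) = (\<Sum>i=1..n. m i)"
    by (simp add: en_def compose_simps(2)[OF assms(1)])
qed

lemma eq_iff_res_div: "\<beta> = \<gamma> \<longleftrightarrow> res \<beta> = res \<gamma> \<and> (\<forall>i. \<beta> i div l = \<gamma> i div l)"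
  by (auto simp: res_def fun_eq_iff) (metis div_mult_mod_eq)

lemma en_mono:
  assumes "\<And>i. \<gamma> i div l \<le> \<beta> i div l"
  shows "en \<gamma> \<le> en \<beta>"
  unfolding en_def by (intro sum_mono assms)

text \<open>A word that does not lower the energy changes no quotient at all, because no single
  quotient can grow to compensate for another.\<close>

lemma en_eqD:
  assumes le: "\<And>i. \<gamma> i div l \<le> \<beta> i div l" and "en \<beta> \<le> en \<gamma>" "\<beta> \<in> multi_indices n"
  shows "\<gamma> i div l = \<beta> i div l"
proof (rule ccontr)
  assume "\<gamma> i div l \<noteq> \<beta> i div l"
  then have "\<gamma> i div l < \<beta> i div l" using le[of i] by simp
  then have "i \<in> {1..n}" using assms(3) by (cases "i \<in> {1..n}") (auto simp: multi_indices_def)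
  then have "en \<gamma> < en \<beta>"
    unfolding en_def using le \<open>\<gamma> i div l < \<beta> i div l\<close> by (intro sum_strict_mono_ex1) auto
  then show False using assms(2) by simp
qed

lemma maps_to_basis:
  assumes "shift_op p \<delta>" "maps_to p \<beta> \<gamma>" "\<beta> \<in> basis"
  shows "\<gamma> \<in> basis"
proof -
  obtain c where c: "c \<noteq> 0" "free_act q p (X \<beta>) = Poly_Mapping.single \<gamma> c"
    using assms(2) by (auto simp: maps_to_def)
  have "Poly_Mapping.keys (free_act q p (X \<beta>)) \<subseteq> basis"
    using assms(1,3) unfolding basis_def
    by (intro keys_free_act[where n = n] keys_gen_basis_homogeneous) (auto simp: shift_op_def)
  then show ?thesis using c by simp
qed

lemma maps_to_en:
  assumes "shift_op p \<delta>" "maps_to p \<beta> \<gamma>"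
  shows "en \<gamma> \<le> en \<beta>"
  by (rule en_mono) (rule shift_opD(2)[OF assms])

lemma maps_to_layer:
  assumes "shift_op p \<delta>" "maps_to p \<beta> \<gamma>" "\<beta> \<in> basis" "en \<beta> \<le> en \<gamma>"
  shows "\<gamma> i div l = \<beta> i div l"
  by (rule en_eqD[OF shift_opD(2)[OF assms(1,2)] assms(4) basis_multi[OF assms(3)]])

text \<open>The starting point of a carrying step: exponent \<open>j\<close> sits at a multiple of
  \<open>l\<close>, so that taking a unit from it borrows, and exponent \<open>i\<close> has room
  for that unit. The capacities left add up to \<open>n * (l - 1) - l\<close>.\<close>

lemma ex_Box_gap:
  assumes j: "j \<in> {1..n}" "i \<in> {1..n}" "i \<noteq> j" and r: "r + l \<le> n * (l - 1)"
  obtains \<rho> where "\<rho> \<in> Box r" "\<rho> j = 0" "\<rho> i \<le> l - 2"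
proof -
  define c where "c k = (if k = j then 0 else if k = i then l - 2 else l - 1)" for k
  have "(\<Sum>k=1..n. c k + (if k = j then l - 1 else 0) + (if k = i then 1 else 0)) = (\<Sum>k=1..n. l - 1)"
    using j l by (intro sum.cong) (auto simp: c_def)
  then have "(\<Sum>k=1..n. c k) + (l - 1) + 1 = n * (l - 1)"
    using j by (simp add: sum.distrib sum.delta)
  then have "r \<le> (\<Sum>k=1..n. c k)" using r l by linarith
  then obtain \<rho> where \<rho>: "\<forall>k\<in>{1..n}. \<rho> k \<le> c k" "\<forall>k. k \<notin> {1..n} \<longrightarrow> \<rho> k = 0" "(\<Sum>k=1..n. \<rho> k) = r"
    using ex_bounded_sum_eq[of "{1..n}" r c] by auto
  have "c k < l" for k using l by (auto simp: c_def)
  then have "\<rho> k < l" for k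
    using \<rho>(1,2) l_pos by (metis le_less_trans)
  moreover have "\<rho> j = 0" "\<rho> i \<le> l - 2"
    using bspec[OF \<rho>(1) j(1)] bspec[OF \<rho>(1) j(2)] j(3) by (simp_all add: c_def)
  ultimately show ?thesis using \<rho> by (intro that) (simp_all add: Box_def multi_indices_def)
qed

text \<open>A word alone may also act on other residues, and within the lower layer; the operators of
  \<open>ex_layer_op\<close> before and after the carrying step exclude this.\<close>

lemma ex_lowering_op:
  assumes j: "j \<in> {1..n}" and s: "s = r + l * Suc K" and r: "r + l \<le> n * (l - 1)"
    and \<rho>: "\<rho> \<in> Box r" and \<sigma>: "\<sigma> \<in> Box (r + l)"
  shows "\<exists>p. shift_op p (\<lambda>i. int (\<sigma> i) - int (\<rho> i) - (if i = j then int l else 0)) \<and>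
    (\<forall>\<beta>. res \<beta> = \<rho> \<longrightarrow> l \<le> \<beta> j \<longrightarrow> free_act q p (X \<beta>) \<noteq> 0) \<and>
    (\<forall>\<beta> \<gamma>. \<beta> \<in> basis \<longrightarrow> en \<beta> \<le> Suc K \<longrightarrow> maps_to p \<beta> \<gamma> \<longrightarrow> K \<le> en \<gamma> \<longrightarrow> res \<beta> = \<rho>)"
proof -
  obtain i where ij: "adj i j" using ex_adj[OF j] by blast
  have i: "i \<in> {1..n}" "i \<noteq> j" using ij adj_neq[OF ij] by (auto simp: adj_def)
  obtain \<rho>' where \<rho>': "\<rho>' \<in> Box r" "\<rho>' j = 0" "\<rho>' i \<le> l - 2"
    using ex_Box_gap[OF j i r] .
  \<comment> \<open>The residue after the carrying step: exponent \<open>j\<close> wraps from 0 to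
    \<open>l - 1\<close>, exponent \<open>i\<close> gains 1, so the residue sum grows by
    \<open>l\<close> in total.\<close>
  define \<sigma>' where "\<sigma>' = \<rho>'(i := \<rho>' i + 1, j := l - 1)"
  have "(\<Sum>k=1..n. 1 * \<sigma>' k) + 1 * \<rho>' i + 1 * \<rho>' j = (\<Sum>k=1..n. 1 * \<rho>' k) + 1 * (\<rho>' i + 1) + 1 * (l - 1)"
    unfolding \<sigma>'_def by (rule sum_fun_upd2) (use i j in auto)
  then have "(\<Sum>k=1..n. \<sigma>' k) = r + l" using \<rho>' l by (simp add: Box_def)
  then have \<sigma>': "\<sigma>' \<in> Box (r + l)"
    using \<rho>' i j l by (auto simp: Box_def multi_indices_def \<sigma>'_def)
  obtain p1 where p1: "shift_op p1 (\<lambda>i. int (\<rho>' i) - int (\<rho> i))"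
    "\<And>\<beta>. res \<beta> = \<rho> \<Longrightarrow> free_act q p1 (X \<beta>) \<noteq> 0"
    "\<And>\<beta> \<gamma>. res \<beta> \<in> Box r \<Longrightarrow> maps_to p1 \<beta> \<gamma> \<Longrightarrow> (\<And>i. \<gamma> i div l = \<beta> i div l) \<Longrightarrow> res \<beta> = \<rho>"
    using ex_layer_op[OF \<rho> \<rho>'(1)] by blast
  obtain p2 where p2: "shift_op p2 (\<lambda>i. int (\<sigma> i) - int (\<sigma>' i))"
    "\<And>\<beta>. res \<beta> = \<sigma>' \<Longrightarrow> free_act q p2 (X \<beta>) \<noteq> 0"
    "\<And>\<beta> \<gamma>. res \<beta> \<in> Box (r + l) \<Longrightarrow> maps_to p2 \<beta> \<gamma> \<Longrightarrow> (\<And>i. \<gamma> i div l = \<beta> i div l) \<Longrightarrow> res \<beta> = \<sigma>'"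
    using ex_layer_op[OF \<sigma>' \<sigma>] by blast
  note st = shift_op_step[OF ij]
  note p1s = shift_op_mult[OF p1(1) st]
  note p = shift_op_mult[OF p1s p2(1)]
  show ?thesis
  proof (rule exI[of _ "p2 * (step i j * p1)"], intro conjI allI impI)
    have "(\<lambda>k. int (\<rho>' k) - int (\<rho> k) + ((if k = i then 1 else 0) - (if k = j then 1 else 0))
        + (int (\<sigma> k) - int (\<sigma>' k))) = (\<lambda>k. int (\<sigma> k) - int (\<rho> k) - (if k = j then int l else 0))"
      using i \<rho>'(2) l by (auto simp: fun_eq_iff \<sigma>'_def of_nat_diff)
    then show "shift_op (p2 * (step i j * p1)) (\<lambda>k. int (\<sigma> k) - int (\<rho> k) - (if k = j then int l else 0))"
      using p by simp
  next
    fix \<beta> assume \<beta>: "res \<beta> = \<rho>" "l \<le> \<beta> j"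
    obtain \<gamma>1 where \<gamma>1: "maps_to p1 \<beta> \<gamma>1" using p1 \<beta> shift_op_nz by blast
    have r1: "res \<gamma>1 k = \<rho>' k" for k
      by (rule res_add[where \<beta> = \<beta> and \<rho> = \<rho>])
        (use shift_opD(1)[OF p1(1) \<gamma>1] \<rho>' \<beta> in \<open>auto simp: Box_def\<close>)
    have "int (\<gamma>1 j) = int (\<beta> j) - int (res \<beta> j)"
      using shift_opD(1)[OF p1(1) \<gamma>1, of j] \<rho>'(2) \<beta>(1) by simp
    then have \<gamma>1j: "\<gamma>1 j = l * (\<beta> j div l)"
      using mult_div_mod_eq[of l "\<beta> j"] unfolding res_def by linarith
    have div: "\<beta> j div l \<noteq> 0" using \<beta>(2) l_pos by (simp add: div_eq_0_iff)
    have "\<not> l dvd \<gamma>1 i + 1"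
      using r1[of i] \<rho>'(3) l by (auto simp: res_def dvd_eq_mod_eq_0 mod_Suc)
    then have \<gamma>2: "maps_to (step i j) \<gamma>1 (\<gamma>1(i := \<gamma>1 i + 1, j := \<gamma>1 j - 1))" (is "maps_to _ _ ?\<gamma>2")
      using \<gamma>1j div l_pos by (simp add: maps_to_step_iff[OF ij])
    have "res ?\<gamma>2 k = \<sigma>' k" for k
    proof -
      have "Suc (\<gamma>1 i) mod l = Suc (\<rho>' i)"
        using r1[of i] \<rho>'(3) l by (auto simp: res_def mod_Suc)
      \<comment> \<open>The borrow: \<open>\<gamma>1 j\<close> is a positive multiple of
        \<open>l\<close>.\<close>
      moreover have "(\<gamma>1 j - 1) mod l = l - 1"
      proof -
        obtain t where "\<beta> j div l = Suc t" using div by (cases "\<beta> j div l") auto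
        then have "\<gamma>1 j - 1 = l * t + (l - 1)" using \<gamma>1j l_pos by simp
        then have "(\<gamma>1 j - 1) mod l = (l - 1) mod l" by (simp only: mod_mult_self4)
        then show ?thesis using l_pos by simp
      qed
      ultimately show ?thesis
        using r1[of k] i(2) by (auto simp: res_def \<sigma>'_def)
    qed
    then have "res ?\<gamma>2 = \<sigma>'" by blast
    then obtain \<gamma>3 where "maps_to p2 ?\<gamma>2 \<gamma>3" using p2 shift_op_nz by blast
    then show "free_act q (p2 * (step i j * p1)) (X \<beta>) \<noteq> 0"
      using maps_to_nz maps_to_mult \<gamma>1 \<gamma>2 by blast
  next
    fix \<beta> \<gamma> assume \<beta>: "\<beta> \<in> basis" "en \<beta> \<le> Suc K" and m: "maps_to (p2 * (step i j * p1)) \<beta> \<gamma>"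
      and K: "K \<le> en \<gamma>"
    obtain \<gamma>2 where \<gamma>2: "maps_to (step i j * p1) \<beta> \<gamma>2" "maps_to p2 \<gamma>2 \<gamma>"
      using maps_to_multE[OF p1s p2(1) m] by blast
    obtain \<gamma>1 where \<gamma>1: "maps_to p1 \<beta> \<gamma>1" "maps_to (step i j) \<gamma>1 \<gamma>2"
      using maps_to_multE[OF p1(1) st \<gamma>2(1)] by blast
    have B1: "\<gamma>1 \<in> basis" by (rule maps_to_basis[OF p1(1) \<gamma>1(1) \<beta>(1)])
    have B2: "\<gamma>2 \<in> basis" by (rule maps_to_basis[OF st \<gamma>1(2) B1])
    have en: "en \<gamma> \<le> en \<gamma>2" "en \<gamma>2 \<le> en \<gamma>1" "en \<gamma>1 \<le> en \<beta>"
      using maps_to_en[OF p2(1) \<gamma>2(2)] maps_to_en[OF st \<gamma>1(2)] maps_to_en[OF p1(1) \<gamma>1(1)] by auto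
    show "res \<beta> = \<rho>"
    \<comment> \<open>Either \<open>p1\<close> stays in the layer \<open>Suc K\<close> and selects
      \<open>\<rho>\<close>, or the energy is already \<open>K\<close> before \<open>p2\<close>,
      which then stays in its layer and selects \<open>\<sigma>'\<close>.\<close>
    proof (cases "en \<gamma>1 = Suc K")
      case True
      then have "en \<beta> = Suc K" using en \<beta>(2) by simp
      then show ?thesis
        using p1(3)[OF _ \<gamma>1(1)] res_Box_iff[OF \<beta>(1) s] maps_to_layer[OF p1(1) \<gamma>1(1) \<beta>(1)] True by simp
    next
      case False
      then have eq: "en \<gamma>2 = K" "en \<gamma> = K" using en \<beta>(2) K by auto
      have "s = (r + l) + l * K" using s by simp
      from res_Box_iff[OF B2 this] have res2: "res \<gamma>2 = \<sigma>'"
        using p2(3)[OF _ \<gamma>2(2)] maps_to_layer[OF p2(1) \<gamma>2(2) B2] eq by simp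
      have e1: "int (\<gamma>2 k) = int (\<beta> k) + (int (\<rho>' k) - int (\<rho> k) + ((if k = i then 1 else 0) - (if k = j then 1 else 0)))" for k
        by (rule shift_opD(1)[OF p1s \<gamma>2(1)])
      have e2: "int (\<sigma>' k) = int (\<rho>' k) + (if k = i then 1 else 0) - (if k = j then 1 else 0) + (if k = j then int l else 0)" for k
        using i \<rho>'(2) l by (auto simp: \<sigma>'_def of_nat_diff)
      \<comment> \<open>The first two factors shift by \<open>\<sigma>' - \<rho>\<close> up to
        multiples of \<open>l\<close>, so residue \<open>\<sigma>'\<close> at
        \<open>\<gamma>2\<close> is traced back to residue \<open>\<rho>\<close> at
        \<open>\<beta>\<close>.\<close>
      have "int (\<gamma>2 k) - int (res \<gamma>2 k) + (if k = j then int l else 0) = int (\<beta> k) - int (\<rho> k)" for k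
        using e1[of k] e2[of k] unfolding res2 by linarith
      moreover have "int l dvd int (\<gamma>2 k) - int (res \<gamma>2 k) + (if k = j then int l else 0)" for k
        by (intro dvd_add) (auto simp: res_def of_nat_mod minus_mod_eq_mult_div)
      ultimately have "int l dvd int (\<beta> k) - int (\<rho> k)" for k by metis
      then have "int (\<beta> k) mod int l = int (\<rho> k) mod int l" for k
        by (simp add: mod_eq_dvd_iff)
      then have "\<beta> k mod l = \<rho> k mod l" for k
        by (metis of_nat_eq_iff of_nat_mod)
      then show ?thesis using \<rho> by (auto simp: fun_eq_iff res_def Box_def)
    qed
  qed
qed

section \<open>Submodules\<close>

lemma spn_iff: "v \<in> spn P \<longleftrightarrow> (\<forall>\<beta>\<in>Poly_Mapping.keys v. \<beta> \<in> basis \<and> P \<beta>)"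
  by (simp add: spn_def)

lemma X_spn_iff: "X \<beta> \<in> spn P \<longleftrightarrow> \<beta> \<in> basis \<and> P \<beta>"
  by (simp add: spn_iff)

lemma spn_mono: "(\<And>\<beta>. \<beta> \<in> basis \<Longrightarrow> P \<beta> \<Longrightarrow> Q \<beta>) \<Longrightarrow> spn P \<subseteq> spn Q"
  by (auto simp: spn_iff)

lemma D_0: "D 0 = {0}"
  by (auto simp: spn_iff)

lemma D_mono: "K \<le> K' \<Longrightarrow> D K \<subseteq> D K'"
  by (rule spn_mono) simp

lemma spn_add: "u \<in> spn P \<Longrightarrow> v \<in> spn P \<Longrightarrow> u + v \<in> spn P"
  using Poly_Mapping.keys_add[of u v] by (auto simp: spn_iff)

section \<open>Submodules in terms of the free algebra\<close>

lemma left_module_Aq: "left_module U (Aq n q)"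
  by (rule Aq_left_module[OF q qchar l_pos])

lemma submodule_V: "submodule V U (Aq n q)"
  by (rule Aq_homogeneous_submodule[OF q qchar l_pos])

lemma left_module_M: "left_module U M"
  by (rule left_module_submodule[OF left_module_Aq submodule_V])

lemma M_simps [simp]:
  "carrier M = V" "\<zero>\<^bsub>M\<^esub> = 0" "u \<oplus>\<^bsub>M\<^esub> v = u + v" "C \<odot>\<^bsub>M\<^esub> v = small_act q C v"
  by simp_all

lemma small_act_to_small:
  "p \<in> carrier (free_alg n) \<Longrightarrow> small_act q (to_small n q l p) v = free_act q p v"
  by (rule small_act_eq[OF q(1) q_diff qint_l l_pos])

lemma scal_1_carrier: "scal c 1 \<in> carrier (free_alg n)"
  by (rule free_alg_closed(4)) simp

lemma free_act_scal_1: "free_act q (scal c 1) v = scal c v"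
  by (simp add: free_act_scal_left)

lemma scal_minus_1: "scal (- 1) v = - v"
  using scal_diff_left[of 0 1 v] by simp

text \<open>Every element of the small quantum group acts through a representative in the free
  algebra. The field acts through the constants \<open>scal c 1\<close>, which supplies closure
  under negation.\<close>

lemma submodule_iff:
  "submodule H U M \<longleftrightarrow> H \<subseteq> V \<and> 0 \<in> H \<and> (\<forall>u\<in>H. \<forall>v\<in>H. u + v \<in> H) \<and>
     (\<forall>p\<in>carrier (free_alg n). \<forall>v\<in>H. free_act q p v \<in> H)" (is "_ \<longleftrightarrow> ?R")
proof
  assume H: "submodule H U M"
  note D = submoduleD[OF left_module_M H, simplified]
  have "free_act q p v \<in> H" if "p \<in> carrier (free_alg n)" "v \<in> H" for p v
    using D(7)[of "to_small n q l p" v] that small_act_to_small[OF that(1)]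
    by (auto simp: small_uq_carrier)
  then show ?R using D(3,4,5) by blast
next
  assume R: ?R
  interpret M: left_module U M by (rule left_module_M)
  show "submodule H U M"
  proof (rule submodule.intro)
    show "subgroup H (add_monoid M)"
    proof (rule M.add.subgroupI)
      fix v assume v: "v \<in> H"
      have neg: "- v \<in> H"
        using R v scal_1_carrier[of "- 1"] free_act_scal_1[of "- 1" v] scal_minus_1[of v] by metis
      have "\<ominus>\<^bsub>M\<^esub> v = - v"
        by (rule M.minus_equality) (use v neg R in auto)
      then show "\<ominus>\<^bsub>M\<^esub> v \<in> H" using neg by simp
    qed (use R in auto)
    show "submodule_axioms H U M"
      by (rule submodule_axioms.intro) (use R in \<open>auto simp: small_uq_carrier small_act_to_small\<close>)
  qed
qed

lemma submodule_closed:
  assumes "submodule H U M"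
  shows "H \<subseteq> V" "0 \<in> H" "\<And>u v. u \<in> H \<Longrightarrow> v \<in> H \<Longrightarrow> u + v \<in> H"
    "\<And>p v. p \<in> carrier (free_alg n) \<Longrightarrow> v \<in> H \<Longrightarrow> free_act q p v \<in> H"
    "\<And>c v. v \<in> H \<Longrightarrow> scal c v \<in> H"
    "\<And>u v. u \<in> H \<Longrightarrow> v \<in> H \<Longrightarrow> u - v \<in> H"
proof -
  note H = assms[unfolded submodule_iff]
  show "H \<subseteq> V" "0 \<in> H" and add: "\<And>u v. u \<in> H \<Longrightarrow> v \<in> H \<Longrightarrow> u + v \<in> H"
    and act: "\<And>p v. p \<in> carrier (free_alg n) \<Longrightarrow> v \<in> H \<Longrightarrow> free_act q p v \<in> H"
    using H by blast+
  show scal: "\<And>c v. v \<in> H \<Longrightarrow> scal c v \<in> H"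
    using act[OF scal_1_carrier] by (simp add: free_act_scal_1)
  show "u - v \<in> H" if "u \<in> H" "v \<in> H" for u v
    using add[OF that(1) scal[OF that(2), of "- 1"]] by (simp add: scal_minus_1)
qed

lemma sum_closed:
  assumes "submodule H U M" "\<And>a. a \<in> A \<Longrightarrow> f a \<in> H"
  shows "(\<Sum>a\<in>A. f a) \<in> H"
  using assms(2) by (induction A rule: infinite_finite_induct) (auto intro: submodule_closed[OF assms(1)])

lemma pm_expand: "v = (\<Sum>\<beta>\<in>Poly_Mapping.keys v. scal (Poly_Mapping.lookup v \<beta>) (X \<beta>))"
  by (rule poly_mapping_eqI) (simp add: lookup_sum lookup_single when_def in_keys_iff)

lemma mem_submoduleI:
  assumes "submodule H U M" "\<And>\<beta>. \<beta> \<in> Poly_Mapping.keys v \<Longrightarrow> X \<beta> \<in> H"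
  shows "v \<in> H"
  by (subst pm_expand) (intro sum_closed[OF assms(1)] submodule_closed(5)[OF assms(1)] assms(2))

lemma spn_subset:
  assumes "submodule H U M" "\<And>\<beta>. \<beta> \<in> basis \<Longrightarrow> P \<beta> \<Longrightarrow> X \<beta> \<in> H"
  shows "spn P \<subseteq> H"
  using mem_submoduleI[OF assms(1)] assms(2) by (auto simp: spn_iff)

lemma gen_basis_div_le:
  assumes "gen_index g \<in> {1..<n}" "\<gamma> \<in> Poly_Mapping.keys (gen_basis q g \<beta>)"
  shows "\<gamma> i div l \<le> \<beta> i div l"
proof -
  have step: "\<gamma> i div l \<le> \<beta> i div l"
    if ab: "adj a b" and \<gamma>: "\<gamma> \<in> Poly_Mapping.keys (free_act q (step a b) (X \<beta>))" for a b
  proof -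
    have "free_act q (step a b) (X \<beta>) \<noteq> 0" using \<gamma> by auto
    then obtain \<gamma>' where \<gamma>': "maps_to (step a b) \<beta> \<gamma>'"
      using shift_op_nz[OF shift_op_step[OF ab]] by blast
    then have "\<gamma>' = \<gamma>" using \<gamma> by (auto simp: maps_to_def split: if_splits)
    then show ?thesis using shift_opD(2)[OF shift_op_step[OF ab] \<gamma>'] by simp
  qed
  show ?thesis
  proof (cases g)
    case (GenE j)
    have "adj j (Suc j)" using assms(1) GenE by (auto simp: adj_def adjacent_def)
    moreover have "free_act q (step j (Suc j)) (X \<beta>) = gen_basis q g \<beta>"
      unfolding GenE step_def by (simp only: if_True refl free_act_gens gen_act_single scal_1)
    ultimately show ?thesis using step assms(2) by metis
  next
    case (GenF j)
    have "adj (Suc j) j" using assms(1) GenF by (auto simp: adj_def adjacent_def)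
    moreover have "free_act q (step (Suc j) j) (X \<beta>) = gen_basis q g \<beta>"
      unfolding GenF step_def by (simp add: free_act_gens gen_act_single del: gen_basis.simps)
    ultimately show ?thesis using step assms(2) by metis
  qed (use assms(2) in \<open>auto split: if_splits\<close>)
qed

text \<open>No generator raises a quotient, so conditions inherited by exponents with smaller
  quotients cut out submodules.\<close>

lemma submodule_spn:
  assumes "\<And>\<beta> \<gamma>. \<beta> \<in> basis \<Longrightarrow> P \<beta> \<Longrightarrow> \<gamma> \<in> basis \<Longrightarrow> (\<And>i. \<gamma> i div l \<le> \<beta> i div l) \<Longrightarrow> P \<gamma>"
  shows "submodule (spn P) U M"
  unfolding submodule_iff
proof (intro conjI ballI)
  show "spn P \<subseteq> V" unfolding V_eq by (rule spn_mono) simp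
  show "0 \<in> spn P" by (simp add: spn_iff)
  show "u + v \<in> spn P" if "u \<in> spn P" "v \<in> spn P" for u v using that by (rule spn_add)
  fix p :: "word \<Rightarrow>\<^sub>0 'k" and v
  assume p: "p \<in> carrier (free_alg n)" and v: "v \<in> spn P"
  have "Poly_Mapping.keys (free_act q p v) \<subseteq> {\<beta> \<in> basis. P \<beta>}"
  proof (rule keys_free_act[OF _ p])
    fix g \<beta> assume g: "gen_index g \<in> {1..<n}" and \<beta>: "\<beta> \<in> {\<beta> \<in> basis. P \<beta>}"
    show "Poly_Mapping.keys (gen_basis q g \<beta>) \<subseteq> {\<beta> \<in> basis. P \<beta>}"
    proof
      fix \<gamma> assume \<gamma>: "\<gamma> \<in> Poly_Mapping.keys (gen_basis q g \<beta>)"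
      then have "\<gamma> \<in> basis"
        using keys_gen_basis_homogeneous[OF g, of \<beta> s q] \<beta> by (auto simp: basis_def)
      then show "\<gamma> \<in> {\<beta> \<in> basis. P \<beta>}"
        using assms[of \<beta> \<gamma>] gen_basis_div_le[OF g \<gamma>] \<beta> by simp
    qed
  qed (use v in \<open>auto simp: spn_iff\<close>)
  then show "free_act q p v \<in> spn P" by (auto simp: spn_iff)
qed

lemma submodule_D: "submodule (D K) U M"
  by (rule submodule_spn) (metis en_mono le_less_trans)

lemma submodule_sum:
  assumes "submodule H U M" "submodule L U M"
  shows "submodule {u + v |u v. u \<in> H \<and> v \<in> L} U M"
  unfolding submodule_iff
proof (intro conjI ballI)
  note H = submodule_closed[OF assms(1)] and L = submodule_closed[OF assms(2)]
  have "submodule V U M" using submodule_spn[of "\<lambda>_. True"] by (simp add: V_eq)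
  then show "{u + v |u v. u \<in> H \<and> v \<in> L} \<subseteq> V" using H(1) L(1) submodule_closed(3) by blast
  show "0 \<in> {u + v |u v. u \<in> H \<and> v \<in> L}" using H(2) L(2) by force
  fix x assume "x \<in> {u + v |u v. u \<in> H \<and> v \<in> L}"
  then obtain a b where x: "x = a + b" "a \<in> H" "b \<in> L" by blast
  show "free_act q p x \<in> {u + v |u v. u \<in> H \<and> v \<in> L}" if "p \<in> carrier (free_alg n)" for p
    using H(4)[OF that x(2)] L(4)[OF that x(3)] by (auto simp: x(1) free_act_add_right)
  fix y assume "y \<in> {u + v |u v. u \<in> H \<and> v \<in> L}"
  then obtain c d where y: "y = c + d" "c \<in> H" "d \<in> L" by blast
  have "x + y = (a + c) + (b + d)" by (simp add: x y)
  then show "x + y \<in> {u + v |u v. u \<in> H \<and> v \<in> L}" using H(3) L(3) x y by blast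
qed

lemma submodule_Int:
  assumes "submodule H U M" "submodule L U M"
  shows "submodule (H \<inter> L) U M"
  using assms by (auto simp: submodule_iff)

section \<open>Coefficients of vectors under shift operators\<close>

lemma free_act_expand:
  "free_act q p v = lin_ext (\<lambda>\<beta>. free_act q p (X \<beta>)) v"
proof (induction v rule: pm_induct)
  case (single \<beta> c)
  then show ?case using free_act_scal_right[of q p c "X \<beta>"] by simp
qed (simp_all add: free_act_add_right lin_ext_add)

lemma keys_free_act_shift:
  assumes "shift_op p \<delta>" "\<gamma> \<in> Poly_Mapping.keys (free_act q p v)"
  obtains \<beta> where "\<beta> \<in> Poly_Mapping.keys v" "maps_to p \<beta> \<gamma>"
proof -
  have "Poly_Mapping.keys (free_act q p v) \<subseteq> {\<gamma>. \<exists>\<beta>\<in>Poly_Mapping.keys v. maps_to p \<beta> \<gamma>}"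
    unfolding free_act_expand[of p v]
  proof (rule keys_lin_ext)
    fix \<beta> assume \<beta>: "\<beta> \<in> Poly_Mapping.keys v"
    show "Poly_Mapping.keys (free_act q p (X \<beta>)) \<subseteq> {\<gamma>. \<exists>\<beta>\<in>Poly_Mapping.keys v. maps_to p \<beta> \<gamma>}"
    proof (cases "free_act q p (X \<beta>) = 0")
      case False
      then obtain \<gamma>' where \<gamma>': "maps_to p \<beta> \<gamma>'" using assms(1) shift_op_nz by blast
      then have "Poly_Mapping.keys (free_act q p (X \<beta>)) = {\<gamma>'}" by (auto simp: maps_to_def)
      then show ?thesis using \<gamma>' \<beta> by auto
    qed simp
  qed
  then show ?thesis using assms(2) that by blast
qed

text \<open>A fixed shift is injective on exponents: \<open>\<beta>\<close> is the only one that can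
  contribute to the coefficient at \<open>\<gamma>\<close>, so nothing cancels.\<close>

lemma lookup_free_act_shift:
  assumes "shift_op p \<delta>" "\<And>i. int (\<gamma> i) = int (\<beta> i) + \<delta> i"
  shows "Poly_Mapping.lookup (free_act q p v) \<gamma>
    = Poly_Mapping.lookup v \<beta> * Poly_Mapping.lookup (free_act q p (X \<beta>)) \<gamma>"
proof (induction v rule: pm_induct)
  case (single \<alpha> c)
  have eq: "free_act q p (Poly_Mapping.single \<alpha> c) = scal c (free_act q p (X \<alpha>))"
    using free_act_scal_right[of q p c "X \<alpha>"] by simp
  show ?case
  proof (cases "\<alpha> = \<beta>")
    case False
    have "\<gamma> \<notin> Poly_Mapping.keys (free_act q p (X \<alpha>))"
    proof
      assume "\<gamma> \<in> Poly_Mapping.keys (free_act q p (X \<alpha>))"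
      then obtain \<alpha>' where "\<alpha>' \<in> Poly_Mapping.keys (X \<alpha>)" "maps_to p \<alpha>' \<gamma>"
        by (rule keys_free_act_shift[OF assms(1)])
      then have "maps_to p \<alpha> \<gamma>" by simp
      then have "int (\<alpha> i) = int (\<beta> i)" for i
        using shift_opD(1)[OF assms(1), of \<alpha> \<gamma> i] assms(2)[of i] by linarith
      then show False using False by (auto simp: fun_eq_iff)
    qed
    then show ?thesis using False by (simp add: eq lookup_single in_keys_iff)
  next
    case True
    show ?thesis unfolding True[symmetric] by (simp add: eq)
  qed
qed (simp_all add: free_act_add_right lookup_add distrib_right)

lemma maps_to_lookup: "maps_to p \<beta> \<gamma> \<Longrightarrow> Poly_Mapping.lookup (free_act q p (X \<beta>)) \<gamma> \<noteq> 0"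
  by (auto simp: maps_to_def)

lemma maps_to_keys:
  assumes "shift_op p \<delta>" "maps_to p \<beta> \<gamma>" "\<beta> \<in> Poly_Mapping.keys v"
  shows "\<gamma> \<in> Poly_Mapping.keys (free_act q p v)"
  unfolding in_keys_iff lookup_free_act_shift[OF assms(1) shift_opD(1)[OF assms(1,2)], of v]
  using maps_to_lookup[OF assms(2)] assms(3) by (simp add: in_keys_iff)

lemma ex_layer:
  assumes "\<beta> \<in> basis"
  obtains r where "s = r + l * en \<beta>" "res \<beta> \<in> Box r"
  using sum_res_en[OF assms] res_Box_iff[OF assms, of "\<Sum>i=1..n. res \<beta> i"] by metis

text \<open>This carries the simplicity of the layer's summands. The top part of \<open>v\<close>
  lives on a single vector of quotients, so its exponents differ by residue only. Selecting the
  residue of \<open>\<beta>\<close> and shifting it to that of \<open>\<gamma>\<close> leaves a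
  nonzero multiple of \<open>X \<gamma>\<close>, up to lower energy, which \<open>H\<close>
  contains.\<close>

lemma submodule_contains_isotypic:
  assumes H: "submodule H U M" and D: "D (en \<beta>) \<subseteq> H" and v: "v \<in> H" "\<beta> \<in> Poly_Mapping.keys v"
    and top: "\<And>\<alpha>. \<alpha> \<in> Poly_Mapping.keys v \<Longrightarrow> en \<alpha> \<le> en \<beta> \<and> (en \<alpha> = en \<beta> \<longrightarrow> (\<forall>i. \<alpha> i div l = \<beta> i div l))"
    and \<gamma>: "\<gamma> \<in> basis" "\<And>i. \<gamma> i div l = \<beta> i div l"
  shows "X \<gamma> \<in> H"
proof -
  have vB: "\<alpha> \<in> basis" if "\<alpha> \<in> Poly_Mapping.keys v" for \<alpha>
    using submodule_closed(1)[OF H] v(1) that by (auto simp: V_eq spn_iff)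
  have \<beta>: "\<beta> \<in> basis" using vB v(2) .
  obtain r where r: "s = r + l * en \<beta>" "res \<beta> \<in> Box r" using ex_layer[OF \<beta>] .
  have en\<gamma>: "en \<gamma> = en \<beta>" using \<gamma>(2) by (simp add: en_def)
  then have "res \<gamma> \<in> Box r" using res_Box_iff[OF \<gamma>(1) r(1)] by simp
  then obtain p where p: "shift_op p (\<lambda>i. int (res \<gamma> i) - int (res \<beta> i))"
    "\<And>\<alpha>. res \<alpha> = res \<beta> \<Longrightarrow> free_act q p (X \<alpha>) \<noteq> 0"
    "\<And>\<alpha> \<alpha>'. res \<alpha> \<in> Box r \<Longrightarrow> maps_to p \<alpha> \<alpha>' \<Longrightarrow> (\<forall>i. \<alpha>' i div l = \<alpha> i div l) \<Longrightarrow> res \<alpha> = res \<beta>"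
    using ex_layer_op[OF r(2)] by blast
  let ?w = "free_act q p v"
  have w: "?w \<in> H" by (rule submodule_closed(4)[OF H shift_op_carrier[OF p(1)] v(1)])
  obtain \<gamma>' where \<gamma>': "maps_to p \<beta> \<gamma>'" using p shift_op_nz by blast
  have "\<gamma>' i = \<gamma> i" for i
  proof -
    have "int (\<gamma>' i) = int (\<beta> i) + (int (res \<gamma> i) - int (res \<beta> i))"
      by (rule shift_opD(1)[OF p(1) \<gamma>'])
    moreover have "\<beta> i = l * (\<beta> i div l) + res \<beta> i" "\<gamma> i = l * (\<beta> i div l) + res \<gamma> i"
      using mult_div_mod_eq[of l "\<gamma> i"] by (simp_all add: res_def \<gamma>(2))
    ultimately show ?thesis by linarith
  qed
  then have m: "maps_to p \<beta> \<gamma>" using \<gamma>' by (metis ext)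
  have "?w - scal (Poly_Mapping.lookup ?w \<gamma>) (X \<gamma>) \<in> D (en \<beta>)"
    unfolding spn_iff
  proof
    fix \<alpha>' assume "\<alpha>' \<in> Poly_Mapping.keys (?w - scal (Poly_Mapping.lookup ?w \<gamma>) (X \<gamma>))"
    then have \<alpha>': "\<alpha>' \<in> Poly_Mapping.keys ?w" "\<alpha>' \<noteq> \<gamma>"
      by (auto simp: in_keys_iff lookup_minus lookup_single when_def split: if_splits)
    then obtain \<alpha> where \<alpha>: "\<alpha> \<in> Poly_Mapping.keys v" "maps_to p \<alpha> \<alpha>'"
      using keys_free_act_shift[OF p(1)] by blast
    have B: "\<alpha> \<in> basis" using vB \<alpha>(1) .
    have "en \<alpha>' \<le> en \<alpha>" "en \<alpha> \<le> en \<beta>" using maps_to_en[OF p(1) \<alpha>(2)] top[OF \<alpha>(1)] by auto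
    moreover have "en \<alpha>' \<noteq> en \<beta>"
    proof
      assume "en \<alpha>' = en \<beta>"
      then have eq: "en \<alpha> = en \<beta>" "en \<alpha> \<le> en \<alpha>'" using calculation by auto
      then have "res \<alpha> = res \<beta>"
        using p(3)[OF _ \<alpha>(2)] maps_to_layer[OF p(1) \<alpha>(2) B] res_Box_iff[OF B r(1)] by blast
      moreover have "\<forall>i. \<alpha> i div l = \<beta> i div l" using top[OF \<alpha>(1)] eq by blast
      ultimately have "\<alpha> = \<beta>" using eq_iff_res_div by blast
      then show False using maps_to_unique[OF m] \<alpha> \<alpha>'(2) by blast
    qed
    ultimately show "\<alpha>' \<in> basis \<and> en \<alpha>' < en \<beta>"
      using maps_to_basis[OF p(1) \<alpha>(2) B] by simp
  qed
  then have "?w - (?w - scal (Poly_Mapping.lookup ?w \<gamma>) (X \<gamma>)) \<in> H"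
    using submodule_closed(6)[OF H w] D by blast
  then have "scal (Poly_Mapping.lookup ?w \<gamma>) (X \<gamma>) \<in> H" by simp
  then have "scal (inverse (Poly_Mapping.lookup ?w \<gamma>)) (scal (Poly_Mapping.lookup ?w \<gamma>) (X \<gamma>)) \<in> H"
    by (rule submodule_closed(5)[OF H])
  moreover have "Poly_Mapping.lookup ?w \<gamma> \<noteq> 0"
    using maps_to_keys[OF p(1) m v(2)] by (simp add: in_keys_iff)
  ultimately show ?thesis by simp
qed

section \<open>The radical\<close>

text \<open>Every monomial of layer \<open>k\<close> is obtained from layer \<open>k + 1\<close>, by
  an operator that lowers everything else too: on energy at most \<open>k\<close> a result of energy
  \<open>k\<close> would require residue \<open>\<rho>\<close>, hence energy \<open>k + 1\<close>.
  The exponent \<open>\<beta>0\<close> witnesses that the total degree allows the higher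
  layer.\<close>

lemma ex_lowering:
  assumes \<gamma>: "\<gamma> \<in> basis" "en \<gamma> = k" and \<beta>0: "\<beta>0 \<in> basis" "k < en \<beta>0"
  shows "\<exists>p \<beta> \<delta>. \<beta> \<in> basis \<and> en \<beta> = Suc k \<and> shift_op p \<delta> \<and> maps_to p \<beta> \<gamma> \<and>
    (\<forall>v\<in>D (Suc k). free_act q p v \<in> D k)"
proof -
  define r where "r = s - l * Suc k"
  have "l * Suc k \<le> l * en \<beta>0" using \<beta>0(2) by (intro mult_le_mono2) simp
  then have "l * Suc k \<le> s" using layer_bounds(1)[OF \<beta>0(1)] by simp
  then have s: "s = r + l * Suc k" by (simp add: r_def)
  then have s': "s = (r + l) + l * k" by simp
  have \<sigma>: "res \<gamma> \<in> Box (r + l)" using res_Box_iff[OF \<gamma>(1) s'] \<gamma>(2) by simp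
  have r: "r + l \<le> n * (l - 1)" by (rule Box_sum_le[OF \<sigma>])
  then have "r \<le> n * (l - 1)" by simp
  then obtain \<rho> where \<rho>: "\<rho> \<in> Box r" using Box_nonempty by blast
  \<comment> \<open>The source will carry one more multiple of \<open>l\<close> than
    \<open>\<gamma>\<close>; placing it at exponent 1 is an arbitrary choice.\<close>
  have j: "1 \<in> {1..n}" using n by simp
  obtain p where p: "shift_op p (\<lambda>i. int (res \<gamma> i) - int (\<rho> i) - (if i = 1 then int l else 0))"
    "\<And>\<beta>. res \<beta> = \<rho> \<Longrightarrow> l \<le> \<beta> 1 \<Longrightarrow> free_act q p (X \<beta>) \<noteq> 0"
    "\<And>\<beta> \<gamma>. \<beta> \<in> basis \<Longrightarrow> en \<beta> \<le> Suc k \<Longrightarrow> maps_to p \<beta> \<gamma> \<Longrightarrow> k \<le> en \<gamma> \<Longrightarrow> res \<beta> = \<rho>"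
    using ex_lowering_op[OF j s r \<rho> \<sigma>] by blast
  define m where "m = (\<lambda>i. \<gamma> i div l)(1 := Suc (\<gamma> 1 div l))"
  define \<beta> where "\<beta> = compose \<rho> m"
  have "(\<Sum>i=1..n. m i) = Suc k"
  proof -
    have "(\<Sum>i=1..n. m i) = (\<Sum>i=1..n. \<gamma> i div l + (if i = 1 then 1 else 0))"
      by (intro sum.cong) (auto simp: m_def)
    then show ?thesis using n \<gamma>(2) by (simp add: sum.distrib en_def)
  qed
  moreover have "m \<in> multi_indices n"
    using basis_multi[OF \<gamma>(1)] j by (auto simp: m_def multi_indices_def)
  ultimately have \<beta>: "\<beta> \<in> basis" "en \<beta> = Suc k"
    unfolding \<beta>_def using compose_basis[OF \<rho>, of m] s by auto
  have "res \<beta> = \<rho>" unfolding \<beta>_def by (rule compose_simps(1)[OF \<rho>])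
  moreover have "l \<le> \<beta> 1" by (simp add: \<beta>_def compose_def m_def)
  ultimately obtain \<gamma>' where \<gamma>': "maps_to p \<beta> \<gamma>'" using p shift_op_nz by blast
  have "\<gamma>' i = \<gamma> i" for i
  proof -
    have "int (\<gamma>' i) = int (\<beta> i) + (int (res \<gamma> i) - int (\<rho> i) - (if i = 1 then int l else 0))"
      by (rule shift_opD(1)[OF p(1) \<gamma>'])
    moreover have "int (\<gamma> i) = int (l * (\<gamma> i div l)) + int (res \<gamma> i)"
      unfolding of_nat_add[symmetric] by (simp add: res_def)
    moreover have "int (\<beta> i) = int (\<rho> i) + int (l * (\<gamma> i div l)) + (if i = 1 then int l else 0)"
      by (simp add: \<beta>_def compose_def m_def algebra_simps)
    ultimately show ?thesis by linarith
  qed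
  then have m: "maps_to p \<beta> \<gamma>" using \<gamma>' by (metis ext)
  have "free_act q p v \<in> D k" if v: "v \<in> D (Suc k)" for v
    unfolding spn_iff
  proof
    fix \<alpha>' assume "\<alpha>' \<in> Poly_Mapping.keys (free_act q p v)"
    then obtain \<alpha> where \<alpha>: "\<alpha> \<in> Poly_Mapping.keys v" "maps_to p \<alpha> \<alpha>'"
      using keys_free_act_shift[OF p(1)] by blast
    have B: "\<alpha> \<in> basis" "en \<alpha> < Suc k" using v \<alpha>(1) by (auto simp: spn_iff)
    have "\<not> k \<le> en \<alpha>'"
    proof
      assume "k \<le> en \<alpha>'"
      then have "res \<alpha> = \<rho>" using p(3)[OF B(1) _ \<alpha>(2)] B(2) by simp
      then have "en \<alpha> = Suc k" using res_Box_iff[OF B(1) s] \<rho> by simp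
      then show False using B(2) by simp
    qed
    then show "\<alpha>' \<in> basis \<and> en \<alpha>' < k" using maps_to_basis[OF p(1) \<alpha>(2) B(1)] by simp
  qed
  then show ?thesis using \<beta> p(1) m by blast
qed

text \<open>A form of Nakayama's lemma. If \<open>X \<beta> = u + v\<close> with \<open>u\<close> in
  \<open>N\<close> and \<open>v\<close> in \<open>D (Suc k)\<close>, a lowering operator turns this
  into a multiple of \<open>X \<gamma>\<close> plus nothing outside \<open>N + D k\<close>, so the
  error term sinks layer by layer.\<close>

lemma D_superfluous:
  assumes N: "submodule N U M" and le: "D (Suc K) \<subseteq> {u + v |u v. u \<in> N \<and> v \<in> D K}"
    and \<beta>0: "\<beta>0 \<in> basis" "en \<beta>0 = K"
  shows "D (Suc K) \<subseteq> N"
proof -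
  \<comment> \<open>Truncated subtraction makes the error term stop at \<open>D 0\<close>, which is
    zero.\<close>
  have "D (Suc K) \<subseteq> {u + v |u v. u \<in> N \<and> v \<in> D (K - i)}" for i
  proof (induction i)
    case (Suc i)
    show ?case
    proof (cases "K \<le> i")
      case False
      define k where "k = K - Suc i"
      have k: "K - i = Suc k" using False by (simp add: k_def)
      let ?S = "{u + v |u v. u \<in> N \<and> v \<in> D k}"
      have S: "submodule ?S U M" by (rule submodule_sum[OF N submodule_D])
      have "D (Suc k) \<subseteq> ?S"
      proof (rule spn_subset[OF S])
        fix \<gamma> assume \<gamma>: "\<gamma> \<in> basis" "en \<gamma> < Suc k"
        show "X \<gamma> \<in> ?S"
        proof (cases "en \<gamma> < k")
          case True
          then have "X \<gamma> \<in> D k" using \<gamma> by (simp add: X_spn_iff)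
          then show ?thesis using submodule_closed(2)[OF N] by force
        next
          case False
          then have "en \<gamma> = k" using \<gamma> by simp
          moreover have "k < en \<beta>0" using k \<beta>0 by simp
          ultimately obtain p \<beta> \<delta> where \<beta>: "\<beta> \<in> basis" "en \<beta> = Suc k" "shift_op p \<delta>" "maps_to p \<beta> \<gamma>"
            and p: "\<forall>v\<in>D (Suc k). free_act q p v \<in> D k"
            using ex_lowering[OF \<gamma>(1) _ \<beta>0(1)] by blast
          have "X \<beta> \<in> D (Suc K)" using \<beta>(1,2) k by (simp add: X_spn_iff)
          then obtain u v where uv: "X \<beta> = u + v" "u \<in> N" "v \<in> D (Suc k)"
            using Suc.IH unfolding k by blast
          have "free_act q p (X \<beta>) \<in> ?S"
            unfolding uv(1) free_act_add_right
            using submodule_closed(4)[OF N shift_op_carrier[OF \<beta>(3)] uv(2)] p uv(3) by blast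
          moreover obtain c where c: "c \<noteq> 0" "free_act q p (X \<beta>) = Poly_Mapping.single \<gamma> c"
            using \<beta>(4) by (auto simp: maps_to_def)
          ultimately have "scal (inverse c) (Poly_Mapping.single \<gamma> c) \<in> ?S"
            by (intro submodule_closed(5)[OF S]) (simp only:)
          moreover have "scal (inverse c) (Poly_Mapping.single \<gamma> c) = X \<gamma>" using c(1) by simp
          ultimately show ?thesis by (simp only:)
        qed
      qed
      have "{u + v |u v. u \<in> N \<and> v \<in> D (Suc k)} \<subseteq> ?S"
      proof -
        have "N \<subseteq> ?S" using submodule_closed(2)[OF submodule_D[of k]] by force
        then show ?thesis using \<open>D (Suc k) \<subseteq> ?S\<close> submodule_closed(3)[OF S] by blast
      qed
      with Suc.IH[unfolded k] have "D (Suc K) \<subseteq> ?S" by (rule subset_trans)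
      then show ?thesis by (simp only: k_def)
    next
      case True
      then show ?thesis using Suc.IH by simp
    qed
  qed (use le in simp)
  from this[of K] have "D (Suc K) \<subseteq> {u + v |u v. u \<in> N \<and> v \<in> {0}}"
    by (simp only: diff_self_eq_0 D_0)
  then show ?thesis by auto
qed

text \<open>Modulo \<open>D (en \<beta>)\<close> this is the simple summand of the layer that
  belongs to the quotients of \<open>\<beta>\<close>.\<close>

lemma submodule_isotypic:
  "submodule (spn (\<lambda>\<alpha>. en \<alpha> < en \<beta> \<or> (\<forall>i. \<alpha> i div l = \<beta> i div l))) U M" (is "submodule (spn ?P) U M")
proof (rule submodule_spn)
  fix \<alpha> \<gamma> assume \<alpha>: "\<alpha> \<in> basis" "?P \<alpha>" and le: "\<And>i. \<gamma> i div l \<le> \<alpha> i div l"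
  have en: "en \<gamma> \<le> en \<alpha>" using le by (rule en_mono)
  show "?P \<gamma>"
  proof (cases "en \<alpha> \<le> en \<gamma>")
    case True
    then have "\<gamma> i div l = \<alpha> i div l" for i by (rule en_eqD[OF le _ basis_multi[OF \<alpha>(1)]])
    then show ?thesis using \<alpha>(2) en by auto
  next
    case False
    moreover have "en \<alpha> \<le> en \<beta>" using \<alpha>(2) by (auto simp: en_def)
    ultimately show ?thesis by simp
  qed
qed

text \<open>Modulo \<open>D (en \<beta>)\<close> this is the sum of all other summands of the layer,
  hence the source of maximal submodules.\<close>

lemma submodule_coisotypic:
  "submodule (spn (\<lambda>\<alpha>. en \<alpha> < en \<beta> \<or> (en \<alpha> = en \<beta> \<and> \<not> (\<forall>i. \<alpha> i div l = \<beta> i div l)))) U M"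
    (is "submodule (spn ?P) U M")
proof (rule submodule_spn)
  fix \<alpha> \<gamma> assume \<alpha>: "\<alpha> \<in> basis" "?P \<alpha>" and le: "\<And>i. \<gamma> i div l \<le> \<alpha> i div l"
  have en: "en \<gamma> \<le> en \<alpha>" using le by (rule en_mono)
  show "?P \<gamma>"
  proof (cases "en \<alpha> \<le> en \<gamma>")
    case True
    then have "\<gamma> i div l = \<alpha> i div l" for i by (rule en_eqD[OF le _ basis_multi[OF \<alpha>(1)]])
    then show ?thesis using \<alpha>(2) en True by auto
  next
    case False
    then show ?thesis using \<alpha>(2) by auto
  qed
qed

lemma radical_layer:
  assumes \<beta>0: "\<beta>0 \<in> basis" "en \<beta>0 = K"
  shows "radical U (M\<lparr>carrier := D (Suc K)\<rparr>) = D K"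
proof
  have sub: "submodule N U (M\<lparr>carrier := D (Suc K)\<rparr>) \<longleftrightarrow> submodule N U M \<and> N \<subseteq> D (Suc K)" for N
    by (rule submodule_restrict_iff[OF left_module_M submodule_D])
  have max: "maximal_submodule N U (M\<lparr>carrier := D (Suc K)\<rparr>) \<longleftrightarrow>
      submodule N U M \<and> N \<subset> D (Suc K) \<and>
      (\<forall>L. submodule L U M \<and> N \<subseteq> L \<and> L \<subseteq> D (Suc K) \<longrightarrow> L = N \<or> L = D (Suc K))" for N
    unfolding maximal_submodule_def sub by auto
  show "radical U (M\<lparr>carrier := D (Suc K)\<rparr>) \<subseteq> D K"
  proof
    fix x assume x: "x \<in> radical U (M\<lparr>carrier := D (Suc K)\<rparr>)"
    then have xD: "x \<in> D (Suc K)" by (simp add: radical_def)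
    show "x \<in> D K"
    proof (rule ccontr)
      assume "x \<notin> D K"
      then obtain \<beta> where \<beta>: "\<beta> \<in> Poly_Mapping.keys x" "\<beta> \<in> basis" "en \<beta> = K"
        using xD by (auto simp: spn_iff less_Suc_eq)
      let ?P = "\<lambda>\<alpha>. en \<alpha> < en \<beta> \<or> (en \<alpha> = en \<beta> \<and> \<not> (\<forall>i. \<alpha> i div l = \<beta> i div l))"
      let ?N = "spn ?P"
      have N: "submodule ?N U M" by (rule submodule_coisotypic)
      have ND: "?N \<subseteq> D (Suc K)" by (rule spn_mono) (use \<beta>(3) in auto)
      have "x \<notin> ?N" using \<beta>(1) by (auto simp: spn_iff)
      have "maximal_submodule ?N U (M\<lparr>carrier := D (Suc K)\<rparr>)"
        unfolding max
      proof (intro conjI allI impI)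
        show "?N \<subset> D (Suc K)" using ND xD \<open>x \<notin> ?N\<close> by blast
        fix L assume L: "submodule L U M \<and> ?N \<subseteq> L \<and> L \<subseteq> D (Suc K)"
        show "L = ?N \<or> L = D (Suc K)"
        proof (rule disjCI)
          assume "L \<noteq> D (Suc K)"
          show "L = ?N"
          proof (rule ccontr)
            assume "L \<noteq> ?N"
            then obtain v where v: "v \<in> L" "v \<notin> ?N" using L by blast
            have vD: "v \<in> D (Suc K)" using v L by blast
            then obtain \<alpha> where \<alpha>: "\<alpha> \<in> Poly_Mapping.keys v" "\<not> ?P \<alpha>"
              using v(2) by (auto simp: spn_iff)
            have \<alpha>': "\<alpha> \<in> basis" "en \<alpha> = K" "\<forall>i. \<alpha> i div l = \<beta> i div l"
              using \<alpha> vD \<beta>(3) by (auto simp: spn_iff less_Suc_eq)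
            \<comment> \<open>Subtracting the terms that lie in \<open>?N\<close> leaves a vector of
              \<open>L\<close> supported on the quotients of \<open>\<beta>\<close> alone.\<close>
            define w where "w = (\<Sum>\<gamma>\<in>{\<gamma> \<in> Poly_Mapping.keys v. ?P \<gamma>}. scal (Poly_Mapping.lookup v \<gamma>) (X \<gamma>))"
            have "w \<in> ?N" unfolding w_def
              by (intro sum_closed[OF N] submodule_closed(5)[OF N]) (use vD in \<open>auto simp: X_spn_iff spn_iff\<close>)
            then have vw: "v - w \<in> L" using v(1) L by (intro submodule_closed(6)) auto
            have lw: "Poly_Mapping.lookup w \<gamma> = (if \<gamma> \<in> Poly_Mapping.keys v \<and> ?P \<gamma> then Poly_Mapping.lookup v \<gamma> else 0)" for \<gamma>
              unfolding w_def by (simp add: lookup_sum lookup_single when_def sum.If_cases)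
            have keys: "\<gamma> \<in> Poly_Mapping.keys (v - w) \<longleftrightarrow> \<gamma> \<in> Poly_Mapping.keys v \<and> \<not> ?P \<gamma>" for \<gamma>
              using lw[of \<gamma>] by (auto simp: in_keys_iff lookup_minus)
            have "D K \<subseteq> L"
              using L spn_mono[of "\<lambda>\<alpha>. en \<alpha> < K" ?P] \<beta>(3) by blast
            have "D (Suc K) \<subseteq> L"
            proof (rule spn_subset)
              show "submodule L U M" using L by blast
              fix \<gamma> assume \<gamma>: "\<gamma> \<in> basis" "en \<gamma> < Suc K"
              show "X \<gamma> \<in> L"
              proof (cases "?P \<gamma>")
                case True
                then have "X \<gamma> \<in> ?N" using \<gamma> by (simp add: X_spn_iff)
                then show ?thesis using L by blast
              next
                case False
                show ?thesis
                proof (rule submodule_contains_isotypic[of L \<alpha> "v - w"])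
                  show "\<alpha> \<in> Poly_Mapping.keys (v - w)" using keys \<alpha> by blast
                  show "\<gamma> i div l = \<alpha> i div l" for i using False \<gamma> \<alpha>' \<beta>(3) by auto
                  show "en \<alpha>'' \<le> en \<alpha> \<and> (en \<alpha>'' = en \<alpha> \<longrightarrow> (\<forall>i. \<alpha>'' i div l = \<alpha> i div l))"
                    if "\<alpha>'' \<in> Poly_Mapping.keys (v - w)" for \<alpha>''
                    using that keys[of \<alpha>''] vD \<alpha>' \<beta>(3) by (auto simp: spn_iff less_Suc_eq)
                qed (use L vw \<gamma> \<alpha>' \<open>D K \<subseteq> L\<close> in auto)
              qed
            qed
            then show False using L \<open>L \<noteq> D (Suc K)\<close> by blast
          qed
        qed
      qed (rule N)
      then show False using x \<open>x \<notin> ?N\<close> by (auto simp: radical_def)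
    qed
  qed
  show "D K \<subseteq> radical U (M\<lparr>carrier := D (Suc K)\<rparr>)"
  proof -
    have "D K \<subseteq> N" if "maximal_submodule N U (M\<lparr>carrier := D (Suc K)\<rparr>)" for N
    proof -
      have N: "submodule N U M" "N \<subset> D (Suc K)"
        "\<And>L. submodule L U M \<Longrightarrow> N \<subseteq> L \<Longrightarrow> L \<subseteq> D (Suc K) \<Longrightarrow> L = N \<or> L = D (Suc K)"
        using that unfolding max by blast+
      let ?L = "{u + v |u v. u \<in> N \<and> v \<in> D K}"
      have "?L = N \<or> ?L = D (Suc K)"
      proof (rule N(3))
        show "submodule ?L U M" by (rule submodule_sum[OF N(1) submodule_D])
        show "N \<subseteq> ?L" using submodule_closed(2)[OF submodule_D[of K]] by force
        show "?L \<subseteq> D (Suc K)"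
        proof
          fix x assume "x \<in> ?L"
          then obtain u v where x: "x = u + v" "u \<in> N" "v \<in> D K" by blast
          have "u \<in> D (Suc K)" using x(2) N(2) by (rule subsetD[OF psubset_imp_subset, rotated])
          moreover have "v \<in> D (Suc K)" using x(3) by (rule subsetD[OF D_mono, rotated]) simp
          ultimately show "x \<in> D (Suc K)" unfolding x(1) by (rule spn_add)
        qed
      qed
      moreover have "?L \<noteq> D (Suc K)"
        using D_superfluous[OF N(1) _ \<beta>0] N(2) by blast
      moreover have "D K \<subseteq> ?L" using submodule_closed(2)[OF N(1)] by force
      ultimately show ?thesis by blast
    qed
    then show ?thesis using D_mono[of K "Suc K"] by (auto simp: radical_def)
  qed
qed

section \<open>The socle\<close>

text \<open>A vector with a term in layer \<open>k + 1\<close> can be lowered by exactly one layer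
  without vanishing. The exponent \<open>\<beta>0\<close> ensures that the residue sum can still
  grow by \<open>l\<close>; the term itself supplies an exponent \<open>j\<close> from which
  \<open>l\<close> can be taken.\<close>

lemma ex_descend:
  assumes S: "submodule S U M" and v: "v \<in> S" "v \<in> D (Suc (Suc k))" "v \<notin> D (Suc k)"
    and \<beta>0: "\<beta>0 \<in> basis" "en \<beta>0 \<le> k"
  shows "\<exists>w\<in>S. w \<in> D (Suc k) \<and> w \<notin> D k"
proof -
  obtain \<beta> where \<beta>: "\<beta> \<in> Poly_Mapping.keys v" "\<beta> \<in> basis" "en \<beta> = Suc k"
    using v by (auto simp: spn_iff less_Suc_eq)
  obtain r where "s = r + l * en \<beta>" and \<rho>: "res \<beta> \<in> Box r" using ex_layer[OF \<beta>(2)] .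
  then have s: "s = r + l * Suc k" and s': "s = (r + l) + l * k" using \<beta>(3) by simp_all
  have "l * en \<beta>0 \<le> l * k" using \<beta>0(2) by simp
  then have r: "r + l \<le> n * (l - 1)" using layer_bounds(2)[OF \<beta>0(1)] s' by linarith
  obtain \<sigma> where \<sigma>: "\<sigma> \<in> Box (r + l)" using Box_nonempty[OF r] .
  have "\<exists>j\<in>{1..n}. \<beta> j div l \<noteq> 0"
  proof (rule ccontr)
    assume "\<not> ?thesis"
    then have "en \<beta> = 0" by (simp add: en_def)
    then show False using \<beta>(3) by simp
  qed
  then obtain j where j: "j \<in> {1..n}" "l \<le> \<beta> j" using l_pos by (auto simp: div_eq_0_iff)
  obtain p where p: "shift_op p (\<lambda>i. int (\<sigma> i) - int (res \<beta> i) - (if i = j then int l else 0))"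
    "\<And>\<alpha>. res \<alpha> = res \<beta> \<Longrightarrow> l \<le> \<alpha> j \<Longrightarrow> free_act q p (X \<alpha>) \<noteq> 0"
    "\<And>\<alpha> \<gamma>. \<alpha> \<in> basis \<Longrightarrow> en \<alpha> \<le> Suc k \<Longrightarrow> maps_to p \<alpha> \<gamma> \<Longrightarrow> k \<le> en \<gamma> \<Longrightarrow> res \<alpha> = res \<beta>"
    using ex_lowering_op[OF j(1) s r \<rho> \<sigma>] by blast
  obtain \<gamma> where \<gamma>: "maps_to p \<beta> \<gamma>" using p j(2) shift_op_nz by blast
  \<comment> \<open>Survivors of the selected residue acquire residue \<open>\<sigma>\<close>, whose
    sum fixes the energy at \<open>k\<close>.\<close>
  have target: "en \<gamma>' = k" if B: "\<alpha> \<in> basis" and m: "maps_to p \<alpha> \<gamma>'" and eq: "res \<alpha> = res \<beta>" for \<alpha> \<gamma>'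
  proof -
    have "res \<gamma>' i = \<sigma> i" for i
    proof -
      have "int (\<gamma>' i) = int (\<alpha> i) + (int (\<sigma> i) - int (res \<beta> i) - (if i = j then int l else 0))"
        by (rule shift_opD(1)[OF p(1) m])
      then have "\<gamma>' i + (if i = j then l else 0) = l * (\<alpha> i div l) + \<sigma> i"
        using fun_cong[OF eq, of i] mult_div_mod_eq[of l "\<alpha> i"] by (simp add: res_def split: if_splits)
      then have "(\<gamma>' i + (if i = j then l else 0)) mod l = \<sigma> i"
        using \<sigma> by (simp add: Box_def)
      then show ?thesis by (simp add: res_def split: if_splits)
    qed
    then have "res \<gamma>' = \<sigma>" by blast
    then show ?thesis using res_Box_iff[OF maps_to_basis[OF p(1) m B] s'] \<sigma> by simp
  qed
  let ?w = "free_act q p v"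
  have "?w \<in> D (Suc k)"
    unfolding spn_iff
  proof
    fix \<gamma>' assume "\<gamma>' \<in> Poly_Mapping.keys ?w"
    then obtain \<alpha> where \<alpha>: "\<alpha> \<in> Poly_Mapping.keys v" "maps_to p \<alpha> \<gamma>'"
      by (rule keys_free_act_shift[OF p(1)])
    have B: "\<alpha> \<in> basis" "en \<alpha> \<le> Suc k" using v(2) \<alpha>(1) by (auto simp: spn_iff)
    have "en \<gamma>' < Suc k"
    proof (cases "k \<le> en \<gamma>'")
      case True
      then show ?thesis using target[OF B(1) \<alpha>(2) p(3)[OF B \<alpha>(2) True]] by simp
    qed simp
    then show "\<gamma>' \<in> basis \<and> en \<gamma>' < Suc k" using maps_to_basis[OF p(1) \<alpha>(2) B(1)] by simp
  qed
  moreover have "?w \<notin> D k"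
    using maps_to_keys[OF p(1) \<gamma> \<beta>(1)] target[OF \<beta>(2) \<gamma> refl] by (auto simp: spn_iff)
  moreover have "?w \<in> S" by (rule submodule_closed(4)[OF S shift_op_carrier[OF p(1)] v(1)])
  ultimately show ?thesis by blast
qed

lemma submodule_meets_layer:
  assumes S: "submodule S U M" and v: "v \<in> S" "v \<notin> D K" and \<beta>0: "\<beta>0 \<in> basis" "en \<beta>0 = K"
  shows "\<exists>w\<in>S. w \<in> D (Suc K) \<and> w \<notin> D K"
proof -
  have "\<exists>w\<in>S. w \<in> D (Suc K) \<and> w \<notin> D K" if "v \<in> S" "v \<in> D (Suc (K + i))" "v \<notin> D K" for v i
    using that
  proof (induction i arbitrary: v)
    case (Suc i)
    show ?case
    proof (cases "v \<in> D (Suc (K + i))")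
      case True
      then show ?thesis using Suc by blast
    next
      case False
      have "\<exists>w\<in>S. w \<in> D (Suc (K + i)) \<and> w \<notin> D (K + i)"
        by (rule ex_descend[OF S Suc.prems(1) _ False \<beta>0(1)]) (use Suc.prems(2) \<beta>0(2) in auto)
      then obtain w where w: "w \<in> S" "w \<in> D (Suc (K + i))" "w \<notin> D (K + i)" by blast
      have "w \<notin> D K" using w(3) D_mono[of K "K + i"] by auto
      then show ?thesis using Suc.IH[OF w(1,2)] by blast
    qed
  qed auto
  \<comment> \<open>Energies are at most \<open>s\<close>, so this crude level already contains
    everything and the descent can start there.\<close>
  moreover have "v \<in> D (Suc (K + s))"
  proof -
    have "en \<beta> \<le> s" if "\<beta> \<in> basis" for \<beta>
    proof -
      have "en \<beta> \<le> l * en \<beta>" using l_pos by (cases l) auto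
      then show ?thesis using layer_bounds(1)[OF that] by linarith
    qed
    then show ?thesis
      using submodule_closed(1)[OF S] v(1) by (fastforce simp: V_eq spn_iff less_Suc_eq_le trans_le_add2)
  qed
  ultimately show ?thesis using v by blast
qed

text \<open>A minimal submodule over \<open>D K\<close> meets layer \<open>K\<close> by descent and
  therefore lies in \<open>D (Suc K)\<close>. In the other direction, the isotypic submodules of the
  layer are minimal and contain all its monomials.\<close>

lemma socle_layer:
  assumes \<beta>0: "\<beta>0 \<in> basis" "en \<beta>0 = K"
  shows "{x \<in> carrier M. D K +>\<^bsub>M\<^esub> x \<in> socle U (quotient_module M (D K))} = D (Suc K)"
proof -
  interpret Q: quotient_of_module U M "D K"
    by (rule quotient_of_module.intro[OF left_module_M submodule_D])
  show ?thesis
  proof (rule Q.vimage_socle[OF submodule_D])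
    show "D K \<subseteq> D (Suc K)" by (rule D_mono) simp
    fix S assume "Q.minimal_over S"
    then have S: "submodule S U M" "D K \<subset> S"
      "\<And>T. submodule T U M \<Longrightarrow> D K \<subseteq> T \<Longrightarrow> T \<subseteq> S \<Longrightarrow> T = D K \<or> T = S"
      by (auto simp: Q.minimal_over_def)
    obtain v where v: "v \<in> S" "v \<notin> D K" using S(2) by blast
    obtain w where w: "w \<in> S" "w \<in> D (Suc K)" "w \<notin> D K"
      using submodule_meets_layer[OF S(1) v \<beta>0] by blast
    have "S \<inter> D (Suc K) = D K \<or> S \<inter> D (Suc K) = S"
      using S(2) D_mono[of K "Suc K"] by (intro S(3) submodule_Int S(1) submodule_D) auto
    then show "S \<subseteq> D (Suc K)" using w by blast
  next
    fix T assume T: "submodule T U M" "D K \<subseteq> T" "\<And>S. Q.minimal_over S \<Longrightarrow> S \<subseteq> T"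
    show "D (Suc K) \<subseteq> T"
    proof (rule spn_subset[OF T(1)])
      fix \<beta> assume \<beta>: "\<beta> \<in> basis" "en \<beta> < Suc K"
      show "X \<beta> \<in> T"
      proof (cases "en \<beta> = K")
        case False
        then show ?thesis using \<beta> T(2) by (auto simp: X_spn_iff)
      next
        case K: True
        let ?S = "spn (\<lambda>\<alpha>. en \<alpha> < en \<beta> \<or> (\<forall>i. \<alpha> i div l = \<beta> i div l))"
        have S: "submodule ?S U M" by (rule submodule_isotypic)
        have X: "X \<beta> \<in> ?S" "X \<beta> \<notin> D K" using \<beta>(1) K by (auto simp: X_spn_iff)
        have "Q.minimal_over ?S"
          unfolding Q.minimal_over_def
        proof (intro conjI allI impI S)
          have "D K \<subseteq> ?S" by (rule spn_mono) (simp add: K)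
          then show "D K \<subset> ?S" using X by blast
          fix H assume H: "submodule H U M" "D K \<subseteq> H" "H \<subseteq> ?S"
          show "H = D K \<or> H = ?S"
          proof (rule disjCI)
            assume "H \<noteq> ?S"
            show "H = D K"
            proof (rule ccontr)
              assume "H \<noteq> D K"
              then obtain v where v: "v \<in> H" "v \<notin> D K" using H(2) by blast
              have vS: "v \<in> ?S" using v(1) H(3) by blast
              then obtain \<alpha> where \<alpha>: "\<alpha> \<in> Poly_Mapping.keys v" "\<not> en \<alpha> < K"
                using v(2) by (auto simp: spn_iff)
              have \<alpha>': "\<forall>i. \<alpha> i div l = \<beta> i div l" using \<alpha> vS K by (auto simp: spn_iff)
              then have en\<alpha>: "en \<alpha> = K" using K by (simp add: en_def)
              have "?S \<subseteq> H"
              proof (rule spn_subset[OF H(1)])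
                fix \<gamma> assume \<gamma>: "\<gamma> \<in> basis" "en \<gamma> < en \<beta> \<or> (\<forall>i. \<gamma> i div l = \<beta> i div l)"
                show "X \<gamma> \<in> H"
                proof (cases "en \<gamma> < K")
                  case True
                  then show ?thesis using H(2) \<gamma>(1) by (auto simp: X_spn_iff)
                next
                  case False
                  show ?thesis
                  proof (rule submodule_contains_isotypic[OF H(1) _ v(1) \<alpha>(1) _ \<gamma>(1)])
                    show "D (en \<alpha>) \<subseteq> H" using H(2) en\<alpha> by simp
                    show "\<gamma> i div l = \<alpha> i div l" for i using \<gamma>(2) False \<alpha>' K by auto
                    show "en \<alpha>'' \<le> en \<alpha> \<and> (en \<alpha>'' = en \<alpha> \<longrightarrow> (\<forall>i. \<alpha>'' i div l = \<alpha> i div l))"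
                      if \<alpha>'': "\<alpha>'' \<in> Poly_Mapping.keys v" for \<alpha>''
                    proof -
                      have "en \<alpha>'' < en \<beta> \<or> (\<forall>i. \<alpha>'' i div l = \<beta> i div l)"
                        using vS \<alpha>'' unfolding spn_iff by blast
                      then show ?thesis
                      proof
                        assume "\<forall>i. \<alpha>'' i div l = \<beta> i div l"
                        then have "\<forall>i. \<alpha>'' i div l = \<alpha> i div l" using \<alpha>' by simp
                        then show ?thesis by (simp add: en_def)
                      qed (simp add: en\<alpha> K)
                    qed
                  qed
                qed
              qed
              then show False using H(3) \<open>H \<noteq> ?S\<close> by blast
            qed
          qed
        qed
        then show ?thesis using T(3) X(1) by blast
      qed
    qed
  qed
qed

section \<open>Rigidity\<close>

definition top_en :: nat where "top_en = s div l"

text \<open>Residues account for at most \<open>n * (l - 1)\<close> of the degree; multiples of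
  \<open>l\<close> must supply the rest.\<close>

definition bot_en :: nat where "bot_en = (LEAST K. s \<le> l * K + n * (l - 1))"

text \<open>No layer is missing in between, so the energy filtration is strict and its length can be
  read off.\<close>

lemma ex_basis_en_iff: "(\<exists>\<beta>\<in>basis. en \<beta> = K) \<longleftrightarrow> bot_en \<le> K \<and> K \<le> top_en"
proof -
  have bot: "s \<le> l * bot_en + n * (l - 1)"
  proof -
    have "s \<le> l * s + n * (l - 1)" using l_pos by (cases l) auto
    then show ?thesis unfolding bot_en_def by (rule LeastI)
  qed
  show ?thesis
  proof
    assume "\<exists>\<beta>\<in>basis. en \<beta> = K"
    then obtain \<beta> where \<beta>: "\<beta> \<in> basis" "en \<beta> = K" by blast
    have "bot_en \<le> K" unfolding bot_en_def using layer_bounds(2)[OF \<beta>(1)] \<beta>(2) by (intro Least_le) simp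
    moreover have "K \<le> top_en"
      using layer_bounds(1)[OF \<beta>(1)] \<beta>(2) l_pos by (simp add: top_en_def less_eq_div_iff_mult_less_eq mult.commute)
    ultimately show "bot_en \<le> K \<and> K \<le> top_en" by simp
  next
    assume K: "bot_en \<le> K \<and> K \<le> top_en"
    have 1: "l * K \<le> s"
      using K l_pos by (simp add: top_en_def less_eq_div_iff_mult_less_eq mult.commute)
    have "l * bot_en \<le> l * K" using K by simp
    then have "s - l * K \<le> n * (l - 1)" using bot by linarith
    then obtain \<rho> where \<rho>: "\<rho> \<in> Box (s - l * K)" using Box_nonempty by blast
    define m where "m = (\<lambda>i::nat. if i = 1 then K else 0)"
    have m: "m \<in> multi_indices n" "(\<Sum>i=1..n. m i) = K"
      using n by (auto simp: m_def multi_indices_def sum.delta)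
    have "compose \<rho> m \<in> basis" "en (compose \<rho> m) = K"
      using compose_basis[OF \<rho> m(1)] 1 m(2) by simp_all
    then show "\<exists>\<beta>\<in>basis. en \<beta> = K" by blast
  qed
qed

lemma bot_le_top: "bot_en \<le> top_en"
proof -
  have "s = l * top_en + s mod l" by (simp add: top_en_def)
  moreover have "s mod l \<le> l - 1" using mod_less_divisor[OF l_pos, of s] by linarith
  moreover have "1 * (l - 1) \<le> n * (l - 1)" using n by (intro mult_le_mono1) simp
  ultimately have "s \<le> l * top_en + n * (l - 1)" by linarith
  then show ?thesis unfolding bot_en_def by (rule Least_le)
qed

lemma basis_en_bounds: "\<beta> \<in> basis \<Longrightarrow> bot_en \<le> en \<beta>" "\<beta> \<in> basis \<Longrightarrow> en \<beta> \<le> top_en"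
  using ex_basis_en_iff by blast+

lemma D_bot: "D bot_en = {0}"
proof -
  have "D bot_en \<subseteq> D 0"
    by (rule spn_mono) (use basis_en_bounds(1) in \<open>auto simp: not_less[symmetric]\<close>)
  then show ?thesis using D_0 submodule_closed(2)[OF submodule_D] by blast
qed

lemma D_top: "D (Suc top_en) = V"
  using basis_en_bounds(2) by (auto simp: V_eq spn_iff less_Suc_eq_le)

lemma socle_series_eq: "bot_en + j \<le> Suc top_en \<Longrightarrow> socle_series U M j = D (bot_en + j)"
proof (induction j)
  case (Suc j)
  then obtain \<beta>0 where "\<beta>0 \<in> basis" "en \<beta>0 = bot_en + j" using ex_basis_en_iff[of "bot_en + j"] by auto
  from socle_layer[OF this] show ?case using Suc by simp
qed (simp add: D_bot)

lemma radical_series_eq: "j \<le> Suc top_en - bot_en \<Longrightarrow> radical_series U M j = D (Suc top_en - j)"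
proof (induction j)
  case (Suc j)
  have K: "Suc top_en - j = Suc (top_en - j)" "Suc top_en - Suc j = top_en - j" using Suc.prems by simp_all
  obtain \<beta>0 where "\<beta>0 \<in> basis" "en \<beta>0 = top_en - j"
    using ex_basis_en_iff[of "top_en - j"] Suc.prems by auto
  from radical_layer[OF this] show ?case using Suc unfolding K by (simp add: K(1))
qed (simp add: D_top)

lemma loewy_length_eq: "loewy_length U M = Suc top_en - bot_en"
  unfolding loewy_length_def
proof (rule Least_equality)
  have "Suc top_en - (Suc top_en - bot_en) = bot_en" using bot_le_top by simp
  then show "radical_series U M (Suc top_en - bot_en) = {\<zero>\<^bsub>M\<^esub>}"
    using radical_series_eq[of "Suc top_en - bot_en"] D_bot by simp
next
  fix j assume j: "radical_series U M j = {\<zero>\<^bsub>M\<^esub>}"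
  show "Suc top_en - bot_en \<le> j"
  proof (rule ccontr)
    assume "\<not> Suc top_en - bot_en \<le> j"
    then have "D (Suc top_en - j) = {0}" "bot_en < Suc top_en - j"
      using j radical_series_eq[of j] by auto
    moreover obtain \<beta> where "\<beta> \<in> basis" "en \<beta> = bot_en" using ex_basis_en_iff[of bot_en] bot_le_top by auto
    ultimately have "X \<beta> \<in> {0}" by (metis X_spn_iff)
    then show False by (simp add: poly_mapping_single_eq_0_iff)
  qed
qed

lemma rigid: "rigid_module U M"
  unfolding rigid_module_def
proof (intro allI impI)
  fix j assume j: "j \<le> loewy_length U M"
  then have j': "bot_en + j \<le> Suc top_en" using bot_le_top by (simp add: loewy_length_eq)
  have "radical_series U M (loewy_length U M - j) = D (Suc top_en - (Suc top_en - bot_en - j))"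
    unfolding loewy_length_eq by (rule radical_series_eq) simp
  also have "Suc top_en - (Suc top_en - bot_en - j) = bot_en + j" using j' by simp
  also have "D (bot_en + j) = socle_series U M j" by (rule socle_series_eq[OF j', symmetric])
  finally show "radical_series U M (loewy_length U M - j) = socle_series U M j" .
qed

section \<open>Indecomposability\<close>

context
  fixes N L :: "((nat \<Rightarrow> nat) \<Rightarrow>\<^sub>0 'k) set"
  assumes N: "submodule N U M" and L: "submodule L U M"
    and disjoint: "N \<inter> L = {0}" and cover: "V \<subseteq> {u + v |u v. u \<in> N \<and> v \<in> L}"
begin

definition proj :: "((nat \<Rightarrow> nat) \<Rightarrow>\<^sub>0 'k) \<Rightarrow> ((nat \<Rightarrow> nat) \<Rightarrow>\<^sub>0 'k)" where
  "proj v = (THE u. u \<in> N \<and> v - u \<in> L)"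

lemma proj_eqI:
  assumes "u \<in> N" "v - u \<in> L"
  shows "proj v = u"
  unfolding proj_def
proof (rule the_equality)
  fix u' assume u': "u' \<in> N \<and> v - u' \<in> L"
  then have "u' - u \<in> N" using submodule_closed(6)[OF N _ assms(1)] by blast
  moreover have "(v - u) - (v - u') \<in> L" using u' submodule_closed(6)[OF L assms(2)] by blast
  then have "u' - u \<in> L" by simp
  ultimately have "u' - u \<in> {0}" using disjoint by blast
  then show "u' = u" by simp
qed (use assms in simp)

lemma proj_props:
  assumes "v \<in> V"
  shows "proj v \<in> N" "v - proj v \<in> L"
proof -
  obtain u w where "v = u + w" "u \<in> N" "w \<in> L" using cover assms by blast
  then have "u \<in> N" "v - u \<in> L" by simp_all
  then show "proj v \<in> N" "v - proj v \<in> L" using proj_eqI by simp_all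
qed

lemma proj_V: "v \<in> V \<Longrightarrow> proj v \<in> V"
  using proj_props(1) submodule_closed(1)[OF N] by blast

lemma proj_scal:
  assumes "v \<in> V"
  shows "proj (scal c v) = scal c (proj v)"
  using submodule_closed(5)[OF N proj_props(1)[OF assms], of c] submodule_closed(5)[OF L proj_props(2)[OF assms], of c]
  by (intro proj_eqI) (simp_all add: scal_diff_right)

lemma proj_act:
  assumes "v \<in> V" "p \<in> carrier (free_alg n)"
  shows "proj (free_act q p v) = free_act q p (proj v)"
proof (rule proj_eqI)
  show "free_act q p (proj v) \<in> N" by (rule submodule_closed(4)[OF N assms(2) proj_props(1)[OF assms(1)]])
  have "free_act q p (v - proj v) \<in> L" by (rule submodule_closed(4)[OF L assms(2) proj_props(2)[OF assms(1)]])
  moreover have "free_act q p v = free_act q p (v - proj v) + free_act q p (proj v)"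
    unfolding free_act_add_right[symmetric] by simp
  ultimately show "free_act q p v - free_act q p (proj v) \<in> L" by simp
qed

definition mat :: "(nat \<Rightarrow> nat) \<Rightarrow> (nat \<Rightarrow> nat) \<Rightarrow> 'k" where
  "mat \<beta> \<gamma> = Poly_Mapping.lookup (proj (X \<beta>)) \<gamma>"

lemma X_V: "\<beta> \<in> basis \<Longrightarrow> X \<beta> \<in> V"
  by (simp add: V_eq X_spn_iff)

text \<open>The word kills \<open>X \<beta>\<close> and hence its projection, where a term at
  \<open>\<beta>'\<close> would survive without cancellation.\<close>

lemma mat_zero:
  assumes p: "shift_op p \<delta>" and "\<beta> \<in> basis" and "free_act q p (X \<beta>) = 0" and m: "maps_to p \<beta>' \<gamma>'"
  shows "mat \<beta> \<beta>' = 0"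
proof -
  have "proj 0 = 0" by (rule proj_eqI) (simp_all add: submodule_closed(2)[OF N] submodule_closed(2)[OF L])
  then have "free_act q p (proj (X \<beta>)) = 0"
    using proj_act[OF X_V[OF assms(2)] shift_op_carrier[OF p]] assms(3) by simp
  then have "mat \<beta> \<beta>' * Poly_Mapping.lookup (free_act q p (X \<beta>')) \<gamma>' = 0"
    using lookup_free_act_shift[OF p shift_opD(1)[OF p m], of "proj (X \<beta>)"] by (simp add: mat_def)
  then show ?thesis using maps_to_lookup[OF m] by simp
qed

text \<open>Comparing coefficients at \<open>\<gamma>'\<close> gives
  \<open>c * mat \<gamma> \<gamma>' = mat \<beta> \<beta>' * c'\<close>, with the scalars by which
  \<open>p\<close> acts on \<open>X \<beta>\<close> and \<open>X \<beta>'\<close>. These may differ,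
  so off the diagonal only vanishing is transported; on the diagonal they cancel.\<close>

lemma mat_shift:
  assumes p: "shift_op p \<delta>" and \<beta>: "\<beta> \<in> basis" and m: "maps_to p \<beta> \<gamma>" and m': "maps_to p \<beta>' \<gamma>'"
  shows "mat \<gamma> \<gamma>' = 0 \<longleftrightarrow> mat \<beta> \<beta>' = 0" "\<beta> = \<beta>' \<Longrightarrow> mat \<gamma> \<gamma>' = mat \<beta> \<beta>'"
proof -
  obtain c where c: "c \<noteq> 0" "free_act q p (X \<beta>) = Poly_Mapping.single \<gamma> c" using m by (auto simp: maps_to_def)
  obtain c' where c': "c' \<noteq> 0" "free_act q p (X \<beta>') = Poly_Mapping.single \<gamma>' c'" using m' by (auto simp: maps_to_def)
  have \<gamma>: "\<gamma> \<in> basis" by (rule maps_to_basis[OF p m \<beta>])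
  have "scal c (proj (X \<gamma>)) = proj (free_act q p (X \<beta>))"
    unfolding proj_scal[OF X_V[OF \<gamma>], symmetric] c(2) by simp
  also have "\<dots> = free_act q p (proj (X \<beta>))"
    by (rule proj_act[OF X_V[OF \<beta>] shift_op_carrier[OF p]])
  finally have "c * mat \<gamma> \<gamma>' = Poly_Mapping.lookup (free_act q p (proj (X \<beta>))) \<gamma>'"
    by (metis lookup_scal mat_def)
  also have "\<dots> = mat \<beta> \<beta>' * c'"
    unfolding lookup_free_act_shift[OF p shift_opD(1)[OF p m'], of "proj (X \<beta>)"] c'(2) mat_def by simp
  finally have eq: "c * mat \<gamma> \<gamma>' = mat \<beta> \<beta>' * c'" .
  show "mat \<gamma> \<gamma>' = 0 \<longleftrightarrow> mat \<beta> \<beta>' = 0" using eq c(1) c'(1) by (metis mult_eq_0_iff)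
  assume b: "\<beta> = \<beta>'"
  then have "\<gamma> = \<gamma>'" using maps_to_unique[OF m] m' by simp
  then have "c = c'" using b c c' by (simp add: poly_mapping_single_eq_iff)
  then show "mat \<gamma> \<gamma>' = mat \<beta> \<beta>'" using eq c(1) by simp
qed

text \<open>An operator of zero shift that selects \<open>res \<beta>'\<close> within the layer
  kills \<open>X \<beta>\<close> but not \<open>X \<beta>'\<close>.\<close>

lemma mat_distinct_res:
  assumes \<beta>: "\<beta> \<in> basis" and \<beta>': "\<beta>' \<in> basis" "en \<beta> = en \<beta>'" "res \<beta> \<noteq> res \<beta>'"
  shows "mat \<beta> \<beta>' = 0"
proof -
  obtain r where r: "s = r + l * en \<beta>'" "res \<beta>' \<in> Box r" using ex_layer[OF \<beta>'(1)] .
  obtain p where p: "shift_op p (\<lambda>i. int (res \<beta>' i) - int (res \<beta>' i))"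
    "\<And>\<alpha>. res \<alpha> = res \<beta>' \<Longrightarrow> free_act q p (X \<alpha>) \<noteq> 0"
    "\<And>\<alpha> \<gamma>. res \<alpha> \<in> Box r \<Longrightarrow> maps_to p \<alpha> \<gamma> \<Longrightarrow> (\<forall>i. \<gamma> i div l = \<alpha> i div l) \<Longrightarrow> res \<alpha> = res \<beta>'"
    using ex_layer_op[OF r(2) r(2)] by blast
  have same: "\<gamma> = \<alpha>" if "maps_to p \<alpha> \<gamma>" for \<alpha> \<gamma>
    using shift_opD(1)[OF p(1) that] by (simp add: fun_eq_iff)
  have "free_act q p (X \<beta>) = 0"
  proof (rule ccontr)
    assume "free_act q p (X \<beta>) \<noteq> 0"
    then obtain \<gamma> where \<gamma>: "maps_to p \<beta> \<gamma>" using p(1) shift_op_nz by blast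
    then have "res \<beta> = res \<beta>'"
      using p(3)[OF _ \<gamma>] same[OF \<gamma>] res_Box_iff[OF \<beta> r(1)] \<beta>'(2) by simp
    then show False using \<beta>'(3) by simp
  qed
  moreover obtain \<gamma>' where "maps_to p \<beta>' \<gamma>'" using p(1,2) shift_op_nz by blast
  ultimately show ?thesis using mat_zero[OF p(1) \<beta>] by blast
qed

lemma en_eq_if_res_eq:
  assumes "\<beta> \<in> basis" "\<gamma> \<in> basis" "res \<beta> = res \<gamma>"
  shows "en \<beta> = en \<gamma>"
proof -
  have "l * en \<beta> = l * en \<gamma>"
    using sum_res_en[OF assms(1)] sum_res_en[OF assms(2)] unfolding assms(3) by linarith
  then show ?thesis using l_pos by simp
qed

section \<open>Moving multiples of \<open>l\<close> between exponents of the top layer\<close>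

definition moves :: "nat \<Rightarrow> nat \<Rightarrow> (nat \<Rightarrow> nat) \<Rightarrow> (nat \<Rightarrow> nat) \<Rightarrow> bool" where
  "moves i j \<beta> \<gamma> \<longleftrightarrow> l \<le> \<beta> j \<and> \<gamma> = \<beta>(j := \<beta> j - l, i := \<beta> i + l)"

lemma moves_basis:
  assumes "moves i j \<beta> \<gamma>" "i \<noteq> j" "i \<in> {1..n}" "j \<in> {1..n}" "\<beta> \<in> basis"
  shows "\<gamma> \<in> basis" "res \<gamma> = res \<beta>" "en \<gamma> = en \<beta>"
proof -
  have \<gamma>: "\<gamma> = \<beta>(j := \<beta> j - l, i := \<beta> i + l)" and le: "l \<le> \<beta> j" using assms(1) by (auto simp: moves_def)
  have "(\<Sum>k=1..n. 1 * \<gamma> k) + 1 * \<beta> j + 1 * \<beta> i = (\<Sum>k=1..n. 1 * \<beta> k) + 1 * (\<beta> j - l) + 1 * (\<beta> i + l)"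
    unfolding \<gamma> by (rule sum_fun_upd2) (use assms in auto)
  then have "(\<Sum>k=1..n. \<gamma> k) = (\<Sum>k=1..n. \<beta> k)" using le by simp
  then show B: "\<gamma> \<in> basis" using assms(3-5) by (auto simp: basis_def multi_indices_def \<gamma>)
  show r: "res \<gamma> = res \<beta>" using le by (auto simp: res_def \<gamma> fun_eq_iff le_mod_geq)
  show "en \<gamma> = en \<beta>" by (rule en_eq_if_res_eq[OF B assms(5) r])
qed

text \<open>Moving \<open>l\<close> from the exponent \<open>j\<close> to the exponent \<open>i\<close> means descending by one layer at
  \<open>j\<close> and ascending again at \<open>i\<close>.\<close>

lemma mat_moves:
  assumes \<beta>: "\<beta> \<in> basis" "en \<beta> = top_en" and \<beta>': "\<beta>' \<in> basis" "res \<beta>' = res \<beta>"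
    and ij: "i \<in> {1..n}" "j \<in> {1..n}" "i \<noteq> j"
  shows "l \<le> \<beta>' j \<Longrightarrow> \<beta> j < l \<Longrightarrow> mat \<beta> \<beta>' = 0"
    and "moves i j \<beta> \<gamma> \<Longrightarrow> moves i j \<beta>' \<gamma>' \<Longrightarrow> mat \<gamma> \<gamma>' = 0 \<longleftrightarrow> mat \<beta> \<beta>' = 0"
    and "moves i j \<beta> \<gamma> \<Longrightarrow> moves i j \<beta>' \<gamma>' \<Longrightarrow> \<beta> = \<beta>' \<Longrightarrow> mat \<gamma> \<gamma>' = mat \<beta> \<beta>'"
proof -
  have main: "(\<beta> j < l \<longrightarrow> mat \<beta> \<beta>' = 0) \<and>
    (moves i j \<beta> \<gamma> \<longrightarrow> moves i j \<beta>' \<gamma>' \<longrightarrow> (mat \<gamma> \<gamma>' = 0 \<longleftrightarrow> mat \<beta> \<beta>' = 0) \<and> (\<beta> = \<beta>' \<longrightarrow> mat \<gamma> \<gamma>' = mat \<beta> \<beta>'))"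
    if le: "l \<le> \<beta>' j" for \<gamma> \<gamma>'
  proof -
    define r where "r = s mod l"
    have "\<beta>' j div l \<noteq> 0" using le l_pos by (simp add: div_eq_0_iff)
    moreover have en': "en \<beta>' = top_en"
      using en_eq_if_res_eq[OF \<beta>'(1) \<beta>(1) \<beta>'(2)] \<beta>(2) by simp
    moreover have "\<beta>' j div l \<le> en \<beta>'"
      unfolding en_def using ij(2) by (intro member_le_sum) auto
    ultimately have "top_en \<noteq> 0" by simp
    then obtain k where k: "top_en = Suc k" by (cases top_en) auto
    have s: "s = r + l * Suc k" unfolding k[symmetric] by (simp add: r_def top_en_def)
    have \<rho>: "res \<beta> \<in> Box r" using res_Box_iff[OF \<beta>(1) s] \<beta>(2) k by simp
    \<comment> \<open>Now \<open>r + l \<le> 2 * l - 1 \<le> 3 * (l - 1) \<le> n * (l - 1)\<close>: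
      the layer below the top one has residues, so descending is possible.\<close>
    have "r \<le> l - 1" unfolding r_def using mod_less_divisor[OF l_pos, of s] by linarith
    moreover have "3 * (l - 1) \<le> n * (l - 1)" using n by (intro mult_le_mono1)
    ultimately have r: "r + l \<le> n * (l - 1)" using l by linarith
    obtain \<sigma> where \<sigma>: "\<sigma> \<in> Box (r + l)" using Box_nonempty[OF r] .
    obtain p where p: "shift_op p (\<lambda>t. int (\<sigma> t) - int (res \<beta> t) - (if t = j then int l else 0))"
      "\<And>\<alpha>. res \<alpha> = res \<beta> \<Longrightarrow> l \<le> \<alpha> j \<Longrightarrow> free_act q p (X \<alpha>) \<noteq> 0"
      using ex_lowering_op[OF ij(2) s r \<rho> \<sigma>] by blast
    obtain p' where p': "shift_op p' (\<lambda>t. int (\<sigma> t) - int (res \<beta> t) - (if t = i then int l else 0))"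
      "\<And>\<alpha>. res \<alpha> = res \<beta> \<Longrightarrow> l \<le> \<alpha> i \<Longrightarrow> free_act q p' (X \<alpha>) \<noteq> 0"
      using ex_lowering_op[OF ij(1) s r \<rho> \<sigma>] by blast
    obtain \<alpha>' where \<alpha>': "maps_to p \<beta>' \<alpha>'" using p \<beta>'(2) le shift_op_nz by blast
    show ?thesis
    proof (intro conjI impI)
      assume lt: "\<beta> j < l"
      \<comment> \<open>The exponent \<open>j\<close> of a nonzero image would be
        \<open>\<sigma> j - l\<close>, which is negative.\<close>
      have "free_act q p (X \<beta>) = 0"
      proof (rule ccontr)
        assume "free_act q p (X \<beta>) \<noteq> 0"
        then obtain \<alpha> where "maps_to p \<beta> \<alpha>" using p(1) shift_op_nz by blast
        then have "int (\<alpha> j) = int (\<beta> j) + (int (\<sigma> j) - int (res \<beta> j) - int l)"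
          using shift_opD(1)[OF p(1), of \<beta> \<alpha> j] by simp
        moreover have "res \<beta> j = \<beta> j" "\<sigma> j < l" using lt \<sigma> by (auto simp: res_def Box_def)
        ultimately show False by simp
      qed
      then show "mat \<beta> \<beta>' = 0" using mat_zero[OF p(1) \<beta>(1)] \<alpha>' by blast
    next
      assume m: "moves i j \<beta> \<gamma>" and m': "moves i j \<beta>' \<gamma>'"
      note mb = moves_basis[OF m ij(3,1,2) \<beta>(1)] and mb' = moves_basis[OF m' ij(3,1,2) \<beta>'(1)]
      obtain \<alpha> where \<alpha>: "maps_to p \<beta> \<alpha>" using p m shift_op_nz unfolding moves_def by blast
      \<comment> \<open>Descending at \<open>j\<close> before the move and at \<open>i\<close> after
        it lead to the same exponent of the lower layer.\<close>
      have same: "maps_to p' \<gamma>1 \<alpha>1"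
        if mv: "moves i j \<beta>1 \<gamma>1" and a: "maps_to p \<beta>1 \<alpha>1" and re: "res \<gamma>1 = res \<beta>" for \<beta>1 \<gamma>1 \<alpha>1
      proof -
        have "l \<le> \<gamma>1 i" using mv by (simp add: moves_def)
        then obtain \<alpha>2 where \<alpha>2: "maps_to p' \<gamma>1 \<alpha>2" using p' re shift_op_nz by blast
        have "\<alpha>2 t = \<alpha>1 t" for t
        proof -
          have "int (\<gamma>1 t) = int (\<beta>1 t) - (if t = j then int l else 0) + (if t = i then int l else 0)"
            using mv ij(3) by (auto simp: moves_def of_nat_diff)
          then show ?thesis
            using shift_opD(1)[OF p(1) a, of t] shift_opD(1)[OF p'(1) \<alpha>2, of t] by linarith
        qed
        then have "\<alpha>2 = \<alpha>1" by blast
        then show ?thesis using \<alpha>2 by simp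
      qed
      have a: "maps_to p' \<gamma> \<alpha>" by (rule same[OF m \<alpha>]) (rule mb(2))
      have a': "maps_to p' \<gamma>' \<alpha>'" by (rule same[OF m' \<alpha>']) (simp add: mb'(2) \<beta>'(2))
      note e = mat_shift[OF p(1) \<beta>(1) \<alpha> \<alpha>'] and e' = mat_shift[OF p'(1) mb(1) a a']
      show "mat \<gamma> \<gamma>' = 0 \<longleftrightarrow> mat \<beta> \<beta>' = 0" using e(1) e'(1) by blast
      assume b: "\<beta> = \<beta>'"
      then have "\<gamma> = \<gamma>'" using m m' by (simp add: moves_def)
      then show "mat \<gamma> \<gamma>' = mat \<beta> \<beta>'" using e(2)[OF b] e'(2) by simp
    qed
  qed
  show "l \<le> \<beta>' j \<Longrightarrow> \<beta> j < l \<Longrightarrow> mat \<beta> \<beta>' = 0" using main by blast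
  show "moves i j \<beta> \<gamma> \<Longrightarrow> moves i j \<beta>' \<gamma>' \<Longrightarrow> mat \<gamma> \<gamma>' = 0 \<longleftrightarrow> mat \<beta> \<beta>' = 0"
    using main[of \<gamma> \<gamma>'] unfolding moves_def by blast
  show "moves i j \<beta> \<gamma> \<Longrightarrow> moves i j \<beta>' \<gamma>' \<Longrightarrow> \<beta> = \<beta>' \<Longrightarrow> mat \<gamma> \<gamma>' = mat \<beta> \<beta>'"
    using main[of \<gamma> \<gamma>'] unfolding moves_def by blast
qed

text \<open>For equal residues, choose \<open>j\<close> with \<open>\<beta> j < \<beta>' j\<close>
  and move \<open>l\<close> away from \<open>j\<close> in both exponents until
  \<open>\<beta> j < l\<close>. Then \<open>\<beta>' j\<close> is still at least \<open>l\<close>,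
  so a descent at \<open>j\<close> kills only the monomial of \<open>\<beta>\<close>.\<close>

lemma mat_off_diagonal:
  assumes "\<beta> \<in> basis" "en \<beta> = top_en" "\<beta>' \<in> basis" "en \<beta>' = top_en" "\<beta> \<noteq> \<beta>'"
  shows "mat \<beta> \<beta>' = 0"
proof (cases "res \<beta>' = res \<beta>")
  case False
  then show ?thesis using mat_distinct_res assms by metis
next
  case res: True
  have "\<exists>j\<in>{1..n}. \<beta> j < \<beta>' j"
  proof (rule ccontr)
    assume "\<not> ?thesis"
    then have le: "\<beta>' j \<le> \<beta> j" if "j \<in> {1..n}" for j using that by (auto simp: not_less)
    obtain j where j: "\<beta> j \<noteq> \<beta>' j" using assms(5) by blast
    have "j \<in> {1..n}"
    proof (rule ccontr)
      assume "j \<notin> {1..n}"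
      then have "\<beta> j = 0" "\<beta>' j = 0" using assms(1,3) by (simp_all add: basis_def multi_indices_def)
      then show False using j by simp
    qed
    moreover from this have "\<beta>' j < \<beta> j" using le[of j] j by simp
    ultimately have "(\<Sum>i=1..n. \<beta>' i) < (\<Sum>i=1..n. \<beta> i)"
      by (intro sum_strict_mono_ex1) (use le in \<open>auto simp del: atLeastAtMost_iff\<close>)
    then show False using assms by (simp add: basis_def)
  qed
  then obtain j where j: "j \<in> {1..n}" "\<beta> j < \<beta>' j" by blast
  obtain i where i: "i \<in> {1..n}" "i \<noteq> j" using ex_adj[OF j(1)] adj_neq by (metis adj_def)
  have "mat \<beta> \<beta>' = 0"
    if "\<beta> \<in> basis" "en \<beta> = top_en" "\<beta>' \<in> basis" "res \<beta>' = res \<beta>" "\<beta> j < \<beta>' j" for \<beta> \<beta>'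
    using that
  proof (induction "\<beta> j" arbitrary: \<beta> \<beta>' rule: less_induct)
    case less
    \<comment> \<open>Congruent numbers \<open>\<beta> j < \<beta>' j\<close> differ by at least
      \<open>l\<close>.\<close>
    have "l \<le> \<beta>' j"
    proof (rule ccontr)
      assume "\<not> l \<le> \<beta>' j"
      then have "res \<beta>' j = \<beta>' j" "res \<beta> j = \<beta> j" using less.prems(5) by (auto simp: res_def)
      then show False using less.prems(4,5) by simp
    qed
    show ?case
    proof (cases "\<beta> j < l")
      case True
      then show ?thesis using mat_moves(1)[OF less.prems(1-4) i(1) j(1) i(2) \<open>l \<le> \<beta>' j\<close>] by simp
    next
      case False
      define \<gamma> \<gamma>' where "\<gamma> = \<beta>(j := \<beta> j - l, i := \<beta> i + l)" and "\<gamma>' = \<beta>'(j := \<beta>' j - l, i := \<beta>' i + l)"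
      have m: "moves i j \<beta> \<gamma>" "moves i j \<beta>' \<gamma>'"
        using False \<open>l \<le> \<beta>' j\<close> by (auto simp: moves_def \<gamma>_def \<gamma>'_def)
      note b = moves_basis[OF m(1) i(2,1) j(1) less.prems(1)]
        and b' = moves_basis[OF m(2) i(2,1) j(1) less.prems(3)]
      have "mat \<gamma> \<gamma>' = 0"
      proof (rule less.hyps)
        show "\<gamma> j < \<beta> j" using False l_pos i(2) by (simp add: \<gamma>_def)
        show "\<gamma> j < \<gamma>' j" using False less.prems(5) i(2) by (simp add: \<gamma>_def \<gamma>'_def)
      qed (use b b' less.prems in auto)
      then show ?thesis using mat_moves(2)[OF less.prems(1-4) i(1) j(1) i(2) m] by simp
    qed
  qed
  then show ?thesis using assms res j(2) by blast
qed

text \<open>Moving all multiples of \<open>l\<close> to exponent 1 brings the quotients to a common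
  normal form without changing the diagonal entry; a layer operator then connects the
  residues.\<close>

lemma mat_diagonal:
  assumes \<alpha>: "\<alpha> \<in> basis" "en \<alpha> = top_en" and \<beta>: "\<beta> \<in> basis" "en \<beta> = top_en"
  shows "mat \<alpha> \<alpha> = mat \<beta> \<beta>"
proof -
  define r where "r = s mod l"
  have s: "s = r + l * top_en" by (simp add: r_def top_en_def)
  define m where "m = (\<lambda>i::nat. if i = 1 then top_en else 0)"
  have one: "1 \<in> {1..n}" using n by simp
  have m: "m \<in> multi_indices n" "(\<Sum>i=1..n. m i) = top_en"
    using one by (auto simp: m_def multi_indices_def)
  have collect: "mat \<beta> \<beta> = mat (compose (res \<beta>) m) (compose (res \<beta>) m)"
    if "\<beta> \<in> basis" "en \<beta> = top_en" for \<beta>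
    using that
  proof (induction "s - \<beta> 1" arbitrary: \<beta> rule: less_induct)
    case less
    show ?case
    proof (cases "\<exists>j\<in>{1..n}. j \<noteq> 1 \<and> l \<le> \<beta> j")
      case True
      then obtain j where j: "j \<in> {1..n}" "1 \<noteq> j" "l \<le> \<beta> j" by auto
      define \<gamma> where "\<gamma> = \<beta>(j := \<beta> j - l, 1 := \<beta> 1 + l)"
      have mv: "moves 1 j \<beta> \<gamma>" using j(3) by (simp add: moves_def \<gamma>_def)
      note b = moves_basis[OF mv j(2) one j(1) less.prems(1)]
      have "\<gamma> 1 \<le> (\<Sum>i=1..n. \<gamma> i)" using one by (intro member_le_sum) auto
      then have "\<gamma> 1 \<le> s" using b(1) by (simp add: basis_def)
      then have "s - \<gamma> 1 < s - \<beta> 1" using l_pos by (simp add: \<gamma>_def)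
      then have "mat \<gamma> \<gamma> = mat (compose (res \<gamma>) m) (compose (res \<gamma>) m)"
        using less.hyps b less.prems(2) by simp
      then show ?thesis
        using mat_moves(3)[OF less.prems less.prems(1) refl one j(1,2) mv mv refl] b(2) by simp
    next
      case False
      then have zero: "\<beta> i div l = 0" if "i \<in> {1..n}" "i \<noteq> 1" for i using that by (auto simp: not_le)
      have out: "\<beta> i = 0" if "i \<notin> {1..n}" for i
        using that less.prems(1) by (simp add: basis_def multi_indices_def)
      have "en \<beta> = (\<Sum>i=1..n. if i = 1 then \<beta> 1 div l else 0)"
        unfolding en_def by (intro sum.cong) (auto simp: zero)
      then have one_div: "\<beta> 1 div l = top_en" using less.prems(2) one by simp
      have "\<beta> i = compose (res \<beta>) m i" for i
      proof -
        have "\<beta> i div l = m i"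
          using zero[of i] out[of i] one_div by (cases "i = 1"; cases "i \<in> {1..n}") (auto simp: m_def)
        then show ?thesis using mult_div_mod_eq[of l "\<beta> i"] by (simp add: compose_def res_def)
      qed
      then have "\<beta> = compose (res \<beta>) m" by blast
      then show ?thesis by simp
    qed
  qed
  have \<rho>: "res \<alpha> \<in> Box r" "res \<beta> \<in> Box r" using res_Box_iff[OF _ s] \<alpha> \<beta> by auto
  obtain p where p: "shift_op p (\<lambda>i. int (res \<beta> i) - int (res \<alpha> i))"
    "\<And>\<gamma>. res \<gamma> = res \<alpha> \<Longrightarrow> free_act q p (X \<gamma>) \<noteq> 0"
    using ex_layer_op[OF \<rho>] by blast
  obtain \<gamma> where \<gamma>: "maps_to p (compose (res \<alpha>) m) \<gamma>"
    using p compose_simps(1)[OF \<rho>(1)] shift_op_nz by blast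
  have "int (\<gamma> i) = int (compose (res \<beta>) m i)" for i
    using shift_opD(1)[OF p(1) \<gamma>, of i] by (simp add: compose_def)
  then have "\<gamma> i = compose (res \<beta>) m i" for i by (simp only: of_nat_eq_iff)
  then have \<gamma>': "\<gamma> = compose (res \<beta>) m" by blast
  have "compose (res \<alpha>) m \<in> basis" using compose_basis[OF \<rho>(1) m(1)] s m(2) by simp
  then show ?thesis
    using mat_shift(2)[OF p(1) _ \<gamma> \<gamma> refl] collect[OF \<alpha>] collect[OF \<beta>] unfolding \<gamma>' by simp
qed

text \<open>The scalar \<open>c\<close> decides which summand is everything: for
  \<open>c \<noteq> 0\<close> the vectors \<open>proj (X \<beta>)\<close> of \<open>N\<close>,
  divided by \<open>c\<close>, represent the top layer, and for \<open>c = 0\<close> the vectors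
  \<open>X \<beta> - proj (X \<beta>)\<close> of \<open>L\<close> do.\<close>

lemma summand_trivial: "N = {0} \<or> L = {0}"
proof -
  obtain \<beta>0 where \<beta>0: "\<beta>0 \<in> basis" "en \<beta>0 = top_en"
    using ex_basis_en_iff[of top_en] bot_le_top by auto
  define c where "c = mat \<beta>0 \<beta>0"
  have scalar: "proj (X \<beta>) - scal c (X \<beta>) \<in> D top_en" if \<beta>: "\<beta> \<in> basis" "en \<beta> = top_en" for \<beta>
    unfolding spn_iff
  proof
    fix \<gamma> assume \<gamma>: "\<gamma> \<in> Poly_Mapping.keys (proj (X \<beta>) - scal c (X \<beta>))"
    have "proj (X \<beta>) - scal c (X \<beta>) \<in> V"
      unfolding V_eq[symmetric]
      using submodule_closed(6)[OF submodule_D[of "Suc top_en", unfolded D_top]]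
        submodule_closed(5)[OF submodule_D[of "Suc top_en", unfolded D_top]] proj_V[OF X_V[OF \<beta>(1)]] X_V[OF \<beta>(1)] by metis
    then have B: "\<gamma> \<in> basis" using \<gamma> by (auto simp: V_eq spn_iff)
    have "en \<gamma> \<noteq> top_en"
    proof
      assume en: "en \<gamma> = top_en"
      have "Poly_Mapping.lookup (proj (X \<beta>) - scal c (X \<beta>)) \<gamma> = 0"
      proof (cases "\<gamma> = \<beta>")
        case True
        then show ?thesis
          using mat_diagonal[OF \<beta> \<beta>0] by (simp add: lookup_minus c_def mat_def)
      next
        case False
        then show ?thesis
          using mat_off_diagonal[OF \<beta> B en] by (simp add: lookup_minus lookup_single mat_def)
      qed
      then show False using \<gamma> by (simp add: in_keys_iff)
    qed
    then show "\<gamma> \<in> basis \<and> en \<gamma> < top_en" using B basis_en_bounds(2)[OF B] by simp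
  qed
  \<comment> \<open>Nakayama: a submodule that represents the top layer modulo
    \<open>D top_en\<close> is the whole component.\<close>
  have full: "H = V" if H: "submodule H U M"
    and X: "\<And>\<beta>. \<beta> \<in> basis \<Longrightarrow> en \<beta> = top_en \<Longrightarrow> \<exists>u\<in>H. X \<beta> - u \<in> D top_en" for H
  proof -
    let ?S = "{u + v |u v. u \<in> H \<and> v \<in> D top_en}"
    have "D (Suc top_en) \<subseteq> ?S"
    proof (rule spn_subset[OF submodule_sum[OF H submodule_D]])
      fix \<beta> assume \<beta>: "\<beta> \<in> basis" "en \<beta> < Suc top_en"
      show "X \<beta> \<in> ?S"
      proof (cases "en \<beta> = top_en")
        case True
        then obtain u where "u \<in> H" "X \<beta> - u \<in> D top_en" using X \<beta>(1) by blast
        moreover have "X \<beta> = u + (X \<beta> - u)" by simp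
        ultimately show ?thesis by blast
      next
        case False
        then have "X \<beta> \<in> D top_en" using \<beta> by (simp add: X_spn_iff)
        moreover have "X \<beta> = 0 + X \<beta>" by simp
        ultimately show ?thesis using submodule_closed(2)[OF H] by blast
      qed
    qed
    then have "D (Suc top_en) \<subseteq> H" by (rule D_superfluous[OF H _ \<beta>0])
    then show "H = V" using submodule_closed(1)[OF H] by (simp add: D_top)
  qed
  show ?thesis
  proof (cases "c = 0")
    case False
    have "N = V"
    proof (rule full[OF N])
      fix \<beta> assume \<beta>: "\<beta> \<in> basis" "en \<beta> = top_en"
      have "scal (- inverse c) (proj (X \<beta>) - scal c (X \<beta>)) \<in> D top_en"
        by (rule submodule_closed(5)[OF submodule_D scalar[OF \<beta>]])
      moreover have "scal (- inverse c) (proj (X \<beta>) - scal c (X \<beta>)) = X \<beta> - scal (inverse c) (proj (X \<beta>))"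
        using False by (intro poly_mapping_eqI) (simp add: lookup_minus lookup_single when_def algebra_simps)
      moreover have "scal (inverse c) (proj (X \<beta>)) \<in> N"
        by (rule submodule_closed(5)[OF N proj_props(1)[OF X_V[OF \<beta>(1)]]])
      ultimately show "\<exists>u\<in>N. X \<beta> - u \<in> D top_en" by auto
    qed
    then have "L = {0}" using submodule_closed(1)[OF L] disjoint by blast
    then show ?thesis ..
  next
    case True
    have "L = V"
    proof (rule full[OF L])
      fix \<beta> assume \<beta>: "\<beta> \<in> basis" "en \<beta> = top_en"
      have "X \<beta> - (X \<beta> - proj (X \<beta>)) \<in> D top_en" using scalar[OF \<beta>] True by simp
      then show "\<exists>u\<in>L. X \<beta> - u \<in> D top_en" using proj_props(2)[OF X_V[OF \<beta>(1)]] by blast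
    qed
    then have "N = {0}" using submodule_closed(1)[OF N] disjoint by blast
    then show ?thesis ..
  qed
qed

end

lemma indecomposable: "indecomposable_module U M"
  unfolding indecomposable_module_def
proof (intro conjI notI)
  assume "carrier M = {\<zero>\<^bsub>M\<^esub>}"
  then have "V = {0}" by simp
  moreover obtain \<beta> where "\<beta> \<in> basis" using ex_basis_en_iff[of top_en] bot_le_top by auto
  ultimately have "X \<beta> \<in> {0}" by (metis V_eq X_spn_iff)
  then show False by (simp add: poly_mapping_single_eq_0_iff)
next
  assume "\<exists>N L. submodule N U M \<and> submodule L U M \<and> N \<noteq> {\<zero>\<^bsub>M\<^esub>} \<and> L \<noteq> {\<zero>\<^bsub>M\<^esub>} \<and>
    N \<inter> L = {\<zero>\<^bsub>M\<^esub>} \<and> N <+>\<^bsub>M\<^esub> L = carrier M"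
  then obtain N L where NL: "submodule N U M" "submodule L U M" "N \<noteq> {0}" "L \<noteq> {0}"
    "N \<inter> L = {0}" "N <+>\<^bsub>M\<^esub> L = V"
    by auto
  have "N <+>\<^bsub>M\<^esub> L \<subseteq> {u + v |u v. u \<in> N \<and> v \<in> L}"
    unfolding set_add_def' M_simps by blast
  then have "V \<subseteq> {u + v |u v. u \<in> N \<and> v \<in> L}" unfolding NL(6) .
  then show False using summand_trivial[OF NL(1,2,5)] NL(3,4) by blast
qed

end

theorem corollary3p13:
  fixes q :: "'k::{alg_closed_field, field_char_0}" and n l s :: nat
  assumes "q \<noteq> 0" and "q \<noteq> 1" and "q \<noteq> - 1"
    and "n \<ge> 3"
    and "qchar q = l" and "l \<ge> 3"
  shows "indecomposable_module (small_uq n q l) ((Aq n q)\<lparr>carrier := Aq_homogeneous n s\<rparr>) \<and>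
         rigid_module (small_uq n q l) ((Aq n q)\<lparr>carrier := Aq_homogeneous n s\<rparr>)"
proof -
  interpret homogeneous_component q n l s
    by unfold_locales (use assms in auto)
  show ?thesis using indecomposable rigid by blast
qed

end
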